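(* Let $m\ge2$ be an integer and $w$ an infinite periodic or Sturmian word over $\{0,1\}$ with slope $\pi(w)=\alpha$. Let $A=A(m,w)=A_0\oplus A_1$ be a $\mathbb{Z}_2$-grading on $A$ such that the generators $a,b,z_1^{(1)}$ are homogeneous. Then $\exp^{gr}(A)$ exists and $$\exp^{gr}(A)=\exp(A)=\Phi\Big(\frac1{m+\alpha}\Big),\qquad \Phi(x)=\frac{1}{x^x(1-x)^{1-x}}.$$ Moreover, if $A^\#$ is obtained from $A$ by adjoining an external unit, with the induced $\mathbb{Z}_2$-grading, then $\exp^{gr}(A^\#)$ exists and $\exp^{gr}(A^\#)=\exp^{gr}(A)+1$.
   Context: $F$ is a field of characteristic zero. $A(m,w)$: basis $\{a,b,z_j^{(i)}: i\ge1,1\le j\le m+w_i\}$, products $z_j^{(i)}a=z_{j+1}^{(i)}$ for $j<m+w_i$, $z_{m+w_i}^{(i)}b=z_1^{(i+1)}$, all other products zero; it is generated by $z_1^{(1)},a,b$. A word is Sturmian if it has exactly $n+1$ distinct subwords of length $n$ for all $n\ge1$; slope $\pi(w)=\lim_n (w_1+\dots+w_n)/n$. $\exp(A)=\lim\sqrt[n]{c_n(A)}$ for ordinary codimensions $c_n$. $A^\#=A\oplus F1$ with external unit $1$, graded by $A_0^\#=A_0\oplus F1$, $A_1^\#=A_1$. Graded codimension $c_n^{gr}(B)=\sum_k\binom nk c_{k,n-k}(B)$ where $c_{k,n-k}(B)$ is the dimension of the space of polynomials multilinear in even variables $x_1..x_k$ and odd variables $y_1..y_{n-k}$ modulo graded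 identities of $B$; $\exp^{gr}(B)=\lim\sqrt[n]{c_n^{gr}(B)}$. *)

theory Defs
  imports Complex_Main "HOL-Library.Function_Algebras"
begin

text \<open>An algebra is given by a basis set B of index type 'b and a multiplication table
  mt: the product of basis elements i and j is the basis element k if mt i j = Some k,
  and zero if mt i j = None. Elements are finitely supported coefficient functions 'b => 'a
  with support inside B.\<close>

definition supp :: "('b \<Rightarrow> 'a::zero) \<Rightarrow> 'b set" where
  "supp x = {i. x i \<noteq> 0}"

definition carrier_alg :: "'b set \<Rightarrow> ('b \<Rightarrow> 'a::zero) set" where
  "carrier_alg B = {x. finite (supp x) \<and> supp x \<subseteq> B}"

definition vmul :: "('b \<Rightarrow> 'b \<Rightarrow> 'b option) \<Rightarrow> ('b \<Rightarrow> 'a::field) \<Rightarrow> ('b \<Rightarrow> 'a) \<Rightarrow> ('b \<Rightarrow> 'a)" where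
  "vmul mt x y = (\<lambda>k. \<Sum>i\<in>supp x. \<Sum>j\<in>supp y. if mt i j = Some k then x i * y j else 0)"

definition vscale :: "'a::field \<Rightarrow> ('b \<Rightarrow> 'a) \<Rightarrow> ('b \<Rightarrow> 'a)" where
  "vscale c x = (\<lambda>k. c * x k)"

definition basis_vec :: "'b \<Rightarrow> ('b \<Rightarrow> 'a::field)" where
  "basis_vec i = (\<lambda>k. if k = i then 1 else 0)"

datatype mon = Leaf nat | Node mon mon

fun leaves :: "mon \<Rightarrow> nat list" where
  "leaves (Leaf i) = [i]"
| "leaves (Node s t) = leaves s @ leaves t"

text \<open>Multilinear monomials in the variables 0..n-1 (each variable exactly once);
  they span the space P_n of multilinear polynomials of the free nonassociative algebra.\<close>
definition multilin_mons :: "nat \<Rightarrow> mon set" where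
  "multilin_mons n = {t. distinct (leaves t) \<and> set (leaves t) = {..<n}}"

fun eval_mon :: "('b \<Rightarrow> 'b \<Rightarrow> 'b option) \<Rightarrow> (nat \<Rightarrow> ('b \<Rightarrow> 'a::field)) \<Rightarrow> mon \<Rightarrow> ('b \<Rightarrow> 'a)" where
  "eval_mon mt v (Leaf i) = v i"
| "eval_mon mt v (Node s t) = vmul mt (eval_mon mt v s) (eval_mon mt v t)"

text \<open>The polynomial function induced by a monomial on the admissible substitutions D.
  A multilinear polynomial is a (graded) identity iff its induced function vanishes on D,
  hence P_n modulo identities is isomorphic to the span of these functions.\<close>
definition mon_fun :: "('b \<Rightarrow> 'b \<Rightarrow> 'b option) \<Rightarrow> (nat \<Rightarrow> ('b \<Rightarrow> 'a::field)) set \<Rightarrow> mon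
    \<Rightarrow> ((nat \<Rightarrow> ('b \<Rightarrow> 'a)) \<Rightarrow> ('b \<Rightarrow> 'a))" where
  "mon_fun mt D t = (\<lambda>v. if v \<in> D then eval_mon mt v t else 0)"

definition fscale :: "'a::field \<Rightarrow> ((nat \<Rightarrow> ('b \<Rightarrow> 'a)) \<Rightarrow> ('b \<Rightarrow> 'a)) \<Rightarrow> ((nat \<Rightarrow> ('b \<Rightarrow> 'a)) \<Rightarrow> ('b \<Rightarrow> 'a))" where
  "fscale c f = (\<lambda>v k. c * f v k)"

text \<open>Dimension of P_n (resp. P_{k,n-k}) modulo (graded) identities, where D is the set of
  admissible substitutions of algebra elements for the variables.\<close>
definition codim_on :: "('b \<Rightarrow> 'b \<Rightarrow> 'b option) \<Rightarrow> (nat \<Rightarrow> ('b \<Rightarrow> 'a::field)) set \<Rightarrow> nat \<Rightarrow> nat" where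
  "codim_on mt D n = vector_space.dim fscale (mon_fun mt D ` multilin_mons n)"

definition codim :: "'a::field itself \<Rightarrow> 'b set \<Rightarrow> ('b \<Rightarrow> 'b \<Rightarrow> 'b option) \<Rightarrow> nat \<Rightarrow> nat" where
  "codim (_::'a itself) B mt n =
     codim_on mt {v :: nat \<Rightarrow> ('b \<Rightarrow> 'a). \<forall>i. v i \<in> carrier_alg B} n"

definition codim_gr_kn :: "'b set \<Rightarrow> ('b \<Rightarrow> 'b \<Rightarrow> 'b option) \<Rightarrow> ('b \<Rightarrow> 'a::field) set \<Rightarrow> ('b \<Rightarrow> 'a) set
    \<Rightarrow> nat \<Rightarrow> nat \<Rightarrow> nat" where
  "codim_gr_kn B mt A0 A1 k n =
     codim_on mt {v. (\<forall>i. v i \<in> carrier_alg B) \<and> (\<forall>i<k. v i \<in> A0) \<and> (\<forall>i. k \<le> i \<and> i < n \<longrightarrow> v i \<in> A1)} n"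

definition codim_gr :: "'b set \<Rightarrow> ('b \<Rightarrow> 'b \<Rightarrow> 'b option) \<Rightarrow> ('b \<Rightarrow> 'a::field) set \<Rightarrow> ('b \<Rightarrow> 'a) set
    \<Rightarrow> nat \<Rightarrow> nat" where
  "codim_gr B mt A0 A1 n = (\<Sum>k\<le>n. (n choose k) * codim_gr_kn B mt A0 A1 k n)"

definition subspace_of :: "('b \<Rightarrow> 'a::field) set \<Rightarrow> ('b \<Rightarrow> 'a) set \<Rightarrow> bool" where
  "subspace_of S V \<longleftrightarrow> S \<subseteq> V \<and> 0 \<in> S \<and> (\<forall>x\<in>S. \<forall>y\<in>S. x + y \<in> S) \<and> (\<forall>c. \<forall>x\<in>S. vscale c x \<in> S)"

definition Z2_grading :: "'b set \<Rightarrow> ('b \<Rightarrow> 'b \<Rightarrow> 'b option) \<Rightarrow> ('b \<Rightarrow> 'a::field) set \<Rightarrow> ('b \<Rightarrow> 'a) set \<Rightarrow> bool" where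
  "Z2_grading B mt A0 A1 \<longleftrightarrow>
     subspace_of A0 (carrier_alg B) \<and> subspace_of A1 (carrier_alg B) \<and>
     A0 \<inter> A1 = {0} \<and> (\<forall>x\<in>carrier_alg B. \<exists>x0\<in>A0. \<exists>x1\<in>A1. x = x0 + x1) \<and>
     (\<forall>x\<in>A0. \<forall>y\<in>A0. vmul mt x y \<in> A0) \<and> (\<forall>x\<in>A0. \<forall>y\<in>A1. vmul mt x y \<in> A1) \<and>
     (\<forall>x\<in>A1. \<forall>y\<in>A0. vmul mt x y \<in> A1) \<and> (\<forall>x\<in>A1. \<forall>y\<in>A1. vmul mt x y \<in> A0)"

text \<open>Basis indices: Ga = a, Gb = b, Gz i j = z_j^(i). The word w is w_1 w_2 ... (w 0 unused).\<close>
datatype gen = Ga | Gb | Gz nat nat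

definition basisA :: "nat \<Rightarrow> (nat \<Rightarrow> nat) \<Rightarrow> gen set" where
  "basisA m w = {Ga, Gb} \<union> {Gz i j | i j. 1 \<le> i \<and> 1 \<le> j \<and> j \<le> m + w i}"

fun multA :: "nat \<Rightarrow> (nat \<Rightarrow> nat) \<Rightarrow> gen \<Rightarrow> gen \<Rightarrow> gen option" where
  "multA m w (Gz i j) Ga = (if 1 \<le> i \<and> 1 \<le> j \<and> j < m + w i then Some (Gz i (j+1)) else None)"
| "multA m w (Gz i j) Gb = (if 1 \<le> i \<and> j = m + w i then Some (Gz (i+1) 1) else None)"
| "multA m w _ _ = None"

definition basis_sharp :: "'b set \<Rightarrow> 'b option set" where
  "basis_sharp B = insert None (Some ` B)"

fun mult_sharp :: "('b \<Rightarrow> 'b \<Rightarrow> 'b option) \<Rightarrow> 'b option \<Rightarrow> 'b option \<Rightarrow> 'b option option" where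
  "mult_sharp mt None j = Some j"
| "mult_sharp mt (Some i) None = Some (Some i)"
| "mult_sharp mt (Some i) (Some j) = map_option Some (mt i j)"

definition embed_sharp :: "'a::field \<Rightarrow> ('b \<Rightarrow> 'a) \<Rightarrow> ('b option \<Rightarrow> 'a)" where
  "embed_sharp c x = (\<lambda>k. case k of None \<Rightarrow> c | Some i \<Rightarrow> x i)"

definition even_sharp :: "('b \<Rightarrow> 'a::field) set \<Rightarrow> ('b option \<Rightarrow> 'a) set" where
  "even_sharp A0 = {embed_sharp c x | c x. x \<in> A0}"

definition odd_sharp :: "('b \<Rightarrow> 'a::field) set \<Rightarrow> ('b option \<Rightarrow> 'a) set" where
  "odd_sharp A1 = {embed_sharp 0 x | x. x \<in> A1}"

text \<open>Words are indexed from 1: w 1, w 2, ...\<close>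
definition binary_word :: "(nat \<Rightarrow> nat) \<Rightarrow> bool" where
  "binary_word w \<longleftrightarrow> (\<forall>i\<ge>1. w i \<in> {0,1})"

definition periodic_word :: "(nat \<Rightarrow> nat) \<Rightarrow> bool" where
  "periodic_word w \<longleftrightarrow> (\<exists>p>0. \<forall>i\<ge>1. w (i + p) = w i)"

definition factors :: "(nat \<Rightarrow> nat) \<Rightarrow> nat \<Rightarrow> nat list set" where
  "factors w n = {map w [i..<i+n] | i. i \<ge> 1}"

definition sturmian :: "(nat \<Rightarrow> nat) \<Rightarrow> bool" where
  "sturmian w \<longleftrightarrow> (\<forall>n\<ge>1. finite (factors w n) \<and> card (factors w n) = n + 1)"

definition has_slope :: "(nat \<Rightarrow> nat) \<Rightarrow> real \<Rightarrow> bool" where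
  "has_slope w \<alpha> \<longleftrightarrow> (\<lambda>n. (\<Sum>i=1..n. real (w i)) / real n) \<longlonglongrightarrow> \<alpha>"

definition Phi :: "real \<Rightarrow> real" where
  "Phi x = 1 / (x powr x * (1 - x) powr (1 - x))"

end

theory Submission
  imports Defs
begin

text \<open>
  Ordering the \<open>z\<close>'s as an infinite path turns \<open>A(m,w)\<close> into a path algebra: a nonzero monomial is left-normed,
  its first variable picks a vertex and the others spell a factor \<open>u\<close> of the label word
  \<open>a\<^bsup>m + w 1 - 1\<^esup> b a\<^bsup>m + w 2 - 1\<^esup> b \<dots>\<close>. Its value on \<open>u\<close> depends only on the first variable and on the set
  of variables standing at the letters \<open>b\<close>, so each \<open>u\<close> of length \<open>n - 1\<close> contributes at most, and a single \<open>u\<close> already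
  contributes, \<open>n (n - 1 choose |u|\<^sub>b)\<close> to the codimension. There are only linearly many \<open>u\<close>, and since
  Sturmian words are balanced, \<open>|u|\<^sub>b\<close> is within a constant of \<open>n / (m + \<alpha>)\<close>; the binomial coefficient
  then grows like \<open>\<Phi>\<^sup>n\<close>. In the graded case the positions of the \<open>b\<close>'s determine the parities of
  all variables but the first, so summing over all choices of parities costs at most a factor 2. An external
  unit may replace any set of even variables, which gives \<open>\<Sum>\<^sub>N (n choose N) \<Phi>\<^sup>N = (1 + \<Phi>)\<^sup>n\<close>.
\<close>

section \<open>Sturmian words are balanced\<close>

text \<open>The obstacle is the free bracketing together with the unit: any subset of the variables
  may turn into 1 at any place. It is tamed by the fact that neither \<open>a\<close> nor
  \<open>b\<close> is a product. A right factor acts on a \<open>z\<close> only through its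
  coordinates at \<open>a\<close> and \<open>b\<close>, so it contributes exactly one variable while
  its other variables become 1; a bracketing thereby reduces to the list \<open>paths\<close>. The
  algebra without unit is the case of substitutions with unit component 0
  (\<open>codim_embed\<close>), so one upper and one lower bound serve all three codimension
  sequences.

  For the lower bound, one path has to be separated from the paths shortened by units. The unit
  variables are placed on the left, where they create only paths of at most two variables; hence the
  recurring threshold 3.

  The number of compatible triples is not evaluated for a single k: the weight
  \<open>n choose k\<close> counts the sets of even variables, so the weighted sum counts pairs of a
  triple and a compatible even set. Binomial coefficients are estimated through the binomial
  distribution with parameter 1 / (m + \<alpha>), without Stirling's formula.\<close>

definition win :: "(nat \<Rightarrow> 'a) \<Rightarrow> nat \<Rightarrow> nat \<Rightarrow> 'a list" where
  "win x n i = map x [i..<i+n]"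

lemma length_win [simp]: "length (win x n i) = n"
  by (simp add: win_def)

lemma win_eq_iff: "win x n i = win x n j \<longleftrightarrow> (\<forall>k<n. x (i+k) = x (j+k))"
  by (auto simp: win_def list_eq_iff_nth_eq)

lemma win_Suc: "win x (Suc n) i = win x n i @ [x (i+n)]"
  by (simp add: win_def)

lemma win_0 [simp]: "win x 0 i = []"
  by (simp add: win_def)

lemma win_Suc_left: "win x (Suc n) i = x i # win x n (Suc i)"
  by (simp add: win_def upt_conv_Cons del: upt_Suc)

text \<open>Right special factors of combinatorics on words, attached to an occurrence
  \<open>i\<close> instead of to the factor itself.\<close>

definition special :: "(nat \<Rightarrow> 'a) \<Rightarrow> nat \<Rightarrow> nat \<Rightarrow> bool" where
  "special x n i \<longleftrightarrow> (\<exists>j. win x n j = win x n i \<and> x (j+n) \<noteq> x (i+n))"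

lemma special_cong:
  assumes "win x n i = win x n j" "\<not> special x n i"
  shows "\<not> special x n j" "x (i+n) = x (j+n)" "win x n (Suc i) = win x n (Suc j)"
proof -
  show eq: "x (i+n) = x (j+n)" using assms unfolding special_def by metis
  show "\<not> special x n j" using assms eq unfolding special_def by metis
  have "win x (Suc n) i = win x (Suc n) j" using assms eq by (simp add: win_Suc)
  then show "win x n (Suc i) = win x n (Suc j)" by (simp add: win_Suc_left)
qed

text \<open>\<open>e\<close> selects one right extension for each factor of length \<open>n\<close>
  and is injective. Every right special factor has a further extension outside the image of
  \<open>e\<close>, and a complexity jump of one leaves room for only one such extension.\<close>

lemma special_unique:
  assumes fin: "finite (range (win x (Suc n)))"
    and card: "card (range (win x (Suc n))) = Suc (card (range (win x n)))"
    and sp: "special x n i" "special x n i'"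
  shows "win x n i = win x n i'"
proof (rule ccontr)
  assume ne: "win x n i \<noteq> win x n i'"
  define e where "e y = win x (Suc n) (SOME j. win x n j = y)" for y
  have e: "butlast (e y) = y" if "y \<in> range (win x n)" for y
  proof -
    have "win x n (SOME j. win x n j = y) = y" using that by (metis (mono_tags, lifting) imageE someI)
    then show ?thesis by (simp add: e_def win_Suc)
  qed
  have other: "\<exists>z. z \<in> range (win x (Suc n)) \<and> butlast z = win x n i \<and> z \<notin> e ` range (win x n)"
    if "special x n i" for i
  proof -
    from that obtain j where j: "win x n j = win x n i" "x (j+n) \<noteq> x (i+n)" unfolding special_def by blast
    have "win x (Suc n) j \<noteq> win x (Suc n) i" using j by (simp add: win_Suc)
    then obtain k where k: "win x n k = win x n i" "win x (Suc n) k \<noteq> e (win x n i)" using j by metis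
    have "win x (Suc n) k \<notin> e ` range (win x n)"
    proof
      assume "win x (Suc n) k \<in> e ` range (win x n)"
      then obtain y where y: "y \<in> range (win x n)" "win x (Suc n) k = e y" by auto
      have "y = win x n k" using e[OF y(1)] y(2) by (simp add: win_Suc[of x n k] flip: y(2))
      then show False using k y by simp
    qed
    moreover have "butlast (win x (Suc n) k) = win x n i" using k by (simp add: win_Suc)
    ultimately show ?thesis by blast
  qed
  obtain z where z: "z \<in> range (win x (Suc n))" "butlast z = win x n i" "z \<notin> e ` range (win x n)"
    using other sp by metis
  obtain z' where z': "z' \<in> range (win x (Suc n))" "butlast z' = win x n i'" "z' \<notin> e ` range (win x n)"
    using other sp by metis
  have zz: "z \<noteq> z'" using z z' ne by auto
  have inj: "inj_on e (range (win x n))" by (rule inj_on_inverseI[of _ butlast]) (rule e)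
  have sub: "insert z (insert z' (e ` range (win x n))) \<subseteq> range (win x (Suc n))"
    using z z' by (auto simp: e_def)
  have fe: "finite (e ` range (win x n))" using sub fin finite_subset by (metis finite_insert)
  have "card (insert z (insert z' (e ` range (win x n)))) = Suc (Suc (card (range (win x n))))"
    using fe zz z z' inj by (simp add: card_image)
  then show False using card_mono[OF fin sub] card by simp
qed

lemma finite_range_win_eventually_periodic:
  assumes "p > 0" "\<And>i. i \<ge> k \<Longrightarrow> x (i+p) = x i"
  shows "range (win x n) = win x n ` {..<k+p}"
proof -
  have "win x n i \<in> win x n ` {..<k+p}" for i
  proof (induction i rule: less_induct)
    case (less i)
    show ?case
    proof (cases "i < k + p")
      case False
      have "win x n i = win x n (i - p)" unfolding win_eq_iff
      proof (intro allI impI)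
        fix l assume "l < n"
        show "x (i + l) = x (i - p + l)" using assms(2)[of "i - p + l"] False by simp
      qed
      then show ?thesis using less[of "i-p"] False assms(1) by simp
    qed auto
  qed
  then show ?thesis by auto
qed

text \<open>The easy half of the Morse-Hedlund theorem: eventual periodicity bounds the complexity,
  so a word with n + 1 factors of each length n cannot be eventually periodic.\<close>

lemma card_range_win_eventually_periodic:
  assumes "p > 0" "\<And>i. i \<ge> k \<Longrightarrow> x (i+p) = x i"
  shows "card (range (win x n)) \<le> k + p"
proof -
  have "card (range (win x n)) = card (win x n ` {..<k+p})"
    by (rule arg_cong[where f=card], rule finite_range_win_eventually_periodic) (use assms in auto)
  also have "\<dots> \<le> k + p" using card_image_le[of "{..<k+p}" "win x n"] by simp
  finally show ?thesis .
qed

text \<open>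
  If \<open>c u c\<close> and \<open>d u d\<close> occur with \<open>u\<close> a palindrome and \<open>c u\<close> were not right special, then \<open>d u\<close> would be
  the only right special factor of its length. It does not occur in the windows starting at the first
  \<open>|u| + 2\<close> positions of \<open>c u c\<close>, so two of these windows agree and the word would be eventually periodic.
\<close>

lemma unbalanced_extension_special:
  fixes x :: "nat \<Rightarrow> nat"
  assumes compl: "\<And>n. finite (range (win x n)) \<and> card (range (win x n)) = Suc n"
    and ce: "c \<noteq> d" "x j = c" "x (j + Suc r) = c" "x i = d" "x (i + Suc r) = d"
    and bin: "\<And>k. x k = c \<or> x k = d"
    and eq: "\<And>k. k < r \<Longrightarrow> x (j + Suc k) = x (i + Suc k)"
    and pal: "\<And>k. k < r \<Longrightarrow> x (j + Suc k) = x (j + (r - k))"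
  shows "special x (Suc r) j"
proof (rule ccontr)
  assume ns: "\<not> special x (Suc r) j"
  have uniq: "win x n k = win x n l" if "special x n k" "special x n l" for n k l
    using special_unique[of x n k l] compl that by simp
  have weq: "win x r (Suc j) = win x r (Suc i)" using eq by (simp add: win_eq_iff)
  have spw: "special x r (Suc i)" unfolding special_def using weq ce by (auto intro!: exI[of _ "Suc j"])
  have spe: "win x (Suc r) l = win x (Suc r) i" if "special x (Suc r) l" for l
  proof -
    from that obtain l' where l': "win x (Suc r) l' = win x (Suc r) l" "x (l' + Suc r) \<noteq> x (l + Suc r)"
      unfolding special_def by blast
    have "special x r (Suc l)" unfolding special_def using l' by (auto simp: win_Suc_left intro!: exI[of _ "Suc l'"])
    then have 1: "win x r (Suc l) = win x r (Suc i)" using uniq spw by blast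
    have "x l \<noteq> c"
    proof
      assume "x l = c"
      then have "win x (Suc r) j = win x (Suc r) l" using 1 weq ce by (simp add: win_Suc_left)
      then show False using special_cong(1)[OF _ ns] that by blast
    qed
    then have "x l = d" using bin by blast
    then show ?thesis using 1 ce by (simp add: win_Suc_left)
  qed
  \<comment> \<open>An occurrence of \<open>d u\<close> at offset \<open>t\<close> would place
    \<open>d\<close> at that offset of \<open>c u c\<close>, and would match the final
    \<open>c\<close> with the letter of \<open>u\<close> at the mirrored place. The palindrome
    carries this \<open>c\<close> back to offset \<open>t\<close>.\<close>
  have avoid: "win x (Suc r) (j+t) \<noteq> win x (Suc r) i" if "t \<le> Suc r" for t
  proof
    assume "win x (Suc r) (j+t) = win x (Suc r) i"
    then have h: "\<And>k. k \<le> r \<Longrightarrow> x (j + t + k) = x (i+k)" by (auto simp: win_eq_iff)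
    have 0: "x (j+t) = d" using h[of 0] ce by simp
    then have "t \<noteq> 0" "t \<noteq> Suc r" using ce by (auto intro: ccontr)
    with that obtain s where s: "t = Suc s" "s < r" by (cases t) auto
    have "x (j + t + (r - s)) = x (i + (r - s))" by (rule h) simp
    then have "x (i + (r - s)) = c" using s ce by simp
    moreover have "x (j + (r - s)) = x (i + (r - s))" using eq[of "r - Suc s"] s by (simp add: Suc_diff_Suc)
    ultimately have "x (j + t) = c" using pal[of s] s by simp
    then show False using 0 ce by simp
  qed
  have ns': "\<not> special x (Suc r) (j+t)" if "t \<le> Suc r" for t using avoid spe that by blast
  \<comment> \<open>Pigeonhole: r + 2 starting positions, but of the r + 2 factors of length r + 1
    the one at \<open>i\<close> is excluded.\<close>
  have "\<not> inj_on (\<lambda>t. win x (Suc r) (j+t)) {..Suc r}"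
  proof
    assume inj: "inj_on (\<lambda>t. win x (Suc r) (j+t)) {..Suc r}"
    have "(\<lambda>t. win x (Suc r) (j+t)) ` {..Suc r} \<subseteq> range (win x (Suc r)) - {win x (Suc r) i}"
      using avoid by auto
    then have "card ((\<lambda>t. win x (Suc r) (j+t)) ` {..Suc r}) \<le> card (range (win x (Suc r)) - {win x (Suc r) i})"
      using compl by (intro card_mono) auto
    then show False using card_image[OF inj] compl[of "Suc r"] by simp
  qed
  then obtain s t where st: "s < t" "t \<le> Suc r" "win x (Suc r) (j+s) = win x (Suc r) (j+t)"
    unfolding inj_on_def by (metis atMost_iff nat_neq_iff)
  define p where "p = t - s"
  have p: "p > 0" using st p_def by simp
  \<comment> \<open>A window that is not special determines the next one, so the coincidence of the
    windows at \<open>j+s\<close> and \<open>j+t\<close> propagates. The first \<open>p\<close>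
    windows are not special by \<open>ns'\<close>, the later ones because they repeat earlier
    ones.\<close>
  have per: "win x (Suc r) (j+s+a) = win x (Suc r) (j+s+a+p) \<and> \<not> special x (Suc r) (j+s+a)" for a
  proof (induction a rule: less_induct)
    case (less a)
    have "win x (Suc r) (j+s+a) = win x (Suc r) (j+s+a+p)"
    proof (cases a)
      case 0
      then show ?thesis using st p_def by simp
    next
      case (Suc b)
      then show ?thesis using less[of b] special_cong(3)[of x "Suc r" "j+s+b" "j+s+b+p"] by simp
    qed
    moreover have "\<not> special x (Suc r) (j+s+a)"
    proof (cases "a < p")
      case True
      then show ?thesis using ns'[of "s+a"] st p_def by (simp add: add.assoc)
    next
      case False
      then show ?thesis using less[of "a-p"] p special_cong(1)[of x "Suc r" "j+s+(a-p)" "j+s+a"] by simp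
    qed
    ultimately show ?case by simp
  qed
  have xp: "x (a + p) = x a" if "a \<ge> j+s" for a
    using per[of "a - (j+s)"] that by (auto simp: win_eq_iff dest: spec[of _ 0])
  have "card (range (win x (j+s+p))) \<le> j+s+p"
    by (rule card_range_win_eventually_periodic[where k="j+s" and p=p and x=x, OF p xp])
  then show False using compl[of "j+s+p"] by simp
qed

text \<open>A shortest pair of windows whose sums differ by 2 has the form 1 u 1 and 0 u 0, and
  minimality forces u to be a palindrome. By \<open>unbalanced_extension_special\<close>, used once
  with each letter, both 1 u and 0 u are right special, against
  \<open>special_unique\<close>.\<close>

lemma sturmian_complexity_balanced:
  fixes x :: "nat \<Rightarrow> nat"
  assumes compl: "\<And>n. finite (range (win x n)) \<and> card (range (win x n)) = Suc n"
    and bin: "\<And>k. x k \<in> {0,1}"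
  shows "(\<Sum>k<n. x (j+k)) \<le> Suc (\<Sum>k<n. x (i+k))"
proof (induction n arbitrary: i j rule: less_induct)
  case (less n)
  note shorter = less.IH
  define D where "D k = int (\<Sum>l<k. x (j+l)) - int (\<Sum>l<k. x (i+l))" for k
  have split: "(\<Sum>l<k+d. x (a+l)) = (\<Sum>l<k. x (a+l)) + (\<Sum>l<d. x (a+k+l))" for a k d
    by (induction d) (simp_all add: ac_simps)
  show ?case
  proof (rule ccontr)
    assume "\<not> ?case"
    then have Dn: "D n \<ge> 2" unfolding D_def by linarith
    have D1: "D k \<le> 1" if "k < n" for k using less[OF that, of j i] unfolding D_def by linarith
    have D2: "D n - D k \<le> 1" if "0 < k" "k \<le> n" for k
    proof -
      have e: "(\<Sum>l<n. x (a+l)) = (\<Sum>l<k. x (a+l)) + (\<Sum>l<n-k. x (a+k+l))" for a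
        using split[of a k "n-k"] that by (simp only: le_add_diff_inverse)
      have "n - k < n" using that by simp
      then show ?thesis using less[of "n-k" "j+k" "i+k"] e[of i] e[of j] unfolding D_def by linarith
    qed
    \<comment> \<open>Proper prefixes and suffixes are shorter windows, hence balanced. A total
      excess of 2 then splits as 1 gained at the first letter and 1 at the last, so the windows
      agree in between.\<close>
    have Dk: "D k = 1" if "0 < k" "k < n" for k using D1[of k] D2[of k] Dn that by simp
    have DS: "D (Suc k) - D k = int (x (j+k)) - int (x (i+k))" for k by (simp add: D_def)
    have D0: "D 0 = 0" by (simp add: D_def)
    have xb: "x k \<le> 1" for k using bin[of k] by auto
    have "n \<noteq> 0" using Dn D0 by (intro notI) simp
    moreover have "n \<noteq> 1" using Dn D0 DS[of 0] xb[of j] by (intro notI) simp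
    ultimately obtain r where r: "n = Suc (Suc r)" by (metis One_nat_def not0_implies_Suc)
    have first: "x j = 1" "x i = 0" using DS[of 0] D0 Dk[of 1] r xb[of j] by auto
    have last: "x (j + Suc r) = 1" "x (i + Suc r) = 0"
      using DS[of "Suc r"] Dn Dk[of "Suc r"] r xb[of "j + Suc r"] by auto
    have mid: "x (j + Suc k) = x (i + Suc k)" if "k < r" for k
      using DS[of "Suc k"] Dk[of "Suc k"] Dk[of "Suc (Suc k)"] r that by simp
    have pal: "x (j + Suc k) = x (j + (r - k))" if "k < r" for k
      using that
    proof (induction k rule: less_induct)
      case (less k)
      note IH = less.IH and kr = less.prems
      show ?case
      proof (rule ccontr)
        assume ne: "\<not> ?case"
        \<comment> \<open>The common prefix of length k before the first mismatch, extended on both sides, gives a shorter unbalanced pair.\<close>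
        have shift: "x (a + (r - k + Suc l)) = x (a' + Suc (k - Suc l))"
          if "l < k" "a = i \<or> a = j" "a' = i \<or> a' = j" for a a' l
        proof -
          have "x (j + Suc (k - Suc l)) = x (j + (r - (k - Suc l)))" using IH[of "k - Suc l"] that kr by simp
          moreover have "r - (k - Suc l) = r - k + Suc l" using that kr by simp
          moreover have "x (j + (r - k + Suc l)) = x (i + (r - k + Suc l))" using mid[of "r - k + l"] that kr by simp
          moreover have "x (j + Suc (k - Suc l)) = x (i + Suc (k - Suc l))" using mid[of "k - Suc l"] that kr by simp
          ultimately show ?thesis using that by auto
        qed
        have inner: "(\<Sum>l<k. x (a + (r - k + Suc l))) = (\<Sum>l<k. x (a' + Suc l))"
          if "a = i \<or> a = j" "a' = i \<or> a' = j" for a a'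
        proof -
          have "(\<Sum>l<k. x (a + (r - k + Suc l))) = (\<Sum>l<k. x (a' + Suc (k - Suc l)))"
            by (intro sum.cong refl shift that) simp
          also have "\<dots> = (\<Sum>l<k. x (a' + Suc l))" by (rule sum.nat_diff_reindex)
          finally show ?thesis .
        qed
        have ends: "(\<Sum>l<Suc (Suc k). x (a + l)) = x a + (\<Sum>l<k. x (a + Suc l)) + x (a + Suc k)" for a
          using sum.lessThan_Suc_shift[of "\<lambda>l. x (a+l)" "Suc k"] by simp
        have ends': "(\<Sum>l<Suc (Suc k). x (a + (r - k) + l)) = x (a + (r - k)) + (\<Sum>l<k. x (a + (r - k + Suc l))) + x (a + Suc r)" for a
          using ends[of "a + (r - k)"] kr by (simp add: add.assoc)
        have mk: "x (i + Suc k) = x (j + Suc k)" "x (i + (r - k)) = x (j + (r - k))"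
          using mid[of k] mid[of "r - Suc k"] kr by (simp_all add: Suc_diff_Suc)
        show False
        proof (cases "x (j + Suc k) = 0")
          case True
          then have "x (j + (r - k)) = 1" using ne bin[of "j + (r-k)"] by auto
          moreover have "(\<Sum>l<Suc (Suc k). x (j + (r - k) + l)) \<le> Suc (\<Sum>l<Suc (Suc k). x (i + l))"
            by (rule shorter) (use kr r in simp)
          ultimately show False using inner[of j i] ends[of i] ends'[of j] True mk first last by linarith
        next
          case False
          then have 1: "x (j + Suc k) = 1" using bin[of "j + Suc k"] by auto
          then have "x (j + (r - k)) = 0" using ne bin[of "j + (r-k)"] by auto
          moreover have "(\<Sum>l<Suc (Suc k). x (j + l)) \<le> Suc (\<Sum>l<Suc (Suc k). x (i + (r - k) + l))"
            by (rule shorter) (use kr r in simp)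
          ultimately show False using inner[of i j] ends[of j] ends'[of i] 1 mk first last by linarith
        qed
      qed
    qed
    have pali: "x (i + Suc k) = x (i + (r - k))" if "k < r" for k
      using pal[OF that] mid[OF that] mid[of "r - Suc k"] that by (simp add: Suc_diff_Suc)
    have b: "x k = 1 \<or> x k = 0" "x k = 0 \<or> x k = 1" for k using bin[of k] by auto
    have "special x (Suc r) j"
      by (rule unbalanced_extension_special[where c=1 and d=0 and i=i]) (use compl first last mid pal b in auto)
    moreover have "special x (Suc r) i"
      by (rule unbalanced_extension_special[where c=0 and d=1 and i=j]) (use compl first last mid pali b in auto)
    ultimately have "win x (Suc r) i = win x (Suc r) j"
      using special_unique[of x "Suc r" i j] compl by simp
    then show False using first by (simp add: win_Suc_left)
  qed
qed

lemma factors_eq_range_win: "factors w n = range (win (\<lambda>k. w (Suc k)) n)"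
proof -
  have "map w [Suc i..<Suc i+n] = win (\<lambda>k. w (Suc k)) n i" for i
    by (simp add: win_def list_eq_iff_nth_eq del: upt_Suc)
  moreover have "factors w n = (\<lambda>i. map w [i..<i+n]) ` {Suc 0..}" by (auto simp: factors_def)
  moreover have "{Suc 0..} = range Suc" using Suc_le_D by fastforce
  ultimately show ?thesis by (simp only: image_image)
qed

lemma sum_list_win: "sum_list (win x n i) = (\<Sum>k<n. x (i+k))"
  by (induction n) (simp_all add: win_Suc)

text \<open>A prefix of length \<open>q * n\<close> is cut into \<open>q\<close> blocks of length
  \<open>n\<close>. Each block sum is within \<open>C\<close> of the given one, hence so is their
  mean, and that mean tends to \<open>n * \<alpha>\<close> as \<open>q\<close> grows.\<close>

lemma discrepancy_of_uniform:
  fixes x :: "nat \<Rightarrow> nat"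
  assumes unif: "\<And>i j n. real (\<Sum>k<n. x (j+k)) \<le> C + real (\<Sum>k<n. x (i+k))"
    and slope: "(\<lambda>n. real (\<Sum>k<n. x k) / real n) \<longlonglongrightarrow> \<alpha>"
  shows "\<bar>real (\<Sum>k<n. x (i+k)) - real n * \<alpha>\<bar> \<le> C"
proof (cases "n = 0")
  case True
  then show ?thesis using unif[where n=0] by simp
next
  case False
  define S where "S j = real (\<Sum>k<n. x (j+k))" for j
  have dec: "real (\<Sum>k<q*n. x k) = (\<Sum>l<q. S (l*n))" for q
  proof (induction q)
    case (Suc q)
    have "(\<Sum>k<q*n+d. x k) = (\<Sum>k<q*n. x k) + (\<Sum>k<d. x (q*n+k))" for d by (induction d) simp_all
    from this[of n] show ?case using Suc by (simp add: S_def add.commute)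
  qed simp
  have SS: "S j \<le> S i + C" "S i - C \<le> S j" for i j
    unfolding S_def using unif[where i=i and j=j and n=n] unif[where i=j and j=i and n=n] by linarith+
  have up: "(\<Sum>l<q. S (l*n)) \<le> real q * (S i + C)" for q
    using sum_bounded_above[of "{..<q}" "\<lambda>l. S (l*n)" "S i + C"] SS by simp
  have lo: "real q * (S i - C) \<le> (\<Sum>l<q. S (l*n))" for q
    using sum_bounded_below[of "{..<q}" "S i - C" "\<lambda>l. S (l*n)"] SS by simp
  have "(\<lambda>q. real (\<Sum>k<q*n. x k) / real (q*n)) \<longlonglongrightarrow> \<alpha>"
    by (rule filterlim_compose[OF slope]) (use False in \<open>simp add: mult_nat_right_at_top\<close>)
  \<comment> \<open>The shift to \<open>Suc q\<close> keeps the divisor nonzero in the two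
    comparisons below.\<close>
  then have lim: "(\<lambda>q. real (\<Sum>k<Suc q*n. x k) / real (Suc q*n)) \<longlonglongrightarrow> \<alpha>"
    by (rule LIMSEQ_Suc)
  have "\<alpha> \<le> (S i + C) / real n"
  proof (rule LIMSEQ_le_const2[OF lim], intro exI allI impI)
    fix q :: nat
    have e: "(real (Suc q) * (S i + C)) / (real (Suc q) * real n) = (S i + C) / real n"
      by (rule mult_divide_mult_cancel_left) simp
    then show "real (\<Sum>k<Suc q*n. x k) / real (Suc q*n) \<le> (S i + C) / real n"
      using divide_right_mono[OF up[of "Suc q"], of "real (Suc q) * real n"] unfolding dec of_nat_mult e
      by (simp only: zero_le_mult_iff of_nat_0_le_iff simp_thms)
  qed
  moreover have "(S i - C) / real n \<le> \<alpha>"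
  proof (rule LIMSEQ_le_const[OF lim], intro exI allI impI)
    fix q :: nat
    have e: "(real (Suc q) * (S i - C)) / (real (Suc q) * real n) = (S i - C) / real n"
      by (rule mult_divide_mult_cancel_left) simp
    then show "(S i - C) / real n \<le> real (\<Sum>k<Suc q*n. x k) / real (Suc q*n)"
      using divide_right_mono[OF lo[of "Suc q"], of "real (Suc q) * real n"] unfolding dec of_nat_mult e
      by (simp only: zero_le_mult_iff of_nat_0_le_iff simp_thms)
  qed
  ultimately show ?thesis using False unfolding S_def by (simp add: field_simps abs_le_iff)
qed

text \<open>Every window equals one that starts before \<open>p\<close>, and sliding that one to
  position 0 changes its sum by at most \<open>p\<close>. Two windows are compared, hence
  \<open>2 * p\<close>.\<close>

lemma periodic_uniform:
  fixes x :: "nat \<Rightarrow> nat"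
  assumes per: "p > 0" "\<And>i. x (i+p) = x i" and bin: "\<And>i. x i \<le> 1"
  shows "(\<Sum>k<n. x (j+k)) \<le> 2 * p + (\<Sum>k<n. x (i+k))"
proof -
  have rep: "\<exists>i'<p. (\<Sum>k<n. x (i'+k)) = (\<Sum>k<n. x (i+k))" for i
  proof -
    have "win x n i \<in> win x n ` {..<0+p}"
      using finite_range_win_eventually_periodic[of p 0 x n] per by auto
    then show ?thesis by (auto simp flip: sum_list_win)
  qed
  have split: "(\<Sum>k<a. x k) + (\<Sum>k<b. x (a+k)) = (\<Sum>k<a+b. x k)" for a b by (induction b) simp_all
  have le: "(\<Sum>k<a. x (b+k)) \<le> a" for a b using sum_bounded_above[of "{..<a}" "\<lambda>k. x (b+k)" 1] bin by simp
  have near: "(\<Sum>k<n. x (i+k)) \<le> p + (\<Sum>k<n. x k)" "(\<Sum>k<n. x k) \<le> p + (\<Sum>k<n. x (i+k))" if "i < p" for i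
    using split[of i n] split[of n i] le[of 0 i] le[of n i] that by (simp_all add: add.commute)
  obtain i' j' where "i' < p" "(\<Sum>k<n. x (i'+k)) = (\<Sum>k<n. x (i+k))"
    "j' < p" "(\<Sum>k<n. x (j'+k)) = (\<Sum>k<n. x (j+k))" using rep by meson
  then show ?thesis using near[of i'] near[of j'] by simp
qed

text \<open>The only place where the alternative periodic or Sturmian enters. What is kept of it is
  bounded discrepancy from the slope and complexity at most n plus a constant, the constant being
  the period or 1.\<close>

lemma word_regularity:
  assumes bw: "binary_word w" and ps: "periodic_word w \<or> sturmian w" and sl: "has_slope w \<alpha>"
  obtains C q where "\<And>i n. \<bar>real (\<Sum>k<n. w (Suc (i+k))) - real n * \<alpha>\<bar> \<le> C"
    "\<And>n. finite (range (win (\<lambda>k. w (Suc k)) n))"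
    "\<And>n. card (range (win (\<lambda>k. w (Suc k)) n)) \<le> n + q"
proof -
  define x where "x = (\<lambda>k. w (Suc k))"
  have bin: "x k \<in> {0,1}" for k using bw unfolding binary_word_def x_def by auto
  then have bin1: "x k \<le> 1" for k by (metis insert_iff le_numeral_extra(4) empty_iff zero_le_one)
  have "(\<Sum>i=1..n. real (w i)) = real (\<Sum>k<n. x k)" for n
    by (simp add: x_def sum.atLeast1_atMost_eq)
  then have slope: "(\<lambda>n. real (\<Sum>k<n. x k) / real n) \<longlonglongrightarrow> \<alpha>"
    using sl unfolding has_slope_def by simp
  have "\<exists>C q. (\<forall>i j n. real (\<Sum>k<n. x (j+k)) \<le> C + real (\<Sum>k<n. x (i+k))) \<and>
      (\<forall>n. finite (range (win x n)) \<and> card (range (win x n)) \<le> n + q)"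
  proof (rule disjE[OF ps])
    assume "periodic_word w"
    then obtain p where p0: "p > 0" and pw: "\<forall>i\<ge>1. w (i + p) = w i" unfolding periodic_word_def by blast
    have p: "p > 0" "x (i+p) = x i" for i using p0 pw[rule_format, of "Suc i"] by (simp_all add: x_def)
    have "\<forall>n. finite (range (win x n)) \<and> card (range (win x n)) \<le> n + p"
      using finite_range_win_eventually_periodic[of p 0 x] card_range_win_eventually_periodic[of p 0 x] p
      by (auto intro: trans_le_add2)
    moreover have "\<forall>i j n. real (\<Sum>k<n. x (j+k)) \<le> real (2*p) + real (\<Sum>k<n. x (i+k))"
      unfolding of_nat_add[symmetric] of_nat_le_iff by (intro allI periodic_uniform p bin1)
    ultimately show ?thesis by blast
  next
    assume st: "sturmian w"
    have compl: "finite (range (win x n)) \<and> card (range (win x n)) = Suc n" for n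
    proof (cases "n = 0")
      case True
      have "range (win x 0) = {[]}" by auto
      then show ?thesis using True by simp
    next
      case False
      then show ?thesis using st unfolding sturmian_def factors_eq_range_win x_def by simp
    qed
    have "\<forall>i j n. real (\<Sum>k<n. x (j+k)) \<le> real 1 + real (\<Sum>k<n. x (i+k))"
      unfolding of_nat_add[symmetric] of_nat_le_iff plus_1_eq_Suc
      by (intro allI sturmian_complexity_balanced compl bin)
    moreover have "\<forall>n. finite (range (win x n)) \<and> card (range (win x n)) \<le> n + 1" using compl by simp
    ultimately show ?thesis by blast
  qed
  then obtain C q where Cq: "\<And>i j n. real (\<Sum>k<n. x (j+k)) \<le> C + real (\<Sum>k<n. x (i+k))"
      "\<And>n. finite (range (win x n))" "\<And>n. card (range (win x n)) \<le> n + q" by blast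
  show thesis
    by (rule that[of C q]) (use discrepancy_of_uniform[of x C, OF Cq(1) slope] Cq in \<open>auto simp: x_def\<close>)
qed

lemma slope_nonneg: "has_slope w \<alpha> \<Longrightarrow> \<alpha> \<ge> 0"
  unfolding has_slope_def by (rule LIMSEQ_le_const) (auto intro!: divide_nonneg_nonneg sum_nonneg)

section \<open>Growth of binomial coefficients\<close>

lemma Phi_ge_1:
  assumes "0 < x" "x < 1" shows "Phi x \<ge> 1"
proof -
  have "x powr x \<le> 1" "(1-x) powr (1-x) \<le> 1" using assms by (auto intro!: powr_le1)
  then have "x powr x * (1-x) powr (1-x) \<le> 1" by (intro mult_le_one) auto
  moreover have "x powr x * (1-x) powr (1-x) > 0" using assms by simp
  ultimately show ?thesis unfolding Phi_def by simp
qed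

lemma binomial_ratio: "Suc k * (n choose Suc k) = (n - k) * (n choose k)"
  by (simp only: binomial_absorption binomial_absorb_comp)

lemma binomial_step:
  "n choose Suc k \<le> n * (n choose k)" "k < n \<Longrightarrow> n choose k \<le> n * (n choose Suc k)"
proof -
  have eq: "Suc k * (n choose Suc k) = (n - k) * (n choose k)"
    by (rule binomial_ratio)
  have "n choose Suc k \<le> Suc k * (n choose Suc k)" by simp
  also have "\<dots> \<le> n * (n choose k)" unfolding eq by (intro mult_right_mono) auto
  finally show "n choose Suc k \<le> n * (n choose k)" .
  assume "k < n"
  then have "n choose k \<le> (n - k) * (n choose k)" by simp
  also have "\<dots> \<le> n * (n choose Suc k)" unfolding eq[symmetric] using \<open>k < n\<close> by (intro mult_right_mono) auto
  finally show "n choose k \<le> n * (n choose Suc k)" .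
qed

text \<open>Each step from \<open>k\<close> towards \<open>l\<close> costs a factor of at most
  \<open>n\<close>, by \<open>binomial_step\<close>.\<close>

lemma binomial_nearby:
  assumes "n \<ge> 1" "k \<le> n" "l \<le> n" "k \<le> l + d" "l \<le> k + d"
  shows "n choose k \<le> n ^ d * (n choose l)"
  using assms(2-)
proof (induction d arbitrary: k)
  case (Suc d)
  consider "l = k" | "l < k" | "k < l" by linarith
  then show ?case
  proof cases
    case 1
    then show ?thesis using assms(1) by simp
  next
    case 2
    then obtain k' where k: "k = Suc k'" by (cases k) auto
    have "n choose k \<le> n * (n choose k')" using binomial_step(1) k by simp
    also have "\<dots> \<le> n * (n ^ d * (n choose l))" using Suc 2 k by (intro mult_left_mono Suc.IH) auto
    finally show ?thesis by (simp add: mult.assoc)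
  next
    case 3
    have "n choose k \<le> n * (n choose Suc k)" using binomial_step(2) 3 Suc.prems by simp
    also have "\<dots> \<le> n * (n ^ d * (n choose l))" using Suc 3 by (intro mult_left_mono Suc.IH) auto
    finally show ?thesis by (simp add: mult.assoc)
  qed
qed simp

text \<open>\<open>Phi \<theta>\<close> is the exponential of the entropy of \<theta>. Hence the
  product of the weight and \<open>Phi \<theta> ^ n\<close> is exactly the exponential of
  \<open>(s - n * \<theta>) * ln (\<theta> / (1 - \<theta>))\<close>, which stays between
  \<open>1 / K\<close> and \<open>K\<close> while \<open>s\<close> is within \<open>C\<close> of the
  mean.\<close>

lemma binomial_weights:
  fixes \<theta> C :: real
  assumes "0 < \<theta>" "\<theta> < 1"
  defines "K \<equiv> exp (C * \<bar>ln (\<theta> / (1-\<theta>))\<bar>)"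
  assumes "s \<le> n" "\<bar>real s - real n * \<theta>\<bar> \<le> C"
  shows "1 \<le> K * (\<theta> ^ s * (1-\<theta>) ^ (n-s)) * Phi \<theta> ^ n" "(\<theta> ^ s * (1-\<theta>) ^ (n-s)) * Phi \<theta> ^ n \<le> K"
proof -
  define d where "d = (real s - real n * \<theta>) * ln (\<theta> / (1-\<theta>))"
  have dK: "\<bar>d\<bar> \<le> C * \<bar>ln (\<theta> / (1-\<theta>))\<bar>"
    unfolding d_def abs_mult using assms by (intro mult_right_mono) auto
  have "Phi \<theta> = exp (- (\<theta> * ln \<theta> + (1-\<theta>) * ln (1-\<theta>)))"
    using assms unfolding Phi_def powr_def by (simp add: exp_minus exp_add exp_diff inverse_eq_divide)
  then have "Phi \<theta> ^ n = exp (- real n * (\<theta> * ln \<theta> + (1-\<theta>) * ln (1-\<theta>)))"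
    by (simp add: exp_of_nat_mult[symmetric] algebra_simps)
  moreover have "\<theta> ^ s = exp (real s * ln \<theta>)" using assms by (simp add: exp_of_nat_mult)
  moreover have "(1-\<theta>) ^ (n-s) = exp (real (n-s) * ln (1-\<theta>))" using assms by (simp only: exp_of_nat_mult) simp
  moreover have "real s * ln \<theta> + real (n-s) * ln (1-\<theta>) - real n * (\<theta> * ln \<theta> + (1-\<theta>) * ln (1-\<theta>)) = d"
    using assms by (simp add: d_def ln_div of_nat_diff algebra_simps)
  ultimately have eq: "(\<theta> ^ s * (1-\<theta>) ^ (n-s)) * Phi \<theta> ^ n = exp d" by (simp flip: exp_add)
  show "(\<theta> ^ s * (1-\<theta>) ^ (n-s)) * Phi \<theta> ^ n \<le> K" unfolding eq K_def using dK by simp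
  have "1 \<le> exp (C * \<bar>ln (\<theta> / (1-\<theta>))\<bar> + d)" using dK by simp
  then show "1 \<le> K * (\<theta> ^ s * (1-\<theta>) ^ (n-s)) * Phi \<theta> ^ n" using eq by (simp add: K_def exp_add mult.assoc)
qed

text \<open>The largest of the n + 1 probabilities of a binomial distribution is at least their mean
  1 / (n + 1). The ratio of consecutive terms (\<open>rec\<close>), compared on both sides of the
  maximum, confines its index to distance 1 from the expectation.\<close>

lemma binomial_mode:
  fixes \<theta> :: real
  assumes "0 < \<theta>" "\<theta> < 1"
  obtains k where "k \<le> n" "\<bar>real k - real n * \<theta>\<bar> \<le> 1"
    "1 \<le> real (Suc n) * (real (n choose k) * (\<theta> ^ k * (1-\<theta>) ^ (n-k)))"
proof -
  define t where "t k = real (n choose k) * (\<theta> ^ k * (1-\<theta>) ^ (n-k))" for k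
  have tot: "(\<Sum>k\<le>n. t k) = 1" using binomial_ring[of \<theta> "1-\<theta>" n] by (simp add: t_def mult.assoc)
  obtain k where k: "k \<le> n" "\<And>j. j \<le> n \<Longrightarrow> t j \<le> t k"
  proof -
    have "Max (t ` {..n}) \<in> t ` {..n}" by (rule Max_in) auto
    then obtain k where "k \<le> n" "t k = Max (t ` {..n})" by (metis imageE atMost_iff)
    then show thesis using that[of k] by simp
  qed
  have pos: "t k > 0" using k assms by (simp add: t_def)
  have rec: "real (Suc j) * (1-\<theta>) * t (Suc j) = real (n-j) * \<theta> * t j" if "j < n" for j
  proof -
    have "Suc j * (n choose Suc j) = (n - j) * (n choose j)"
      by (rule binomial_ratio)
    then have "real (Suc j) * real (n choose Suc j) = real (n - j) * real (n choose j)"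
      by (metis of_nat_mult)
    moreover have "n - j = Suc (n - Suc j)" using that by simp
    then have "(1-\<theta>) ^ (n-j) = (1-\<theta>) * (1-\<theta>) ^ (n - Suc j)" by (metis power_Suc)
    moreover have "real (Suc j) * (1-\<theta>) * t (Suc j) = (real (Suc j) * real (n choose Suc j)) * (\<theta> * \<theta> ^ j * ((1-\<theta>) * (1-\<theta>) ^ (n - Suc j)))"
      by (simp add: t_def del: of_nat_Suc)
    ultimately show ?thesis by (simp add: t_def)
  qed
  have "real n * \<theta> - 1 \<le> real k"
  proof (cases "k < n")
    case True
    have "real (n-k) * \<theta> * t k \<le> real (Suc k) * (1-\<theta>) * t k"
      using rec[OF True] k(2)[of "Suc k"] True assms by (metis Suc_leI diff_ge_0_iff_ge less_eq_real_def mult_left_mono mult_nonneg_nonneg of_nat_0_le_iff)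
    then have "real (n-k) * \<theta> \<le> real (Suc k) * (1-\<theta>)" using pos by simp
    then show ?thesis using assms True by (simp add: of_nat_diff algebra_simps)
  next
    case False
    then show ?thesis using k assms mult_left_mono[of \<theta> 1 "real n"] by simp
  qed
  moreover have "real k \<le> real n * \<theta> + 1"
  proof (cases k)
    case (Suc j)
    have "real (Suc j) * (1-\<theta>) * t k \<le> real (n-j) * \<theta> * t k"
      using rec[of j] k(1) k(2)[of j] Suc assms by (metis Suc_le_lessD less_eq_real_def mult_left_mono mult_nonneg_nonneg of_nat_0_le_iff less_imp_le)
    then have "real (Suc j) * (1-\<theta>) \<le> real (n-j) * \<theta>" using pos by simp
    then show ?thesis using assms Suc k by (simp add: of_nat_diff algebra_simps)
  qed (use assms in simp)
  moreover have "1 \<le> real (Suc n) * t k"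
    using sum_bounded_above[of "{..n}" t "t k"] k tot by simp
  ultimately show thesis using that[of k] k by (simp add: t_def abs_le_iff)
qed

text \<open>Upper bound: a single probability is at most 1. Lower bound: the mode has probability at
  least 1 / (n + 1), and moving from the mode to \<open>s\<close> costs only a power of
  \<open>n\<close>.\<close>

lemma binomial_Phi_bounds:
  fixes \<theta> C :: real
  assumes th: "0 < \<theta>" "\<theta> < 1"
  obtains K r where "K > 0"
    "\<And>n s. n \<ge> 1 \<Longrightarrow> s \<le> n \<Longrightarrow> \<bar>real s - real n * \<theta>\<bar> \<le> C \<Longrightarrow> real (n choose s) \<le> K * Phi \<theta> ^ n"
    "\<And>n s. n \<ge> 1 \<Longrightarrow> s \<le> n \<Longrightarrow> \<bar>real s - real n * \<theta>\<bar> \<le> C \<Longrightarrow> Phi \<theta> ^ n \<le> K * real n ^ r * real (n choose s)"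
proof -
  define K1 where "K1 = exp (C * \<bar>ln (\<theta> / (1-\<theta>))\<bar>)"
  define K2 where "K2 = exp (1 * \<bar>ln (\<theta> / (1-\<theta>))\<bar>)"
  \<comment> \<open>The distance from \<open>s\<close> to the mode: \<open>C\<close> from
    \<open>s\<close> to the expectation, and 1 from there to the mode.\<close>
  define d where "d = nat \<lceil>C + 1\<rceil>"
  have P: "Phi \<theta> \<ge> 1" using Phi_ge_1 th by simp
  show thesis
  proof (rule that[of "max K1 (2*K2)" "Suc d"])
    show "max K1 (2*K2) > 0" by (simp add: K1_def less_max_iff_disj)
    fix n s :: nat
    assume ns: "n \<ge> 1" "s \<le> n" "\<bar>real s - real n * \<theta>\<bar> \<le> C"
    define W where "W = \<theta> ^ s * (1-\<theta>) ^ (n-s)"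
    have W: "W > 0" using th by (simp add: W_def)
    have "(\<Sum>k\<le>n. real (n choose k) * (\<theta> ^ k * (1-\<theta>) ^ (n-k))) = 1"
      using binomial_ring[of \<theta> "1-\<theta>" n] by (simp add: mult.assoc)
    moreover have "real (n choose s) * W \<le> (\<Sum>k\<le>n. real (n choose k) * (\<theta> ^ k * (1-\<theta>) ^ (n-k)))"
      unfolding W_def using ns th by (intro member_le_sum) auto
    ultimately have "real (n choose s) * W \<le> 1" by simp
    also have "1 \<le> K1 * W * Phi \<theta> ^ n"
      using binomial_weights(1)[OF th ns(2,3)] by (simp add: K1_def W_def)
    finally have "real (n choose s) * W \<le> (K1 * Phi \<theta> ^ n) * W" by (simp add: mult_ac)
    then have "real (n choose s) \<le> K1 * Phi \<theta> ^ n" using W by simp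
    also have "\<dots> \<le> max K1 (2*K2) * Phi \<theta> ^ n" using P by (intro mult_right_mono) auto
    finally show "real (n choose s) \<le> max K1 (2*K2) * Phi \<theta> ^ n" .
    obtain k where k: "k \<le> n" "\<bar>real k - real n * \<theta>\<bar> \<le> 1"
      "1 \<le> real (Suc n) * (real (n choose k) * (\<theta> ^ k * (1-\<theta>) ^ (n-k)))"
      using binomial_mode[OF th] by blast
    have "Phi \<theta> ^ n * 1 \<le> Phi \<theta> ^ n * (real (Suc n) * (real (n choose k) * (\<theta> ^ k * (1-\<theta>) ^ (n-k))))"
      using k P by (intro mult_left_mono) auto
    also have "\<dots> = real (Suc n) * real (n choose k) * ((\<theta> ^ k * (1-\<theta>) ^ (n-k)) * Phi \<theta> ^ n)"
      by (simp add: mult_ac)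
    also have "\<dots> \<le> real (Suc n) * real (n choose k) * K2"
      using binomial_weights(2)[OF th k(1,2)] by (intro mult_left_mono) (auto simp: K2_def)
    also have "\<dots> \<le> (2 * real n) * real (n ^ d * (n choose s)) * K2"
    proof (intro mult_mono mult_right_mono)
      have dd: "C + 1 \<le> real d" unfolding d_def by linarith
      then have "real k \<le> real (s + d)" "real s \<le> real (k + d)" using k(2) ns(3) unfolding of_nat_add by linarith+
      then show "real (n choose k) \<le> real (n ^ d * (n choose s))"
        using binomial_nearby[of n k s d] k ns by (metis of_nat_le_iff)
    qed (use ns in \<open>auto simp: K2_def\<close>)
    also have "\<dots> = (2*K2) * (real n ^ Suc d * real (n choose s))" by simp
    also have "\<dots> \<le> max K1 (2*K2) * (real n ^ Suc d * real (n choose s))" by (intro mult_right_mono) auto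
    finally show "Phi \<theta> ^ n \<le> max K1 (2*K2) * real n ^ Suc d * real (n choose s)" by (simp add: mult.assoc)
  qed
qed

section \<open>Limits of n-th roots under polynomial error factors\<close>

lemma root_sandwich:
  fixes L K :: real
  assumes "L > 0" "K > 0"
    and up: "\<And>n. n \<ge> start \<Longrightarrow> f n \<le> K * real n ^ r * L ^ n"
    and lo: "\<And>n. n \<ge> start \<Longrightarrow> L ^ n \<le> K * real n ^ r * f n"
  shows "(\<lambda>n. root n (f n)) \<longlonglongrightarrow> L"
proof -
  define g where "g n = root n (K * real n ^ r)" for n
  have "(\<lambda>n. root n K * root n (real n) ^ r) \<longlonglongrightarrow> 1 * 1 ^ r"
    by (intro tendsto_intros LIMSEQ_root_const LIMSEQ_root assms)
  moreover have "\<forall>\<^sub>F n in sequentially. root n K * root n (real n) ^ r = g n"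
    using eventually_gt_at_top[of 0] by eventually_elim (simp add: g_def real_root_mult real_root_power)
  ultimately have g: "g \<longlonglongrightarrow> 1" by (simp add: filterlim_cong)
  show ?thesis
  proof (rule tendsto_sandwich[where f="\<lambda>n. L / g n" and h="\<lambda>n. g n * L"])
    show "(\<lambda>n. L / g n) \<longlonglongrightarrow> L" using tendsto_divide[OF tendsto_const g] by fastforce
    show "(\<lambda>n. g n * L) \<longlonglongrightarrow> L" using tendsto_mult[OF g tendsto_const] by fastforce
    show "\<forall>\<^sub>F n in sequentially. root n (f n) \<le> g n * L"
      using eventually_ge_at_top[of "max 1 start"]
    proof eventually_elim
      case (elim n)
      then have "root n (f n) \<le> root n (K * real n ^ r * L ^ n)" using up by (intro real_root_le_mono) auto
      then show ?case using elim assms by (simp add: g_def real_root_mult real_root_power_cancel)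
    qed
    show "\<forall>\<^sub>F n in sequentially. L / g n \<le> root n (f n)"
      using eventually_ge_at_top[of "max 1 start"]
    proof eventually_elim
      case (elim n)
      then have "root n (L ^ n) \<le> root n (K * real n ^ r * f n)" using lo by (intro real_root_le_mono) auto
      then have "L \<le> g n * root n (f n)" using elim assms by (simp add: g_def real_root_mult real_root_power_cancel)
      moreover have "g n > 0" using elim assms by (simp add: g_def)
      ultimately show ?case by (simp add: divide_le_eq mult.commute)
    qed
  qed
qed

lemma root_sandwich_degrees:
  fixes L K :: real
  assumes L: "L > 0" "K > 0" "K' > 0"
    and up: "\<And>n. n \<ge> 3 \<Longrightarrow> real (f n) \<le> K * real n ^ r * L ^ n"
    and lo: "\<And>n. n \<ge> 3 \<Longrightarrow> L ^ n \<le> K' * real n ^ r' * real (f n)"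
  shows "(\<lambda>n. root n (real (f n))) \<longlonglongrightarrow> L"
proof (rule root_sandwich[where start=3 and K="max K K'" and r="max r r'"])
  fix n :: nat assume n: "n \<ge> 3"
  have "K * real n ^ r * L ^ n \<le> max K K' * real n ^ max r r' * L ^ n"
    using n L by (intro mult_right_mono mult_mono power_increasing) auto
  with up[OF n] show "real (f n) \<le> max K K' * real n ^ max r r' * L ^ n" by simp
  have "K' * real n ^ r' * real (f n) \<le> max K K' * real n ^ max r r' * real (f n)"
    using n L by (intro mult_right_mono mult_mono power_increasing) auto
  with lo[OF n] show "L ^ n \<le> max K K' * real n ^ max r r' * real (f n)" by simp
qed (use L in auto)

text \<open>Both bounds are compared with the expansion of \<open>(P + 1) ^ n\<close>, where
  \<open>N\<close> counts the variables not replaced by the unit. The upper bound is summed over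
  \<open>N\<close>. The lower bound is available for one \<open>N\<close> at a time, so each term of
  the expansion is bounded by \<open>f n\<close>, at the cost of the factor n + 1. The summand
  \<open>2 ^ n\<close> is absorbed because \<open>P \<ge> 1\<close>.\<close>

lemma root_limit_sharp:
  fixes P K :: real
  assumes P: "P \<ge> 1" and K: "K > 0"
    and up: "\<And>n. real (f n) \<le> real (2 * (\<Sum>N\<in>{1..n}. (n choose N) * a N) + 2 ^ n)"
    and lo: "\<And>n N. N \<ge> 3 \<Longrightarrow> (n choose N) * b N \<le> f n"
    and a: "\<And>N. N \<ge> 1 \<Longrightarrow> real (a N) \<le> K * real N ^ 2 * P ^ N"
    and b: "\<And>N. N \<ge> 3 \<Longrightarrow> P ^ N \<le> K * real N ^ r * real (b N)"
  shows "(\<lambda>n. root n (real (f n))) \<longlonglongrightarrow> P + 1"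
proof (rule root_sandwich_degrees[where K="2*K+1" and r=2 and K'="2 * (K + P ^ 2)" and r'="r+3"])
  have binom: "(\<Sum>N\<le>n. real (n choose N) * P ^ N) = (P + 1) ^ n" for n
    using binomial_ring[of P 1 n] by simp
  fix n :: nat assume n: "n \<ge> 3"
  have "(\<Sum>N\<in>{1..n}. real (n choose N) * real (a N)) \<le> (\<Sum>N\<in>{1..n}. real (n choose N) * (K * real n ^ 2 * P ^ N))"
  proof (intro sum_mono mult_left_mono)
    fix N assume N: "N \<in> {1..n}"
    have "real (a N) \<le> K * real N ^ 2 * P ^ N" using a N by simp
    also have "\<dots> \<le> K * real n ^ 2 * P ^ N" using N K P by (intro mult_right_mono mult_left_mono power_mono) auto
    finally show "real (a N) \<le> K * real n ^ 2 * P ^ N" .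
  qed simp
  also have "\<dots> = K * real n ^ 2 * (\<Sum>N\<in>{1..n}. real (n choose N) * P ^ N)"
    by (simp add: sum_distrib_left mult_ac)
  also have "\<dots> \<le> K * real n ^ 2 * (\<Sum>N\<le>n. real (n choose N) * P ^ N)"
    using K P by (intro mult_left_mono sum_mono2) auto
  finally have 1: "(\<Sum>N\<in>{1..n}. real (n choose N) * real (a N)) \<le> K * real n ^ 2 * (P + 1) ^ n" by (simp add: binom)
  have "1 * 2 ^ n \<le> real n ^ 2 * (P + 1) ^ n" using n P by (intro mult_mono power_mono one_le_power) auto
  then have "real (f n) \<le> 2 * (K * real n ^ 2 * (P + 1) ^ n) + real n ^ 2 * (P + 1) ^ n"
    using up[of n] 1 by simp
  then show "real (f n) \<le> (2*K+1) * real n ^ 2 * (P + 1) ^ n" by (simp add: algebra_simps)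
  have f1: "1 \<le> real (f n)"
  proof -
    have "P ^ n > 0" using P by simp
    then have "b n \<noteq> 0" using b[OF n] by (intro notI) simp
    then have "1 \<le> f n" using lo[OF n, of n] by simp
    then show ?thesis by simp
  qed
  \<comment> \<open>For \<open>N < 3\<close> the hypothesis \<open>lo\<close> is silent; there the
    term is polynomial in \<open>n\<close>, and \<open>f n \<ge> 1\<close> suffices.\<close>
  have bnd: "real (n choose N) * P ^ N \<le> (K + P ^ 2) * real n ^ (r + 2) * real (f n)" if N: "N \<le> n" for N
  proof (cases "N \<ge> 3")
    case True
    have "real (n choose N) * P ^ N \<le> real (n choose N) * (K * real N ^ r * real (b N))"
      using b[OF True] by (intro mult_left_mono) auto
    also have "\<dots> = K * real N ^ r * real ((n choose N) * b N)" by simp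
    also have "\<dots> \<le> (K + P ^ 2) * real n ^ (r + 2) * real (f n)"
    proof (intro mult_mono)
      have "real N ^ r \<le> real n ^ r" using N by (intro power_mono) auto
      also have "\<dots> \<le> real n ^ (r + 2)" using n by (intro power_increasing) auto
      finally show "real N ^ r \<le> real n ^ (r + 2)" .
      show "real ((n choose N) * b N) \<le> real (f n)" using lo[OF True] by (rule of_nat_mono)
    qed (use K P in auto)
    finally show ?thesis .
  next
    case False
    have "n choose N \<le> n ^ N" using N binomial_le_pow[of N n] by simp
    also have "\<dots> \<le> n ^ (r + 2)" using False n by (intro power_increasing) auto
    finally have "real (n choose N) \<le> real n ^ (r + 2)" by (metis of_nat_le_iff of_nat_power)
    moreover have "P ^ N \<le> K + P ^ 2" using power_increasing[of N 2 P] False P K by simp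
    ultimately have "real (n choose N) * P ^ N \<le> real n ^ (r + 2) * (K + P ^ 2)"
      using P by (intro mult_mono) auto
    also have "\<dots> * 1 \<le> \<dots> * real (f n)" using f1 K P by (intro mult_left_mono mult_nonneg_nonneg) auto
    finally show ?thesis by (simp add: mult_ac)
  qed
  have "(P + 1) ^ n \<le> of_nat (card {..n}) * ((K + P ^ 2) * real n ^ (r + 2) * real (f n))"
    unfolding binom[symmetric] by (rule sum_bounded_above) (rule bnd, simp)
  also have "\<dots> \<le> (2 * real n) * ((K + P ^ 2) * real n ^ (r + 2) * real (f n))"
    using n K P by (intro mult_right_mono mult_nonneg_nonneg) auto
  also have "\<dots> = 2 * (K + P ^ 2) * real n ^ (r + 3) * real (f n)" by (simp add: power_add power3_eq_cube power2_eq_square)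
  finally show "(P + 1) ^ n \<le> 2 * (K + P ^ 2) * real n ^ (r + 3) * real (f n)" .
qed (use K P in \<open>auto simp: add_pos_nonneg\<close>)

section \<open>Codimensions of path algebras with unit\<close>

interpretation fs: vector_space "fscale :: 'a::field \<Rightarrow> ((nat \<Rightarrow> 'b \<Rightarrow> 'a) \<Rightarrow> 'b \<Rightarrow> 'a) \<Rightarrow> _"
  by unfold_locales (auto simp: fscale_def fun_eq_iff algebra_simps)

lemma sum_apply2: "(\<Sum>x\<in>A. f x) v k = (\<Sum>x\<in>A. f x v k)"
  by (induction A rule: infinite_finite_induct) auto

lemma sum_list_apply2: "sum_list fs v k = (\<Sum>f\<leftarrow>fs. f v k)"
  by (induction fs) auto

lemma sum_list_concat: "sum_list (concat xss) = (\<Sum>xs\<leftarrow>xss. sum_list xs)" for xss :: "'a::monoid_add list list"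
  by (induction xss) auto

text \<open>Evaluation at the points \<open>x s\<close>, \<open>y s\<close> is a dual system, so the
  functions \<open>f s\<close> are independent. The finite spanning set \<open>W\<close> ensures
  that a basis extending them is finite, since \<open>dim\<close> is a cardinality and
  \<open>card\<close> is 0 on infinite sets.\<close>

lemma card_le_dim_if_dual:
  fixes f :: "'s \<Rightarrow> ((nat \<Rightarrow> 'b \<Rightarrow> 'a::field) \<Rightarrow> 'b \<Rightarrow> 'a)"
  assumes S: "finite S" "f ` S \<subseteq> M"
    and W: "finite W" "M \<subseteq> fs.span W"
    and dual: "\<And>s s'. s \<in> S \<Longrightarrow> s' \<in> S \<Longrightarrow> f s' (x s) (y s) = (if s = s' then 1 else 0)"
  shows "card S \<le> fs.dim M"
proof -
  have inj: "inj_on f S" by (rule inj_onI) (metis dual zero_neq_one)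
  have fS: "finite (f ` S)" using S by simp
  have zero: "c z = 0" if c: "(\<Sum>z\<in>f ` S. fscale (c z) z) = 0" and z: "z \<in> f ` S" for c z
  proof -
    obtain s where s: "s \<in> S" "z = f s" using z by auto
    have "0 = (\<Sum>z\<in>f ` S. fscale (c z) z) (x s) (y s)" using c by simp
    also have "\<dots> = (\<Sum>s'\<in>S. c (f s') * f s' (x s) (y s))"
      by (simp add: sum_apply2 fscale_def sum.reindex[OF inj])
    also have "\<dots> = (\<Sum>s'\<in>S. if s = s' then c (f s') else 0)"
      using dual s by (intro sum.cong) auto
    also have "\<dots> = c z" using s S by simp
    finally show "c z = 0" by simp
  qed
  have ind: "fs.independent (f ` S)"
    unfolding fs.dependent_finite[OF fS]
  proof (rule notI, elim exE conjE bexE)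
    fix u z assume "z \<in> f ` S" "u z \<noteq> 0" "(\<Sum>v\<in>f ` S. fscale (u v) v) = 0"
    then show False using zero[of u z] by simp
  qed
  obtain B where B: "f ` S \<subseteq> B" "B \<subseteq> M" "fs.independent B" "M \<subseteq> fs.span B"
    using fs.maximal_independent_subset_extend[OF S(2) ind] by blast
  have "finite B" using fs.independent_span_bound[OF W(1) B(3)] B W by auto
  then have "card (f ` S) \<le> card B" using B by (intro card_mono)
  also have "card B = fs.dim M" using fs.basis_card_eq_dim B by blast
  finally show ?thesis using card_image[OF inj] by simp
qed

section \<open>Coordinates of products after adjoining the unit\<close>

lemma vmul_eq:
  assumes "finite S" "supp x \<subseteq> S" "finite S'" "supp y \<subseteq> S'"
  shows "vmul mt x y k = (\<Sum>i\<in>S. \<Sum>j\<in>S'. if mt i j = Some k then x i * y j else 0)"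
proof -
  have "vmul mt x y k = (\<Sum>i\<in>supp x. \<Sum>j\<in>S'. if mt i j = Some k then x i * y j else 0)"
    unfolding vmul_def using assms by (intro sum.cong refl sum.mono_neutral_left) (auto simp: supp_def)
  also have "\<dots> = (\<Sum>i\<in>S. \<Sum>j\<in>S'. if mt i j = Some k then x i * y j else 0)"
    using assms by (intro sum.mono_neutral_left) (auto simp: supp_def intro!: sum.neutral split: if_splits)
  finally show ?thesis .
qed

lemma finite_supp_vmul:
  assumes "finite (supp x)" "finite (supp y)"
  shows "finite (supp (vmul mt x y))"
proof (rule finite_subset)
  show "supp (vmul mt x y) \<subseteq> (\<Union>i\<in>supp x. \<Union>j\<in>supp y. set_option (mt i j))"
  proof
    fix k assume "k \<in> supp (vmul mt x y)"
    then have "(\<Sum>i\<in>supp x. \<Sum>j\<in>supp y. if mt i j = Some k then x i * y j else 0) \<noteq> 0"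
      by (simp add: supp_def vmul_def)
    moreover have "(\<Sum>i\<in>supp x. \<Sum>j\<in>supp y. if mt i j = Some k then x i * y j else 0) = 0"
      if "\<not> (\<exists>i\<in>supp x. \<exists>j\<in>supp y. mt i j = Some k)"
      using that by (intro sum.neutral ballI) simp
    ultimately have "\<exists>i\<in>supp x. \<exists>j\<in>supp y. mt i j = Some k" by blast
    then show "k \<in> (\<Union>i\<in>supp x. \<Union>j\<in>supp y. set_option (mt i j))" by auto
  qed
qed (use assms in auto)

lemma finite_supp_eval: "(\<And>i. finite (supp (v i))) \<Longrightarrow> finite (supp (eval_mon mt v t))"
  by (induction t) (auto intro: finite_supp_vmul)

lemma finite_supp_comp_Some: "finite (supp X) \<Longrightarrow> finite (supp (X \<circ> Some))"
proof -
  have "supp (X \<circ> Some) = Some -` supp X" by (auto simp: supp_def)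
  then show "finite (supp X) \<Longrightarrow> ?thesis" by (simp add: finite_vimageI)
qed

lemma vmul_sharp:
  assumes "finite (supp X)" "finite (supp Y)"
  shows "vmul (mult_sharp mt) X Y None = X None * Y None"
    "vmul (mult_sharp mt) X Y (Some k) = X None * Y (Some k) + X (Some k) * Y None + vmul mt (X \<circ> Some) (Y \<circ> Some) k"
proof -
  define S where "S = insert k (supp (X \<circ> Some))"
  define S' where "S' = insert k (supp (Y \<circ> Some))"
  have fin: "finite S" "finite S'" using assms finite_supp_comp_Some by (auto simp: S_def S'_def)
  have X: "supp X \<subseteq> insert None (Some ` S)"
  proof
    fix z assume "z \<in> supp X" then show "z \<in> insert None (Some ` S)" by (cases z) (auto simp: S_def supp_def)
  qed
  have Y: "supp Y \<subseteq> insert None (Some ` S')"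
  proof
    fix z assume "z \<in> supp Y" then show "z \<in> insert None (Some ` S')" by (cases z) (auto simp: S'_def supp_def)
  qed
  have sums: "vmul (mult_sharp mt) X Y z =
     (if z = None then X None * Y None else 0)
     + (\<Sum>j\<in>S'. if Some j = z then X None * Y (Some j) else 0)
     + ((\<Sum>i\<in>S. if Some i = z then X (Some i) * Y None else 0)
     + (\<Sum>i\<in>S. \<Sum>j\<in>S'. if map_option Some (mt i j) = Some z then X (Some i) * Y (Some j) else 0))" for z
    by (subst vmul_eq[OF _ X _ Y]) (use fin in \<open>auto simp: sum.reindex sum.distrib\<close>)
  show "vmul (mult_sharp mt) X Y None = X None * Y None"
    by (simp add: sums sum.neutral)
  have "(\<Sum>i\<in>S. \<Sum>j\<in>S'. if map_option Some (mt i j) = Some (Some k) then X (Some i) * Y (Some j) else 0)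
     = vmul mt (X \<circ> Some) (Y \<circ> Some) k"
    by (subst vmul_eq[of S _ S']) (use assms in \<open>auto simp: S_def S'_def finite_supp_comp_Some intro!: sum.cong\<close>)
  moreover have "(\<Sum>j\<in>S'. if Some j = Some k then X None * Y (Some j) else 0) = X None * Y (Some k)"
    using fin by (simp add: S'_def)
  moreover have "(\<Sum>i\<in>S. if Some i = Some k then X (Some i) * Y None else 0) = X (Some k) * Y None"
    using fin by (simp add: S_def)
  ultimately show "vmul (mult_sharp mt) X Y (Some k) = X None * Y (Some k) + X (Some k) * Y None + vmul mt (X \<circ> Some) (Y \<circ> Some) k"
    by (simp add: sums)
qed

text \<open>Each list collects the variables that are not read as the unit in one surviving term of
  the expanded monomial. In a product, either one factor is read as the unit altogether, or a path
  of the left factor is prolonged by a single variable of the right factor.\<close>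

fun paths :: "mon \<Rightarrow> nat list list" where
  "paths (Leaf i) = [[i]]"
| "paths (Node s t) = paths s @ paths t @ concat (map (\<lambda>L. map (\<lambda>i. L @ [i]) (leaves t)) (paths s))"

lemma paths_subset: "L \<in> set (paths t) \<Longrightarrow> L \<noteq> [] \<and> set L \<subseteq> set (leaves t)"
  by (induction t arbitrary: L) fastforce+

lemma paths_distinct: "distinct (leaves t) \<Longrightarrow> L \<in> set (paths t) \<Longrightarrow> distinct L"
proof (induction t arbitrary: L)
  case (Node s t)
  from Node.prems(2) consider "L \<in> set (paths s)" | "L \<in> set (paths t)"
    | L' i where "L' \<in> set (paths s)" "i \<in> set (leaves t)" "L = L' @ [i]" by auto
  then show ?case
  proof cases
    case 1
    then show ?thesis using Node.IH(1)[of L] Node.prems(1) by simp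
  next
    case 2
    then show ?thesis using Node.IH(2)[of L] Node.prems(1) by simp
  next
    case (3 L' i)
    then show ?thesis using paths_subset[of L' s] Node.IH(1)[of L'] Node.prems(1) by auto
  qed
qed simp

fun b_vars :: "nat list \<Rightarrow> bool list \<Rightarrow> nat set" where
  "b_vars (i # l) (c # u) = (if c then insert i (b_vars l u) else b_vars l u)"
| "b_vars _ _ = {}"

abbreviation count_b :: "bool list \<Rightarrow> nat" where "count_b u \<equiv> count_list u True"

lemma b_vars_subset: "b_vars l u \<subseteq> set l"
  by (induction l u rule: b_vars.induct) auto

lemma finite_b_vars [simp]: "finite (b_vars l u)"
  by (rule finite_subset[OF b_vars_subset]) simp

lemma card_b_vars: "distinct l \<Longrightarrow> length l = length u \<Longrightarrow> card (b_vars l u) = count_b u"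
proof (induction l u rule: b_vars.induct)
  case (1 i l c u)
  then have "i \<notin> b_vars l u" using b_vars_subset by fastforce
  then show ?case using 1 by auto
qed auto

lemma count_b_le_length: "count_b u \<le> length u"
  by (rule count_le_length)

text \<open>Realizes every admissible set \<open>T\<close> by an ordering of the variables, so that
  each triple in the lower bound comes from an actual monomial.\<close>

lemma obtain_b_vars:
  assumes "finite R" "T \<subseteq> R" "card R = length u" "card T = count_b u"
  obtains l where "distinct l" "set l = R" "b_vars l u = T"
  using assms
proof (induction u arbitrary: R T thesis)
  case Nil
  then show ?case using Nil.prems(1)[of "[]"] by auto
next
  case (Cons c u)
  have fT: "finite T" using Cons.prems finite_subset by blast
  \<comment> \<open>A first variable on the side of \<open>T\<close> prescribed by the first letter;
    one exists by comparing \<open>card T\<close> with the number of letters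
    \<open>b\<close>.\<close>
  obtain i where i: "i \<in> R" "i \<in> T \<longleftrightarrow> c"
  proof (cases c)
    case True
    then have "T \<noteq> {}" using Cons.prems by auto
    then show ?thesis using that Cons.prems True by auto
  next
    case False
    then have "card T < card R" using Cons.prems count_b_le_length[of u] by simp
    then have "T \<noteq> R" by auto
    then show ?thesis using that Cons.prems False by auto
  qed
  obtain l where l: "distinct l" "set l = R - {i}" "b_vars l u = T - {i}"
  proof (rule Cons.IH[of "R - {i}" "T - {i}"])
    show "card (T - {i}) = count_b u" using i Cons.prems fT by (cases c) auto
  qed (use Cons.prems i in auto)
  show ?case
  proof (rule Cons.prems(1)[of "i # l"])
    show "b_vars (i # l) (c # u) = T" using l i by auto
  qed (use l i in auto)
qed

section \<open>Evaluation of monomials in a path algebra with unit\<close>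

text \<open>The algebra of an infinite labelled path: every nonzero product of basis elements
  is \<open>g p \<cdot> (label of edge p) = g (p + 1)\<close>.\<close>

locale path_algebra =
  fixes mt :: "'b \<Rightarrow> 'b \<Rightarrow> 'b option" and g :: "nat \<Rightarrow> 'b" and letter :: "nat \<Rightarrow> bool" and aa bb :: 'b
  assumes mt_iff: "mt x y = Some r \<longleftrightarrow> (\<exists>p. x = g p \<and> y = (if letter p then bb else aa) \<and> r = g (Suc p))"
    and inj_g: "inj g" and ab: "aa \<noteq> bb" "aa \<notin> range g" "bb \<notin> range g"
begin

definition label :: "nat \<Rightarrow> 'b" where "label p = (if letter p then bb else aa)"

lemma label_notin_range: "label p \<notin> range g"
  unfolding label_def using ab by (cases "letter p") auto

lemma mt_iff_label: "mt i j = Some (g (Suc p)) \<longleftrightarrow> i = g p \<and> j = label p"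
  by (auto simp: mt_iff label_def inj_eq[OF inj_g])

lemma vmul_step:
  fixes x y :: "'b \<Rightarrow> 'a::field"
  assumes "finite (supp x)" "finite (supp y)"
  shows "vmul mt x y (g (Suc p)) = x (g p) * y (label p)"
proof -
  have eq: "(if mt i j = Some (g (Suc p)) then x i * y j else 0) = (if j = label p then (if i = g p then x i * y j else 0) else 0)" for i j
    by (simp add: mt_iff_label)
  have "vmul mt x y (g (Suc p)) = (\<Sum>i\<in>insert (g p) (supp x). \<Sum>j\<in>insert (label p) (supp y). if mt i j = Some (g (Suc p)) then x i * y j else 0)"
    by (rule vmul_eq) (use assms in auto)
  also have "\<dots> = x (g p) * y (label p)" unfolding eq using assms by simp
  finally show ?thesis .
qed

lemma vmul_zero:
  assumes "k \<notin> g ` range Suc"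
  shows "vmul mt x y k = 0"
proof -
  have "mt i j \<noteq> Some k" for i j using assms unfolding mt_iff by blast
  then show ?thesis by (simp add: vmul_def)
qed

context
  fixes v :: "nat \<Rightarrow> 'b option \<Rightarrow> 'a::field"
  assumes fin: "\<And>i. finite (supp (v i))"
begin

abbreviation E :: "mon \<Rightarrow> 'b option \<Rightarrow> 'a" where "E \<equiv> eval_mon (mult_sharp mt) v"

lemma finE: "finite (supp (E t))" "finite (supp (E t \<circ> Some))"
  by (rule finite_supp_eval[OF fin]) (rule finite_supp_comp_Some[OF finite_supp_eval[OF fin]])

lemma eval_None: "distinct (leaves t) \<Longrightarrow> E t None = (\<Prod>j\<in>set (leaves t). v j None)"
  by (induction t) (auto simp: vmul_sharp finE prod.union_disjoint)

text \<open>A basis element that is not a product can only be reached through the unit: one variable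
  supplies its coordinate, all others their unit components. This covers \<open>a\<close>,
  \<open>b\<close> and the initial vertex.\<close>

lemma eval_other:
  assumes "k \<notin> g ` range Suc"
  shows "distinct (leaves t) \<Longrightarrow>
    E t (Some k) = (\<Sum>i\<in>set (leaves t). v i (Some k) * (\<Prod>j\<in>set (leaves t) - {i}. v j None))"
proof (induction t)
  case (Node s t)
  let ?S = "set (leaves s)" and ?T = "set (leaves t)"
  have d: "?S \<inter> ?T = {}" "distinct (leaves s)" "distinct (leaves t)" using Node.prems by auto
  have 1: "(\<Prod>j\<in>?S \<union> ?T - {i}. v j None) = (\<Prod>j\<in>?S - {i}. v j None) * (\<Prod>j\<in>?T. v j None)" if "i \<in> ?S" for i
  proof -
    have "?S \<union> ?T - {i} = (?S - {i}) \<union> ?T" using that d by auto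
    moreover have "(?S - {i}) \<inter> ?T = {}" using d by auto
    ultimately show ?thesis by (simp add: prod.union_disjoint)
  qed
  have 2: "(\<Prod>j\<in>?S \<union> ?T - {i}. v j None) = (\<Prod>j\<in>?S. v j None) * (\<Prod>j\<in>?T - {i}. v j None)" if "i \<in> ?T" for i
  proof -
    have "?S \<union> ?T - {i} = ?S \<union> (?T - {i})" using that d by auto
    moreover have "?S \<inter> (?T - {i}) = {}" using d by auto
    ultimately show ?thesis by (simp add: prod.union_disjoint)
  qed
  have "E (Node s t) (Some k) = (\<Prod>j\<in>?S. v j None) * E t (Some k) + E s (Some k) * (\<Prod>j\<in>?T. v j None)"
    using d assms by (simp add: vmul_sharp finE vmul_zero eval_None)
  also have "\<dots> = (\<Sum>i\<in>?S. v i (Some k) * (\<Prod>j\<in>?S \<union> ?T - {i}. v j None)) + (\<Sum>i\<in>?T. v i (Some k) * (\<Prod>j\<in>?S \<union> ?T - {i}. v j None))"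
    using Node.IH d by (simp add: 1 2 sum_distrib_left sum_distrib_right mult_ac add.commute)
  also have "\<dots> = (\<Sum>i\<in>set (leaves (Node s t)). v i (Some k) * (\<Prod>j\<in>set (leaves (Node s t)) - {i}. v j None))"
    using d by (simp add: sum.union_disjoint)
  finally show ?case .
qed simp

end

primrec label_prod :: "(nat \<Rightarrow> 'b option \<Rightarrow> 'a::field) \<Rightarrow> nat \<Rightarrow> nat list \<Rightarrow> 'a" where
  "label_prod v p [] = 1"
| "label_prod v p (i # l) = v i (Some (label p)) * label_prod v (Suc p) l"

lemma label_prod_snoc: "label_prod v p (l @ [i]) = label_prod v p l * v i (Some (label (p + length l)))"
  by (induction l arbitrary: p) simp_all

text \<open>Here the order of the variables is forgotten: along a fixed label word, commuting
  scalars leave only the set of variables at the letters \<open>b\<close>. This is what turns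
  permutations into binomial coefficients.\<close>

lemma label_prod_b_vars:
  "distinct l \<Longrightarrow> label_prod v p l = (\<Prod>j\<in>b_vars l (win letter (length l) p). v j (Some bb)) *
     (\<Prod>j\<in>set l - b_vars l (win letter (length l) p). v j (Some aa))"
proof (induction l arbitrary: p)
  case (Cons i l)
  have i: "i \<notin> b_vars l u" for u using Cons.prems b_vars_subset[of l u] by auto
  have 1: "insert i (set l) - insert i (b_vars l u) = set l - b_vars l u" for u using Cons.prems by auto
  have 2: "insert i (set l) - b_vars l u = insert i (set l - b_vars l u)" for u using i by auto
  show ?case using Cons i by (simp add: win_Suc_left label_def 1 2 mult_ac)
qed simp

text \<open>Contribution of the path \<open>L\<close> ending at vertex \<open>q\<close>. The first
  variable picks a vertex and only the remaining \<open>length L - 1\<close> traverse edges, so the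
  start is \<open>Suc q - length L\<close>; paths too long to end at \<open>q\<close> contribute
  0.\<close>

definition path_value :: "(nat \<Rightarrow> 'b option \<Rightarrow> 'a::field) \<Rightarrow> nat list \<Rightarrow> nat \<Rightarrow> 'a" where
  "path_value v L q = (if length L \<le> Suc q \<and> L \<noteq> [] then v (hd L) (Some (g (Suc q - length L))) * label_prod v (Suc q - length L) (tl L) else 0)"

lemma path_value_snoc:
  assumes "L \<noteq> []"
  shows "path_value v (L @ [i]) 0 = 0" "path_value v (L @ [i]) (Suc q) = path_value v L q * v i (Some (label q))"
proof -
  obtain h l where L: "L = h # l" using assms by (cases L) auto
  show "path_value v (L @ [i]) 0 = 0" using L by (simp add: path_value_def)
  show "path_value v (L @ [i]) (Suc q) = path_value v L q * v i (Some (label q))"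
    using L by (auto simp: path_value_def label_prod_snoc)
qed

text \<open>Expansion of a monomial at a vertex over all ways to read variables as units. The three
  groups of lists in \<open>paths\<close> match the three terms of a product in
  \<open>vmul_sharp\<close>.\<close>

lemma eval_g:
  fixes v :: "nat \<Rightarrow> 'b option \<Rightarrow> 'a::field"
  assumes fin: "\<And>i. finite (supp (v i))"
  shows "distinct (leaves t) \<Longrightarrow> eval_mon (mult_sharp mt) v t (Some (g q)) =
     (\<Sum>L\<leftarrow>paths t. (\<Prod>j\<in>set (leaves t) - set L. v j None) * path_value v L q)"
proof (induction t arbitrary: q)
  case (Leaf i)
  then show ?case by (cases q) (auto simp: path_value_def)
next
  case (Node s t)
  let ?S = "set (leaves s)" and ?T = "set (leaves t)"
  let ?E = "eval_mon (mult_sharp mt) v"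
  have d: "?S \<inter> ?T = {}" "distinct (leaves s)" "distinct (leaves t)" using Node.prems by auto
  have 1: "(\<Prod>j\<in>?S \<union> ?T - set L. v j None) = (\<Prod>j\<in>?S - set L. v j None) * (\<Prod>j\<in>?T. v j None)" if "L \<in> set (paths s)" for L
  proof -
    have "?S \<union> ?T - set L = (?S - set L) \<union> ?T" using paths_subset[OF that] d by auto
    moreover have "(?S - set L) \<inter> ?T = {}" using d by auto
    ultimately show ?thesis by (simp add: prod.union_disjoint)
  qed
  have 2: "(\<Prod>j\<in>?S \<union> ?T - set L. v j None) = (\<Prod>j\<in>?S. v j None) * (\<Prod>j\<in>?T - set L. v j None)" if "L \<in> set (paths t)" for L
  proof -
    have "?S \<union> ?T - set L = ?S \<union> (?T - set L)" using paths_subset[OF that] d by auto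
    moreover have "?S \<inter> (?T - set L) = {}" using d by auto
    ultimately show ?thesis by (simp add: prod.union_disjoint)
  qed
  have 3: "(\<Prod>j\<in>?S \<union> ?T - set (L @ [i]). v j None) = (\<Prod>j\<in>?S - set L. v j None) * (\<Prod>j\<in>?T - {i}. v j None)"
    if "L \<in> set (paths s)" "i \<in> ?T" for L i
  proof -
    have "?S \<union> ?T - set (L @ [i]) = (?S - set L) \<union> (?T - {i})" using paths_subset[OF that(1)] that d by auto
    moreover have "(?S - set L) \<inter> (?T - {i}) = {}" using d by auto
    ultimately show ?thesis by (simp add: prod.union_disjoint)
  qed
  have ne: "L \<noteq> []" if "L \<in> set (paths s)" for L using paths_subset[OF that] by simp
  have prod: "vmul mt (?E s \<circ> Some) (?E t \<circ> Some) (g q) =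
     (\<Sum>L\<leftarrow>paths s. \<Sum>i\<leftarrow>leaves t. (\<Prod>j\<in>?S \<union> ?T - set (L @ [i]). v j None) * path_value v (L @ [i]) q)"
  proof (cases q)
    case 0
    have "g 0 \<notin> g ` range Suc" using inj_g by (auto simp: inj_def)
    then have "vmul mt (?E s \<circ> Some) (?E t \<circ> Some) (g q) = 0" using 0 by (simp add: vmul_zero)
    moreover have "(\<Sum>L\<leftarrow>paths s. \<Sum>i\<leftarrow>leaves t. (\<Prod>j\<in>?S \<union> ?T - set (L @ [i]). v j None) * path_value v (L @ [i]) q)
       = (\<Sum>L\<leftarrow>paths s. \<Sum>i\<leftarrow>leaves t. 0)"
      by (intro arg_cong[of _ _ sum_list] map_cong refl) (use paths_subset in \<open>simp add: 0 path_value_snoc\<close>)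
    ultimately show ?thesis by simp
  next
    case (Suc p)
    \<comment> \<open>The label is not a product, so the right factor enters linearly by
      \<open>eval_other\<close>, whatever its bracketing.\<close>
    have "label p \<notin> g ` range Suc" using label_notin_range by auto
    then have Et: "?E t (Some (label p)) = (\<Sum>i\<leftarrow>leaves t. v i (Some (label p)) * (\<Prod>j\<in>?T - {i}. v j None))"
      using eval_other[OF fin, of "label p" t] d by (simp add: sum.distinct_set_conv_list)
    have "vmul mt (?E s \<circ> Some) (?E t \<circ> Some) (g q) = ?E s (Some (g p)) * ?E t (Some (label p))"
      using Suc by (simp add: vmul_step finE[OF fin])
    also have "\<dots> = (\<Sum>L\<leftarrow>paths s. \<Sum>i\<leftarrow>leaves t. ((\<Prod>j\<in>?S - set L. v j None) * path_value v L p) * (v i (Some (label p)) * (\<Prod>j\<in>?T - {i}. v j None)))"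
      using Node.IH(1)[of p] d Et by (simp add: sum_list_mult_const sum_list_const_mult flip: sum_list_mult_const)
    also have "\<dots> = (\<Sum>L\<leftarrow>paths s. \<Sum>i\<leftarrow>leaves t. (\<Prod>j\<in>?S \<union> ?T - set (L @ [i]). v j None) * path_value v (L @ [i]) q)"
      by (intro arg_cong[of _ _ sum_list] map_cong refl) (simp only: 3 Suc path_value_snoc(2)[OF ne] mult_ac)
    finally show ?thesis .
  qed
  have "?E (Node s t) (Some (g q)) = (\<Prod>j\<in>?S. v j None) * ?E t (Some (g q)) + ?E s (Some (g q)) * (\<Prod>j\<in>?T. v j None)
      + vmul mt (?E s \<circ> Some) (?E t \<circ> Some) (g q)"
    using d by (simp add: vmul_sharp finE[OF fin] eval_None[OF fin])
  also have "(\<Prod>j\<in>?S. v j None) * ?E t (Some (g q)) = (\<Sum>L\<leftarrow>paths t. (\<Prod>j\<in>?S \<union> ?T - set L. v j None) * path_value v L q)"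
    unfolding Node.IH(2)[OF d(3)] sum_list_const_mult[symmetric]
    by (intro arg_cong[of _ _ sum_list] map_cong refl) (simp only: 2 mult_ac)
  also have "?E s (Some (g q)) * (\<Prod>j\<in>?T. v j None) = (\<Sum>L\<leftarrow>paths s. (\<Prod>j\<in>?S \<union> ?T - set L. v j None) * path_value v L q)"
    unfolding Node.IH(1)[OF d(2)] sum_list_mult_const[symmetric]
    by (intro arg_cong[of _ _ sum_list] map_cong refl) (simp only: 1 mult_ac)
  finally show ?case
    unfolding prod by (simp add: map_concat sum_list_concat comp_def add_ac)
qed

end

section \<open>Upper bound: a spanning set indexed by factors of the label word\<close>

text \<open>
  In \<open>(V,u,i,T)\<close>, the variables outside \<open>V\<close> are replaced by the unit, those in \<open>V\<close> run along a path
  with label word \<open>u\<close> starting with the variable \<open>i\<close>, and \<open>T\<close> is the set of variables at the letters \<open>b\<close>.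
\<close>

definition word_data :: "(nat \<Rightarrow> bool) \<Rightarrow> nat \<Rightarrow> (nat set \<times> bool list \<times> nat \<times> nat set) set" where
  "word_data letter n = {(V,u,i,T). V \<subseteq> {..<n} \<and> i \<in> V \<and> u \<in> range (win letter (card V - 1)) \<and>
     T \<subseteq> V - {i} \<and> card T = count_b u}"

lemma finite_word_data:
  assumes "\<And>N. finite (range (win letter N))"
  shows "finite (word_data letter n)"
proof (rule finite_subset)
  show "word_data letter n \<subseteq> Pow {..<n} \<times> (\<Union>N\<in>{..n}. range (win letter N)) \<times> {..<n} \<times> Pow {..<n}"
  proof safe
    fix V u i T assume a: "(V,u,i,T) \<in> word_data letter n"
    then have "card V \<le> n" using card_mono[of "{..<n}" V] by (auto simp: word_data_def)
    then show "u \<in> (\<Union>N\<in>{..n}. range (win letter N))" using a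
      by (auto simp: word_data_def intro!: bexI[of _ "card V - 1"])
  qed (auto simp: word_data_def)
qed (use assms in auto)

context path_algebra
begin

definition word_fun :: "(nat \<Rightarrow> 'b option \<Rightarrow> 'a::field) set \<Rightarrow> nat \<Rightarrow> nat set \<times> bool list \<times> nat \<times> nat set
    \<Rightarrow> (nat \<Rightarrow> 'b option \<Rightarrow> 'a) \<Rightarrow> 'b option \<Rightarrow> 'a" where
  "word_fun D n = (\<lambda>(V,u,i,T) v k. if v \<in> D \<and> k \<in> Some ` range g then
     (let q = inv g (the k) in
        if card V \<le> Suc q \<and> win letter (card V - 1) (Suc q - card V) = u
        then (\<Prod>j\<in>{..<n} - V. v j None) * (v i (Some (g (Suc q - card V))) * ((\<Prod>j\<in>T. v j (Some bb)) *
          (\<Prod>j\<in>V - {i} - T. v j (Some aa)))) else 0) else 0)"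

text \<open>The coordinates off the path. They do not depend on the monomial, so all monomials share
  this summand and it costs a single dimension.\<close>

definition unit_fun :: "(nat \<Rightarrow> 'b option \<Rightarrow> 'a::field) set \<Rightarrow> nat \<Rightarrow> (nat \<Rightarrow> 'b option \<Rightarrow> 'a) \<Rightarrow> 'b option \<Rightarrow> 'a" where
  "unit_fun D n = (\<lambda>v k. if v \<in> D \<and> k \<notin> Some ` range g then
     (case k of None \<Rightarrow> (\<Prod>j<n. v j None) | Some r \<Rightarrow> (\<Sum>i<n. v i (Some r) * (\<Prod>j\<in>{..<n} - {i}. v j None))) else 0)"

definition path_fun :: "(nat \<Rightarrow> 'b option \<Rightarrow> 'a::field) set \<Rightarrow> nat \<Rightarrow> nat list \<Rightarrow> (nat \<Rightarrow> 'b option \<Rightarrow> 'a) \<Rightarrow> 'b option \<Rightarrow> 'a" where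
  "path_fun D n L = (\<lambda>v k. if v \<in> D \<and> k \<in> Some ` range g then
     (\<Prod>j\<in>{..<n} - set L. v j None) * path_value v L (inv g (the k)) else 0)"

lemma mon_fun_decomp:
  fixes D :: "(nat \<Rightarrow> 'b option \<Rightarrow> 'a::field) set"
  assumes fin: "\<forall>v\<in>D. \<forall>i. finite (supp (v i))" and t: "t \<in> multilin_mons n"
  shows "mon_fun (mult_sharp mt) D t = unit_fun D n + (\<Sum>L\<leftarrow>paths t. path_fun D n L)"
proof (intro ext)
  fix v :: "nat \<Rightarrow> 'b option \<Rightarrow> 'a" and k
  have t': "distinct (leaves t)" "set (leaves t) = {..<n}" using t by (auto simp: multilin_mons_def)
  have sl: "(\<Sum>L\<leftarrow>paths t. path_fun D n L) v k = (\<Sum>L\<leftarrow>paths t. path_fun D n L v k)"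
    by (simp add: sum_list_apply2 comp_def)
  show "mon_fun (mult_sharp mt) D t v k = (unit_fun D n + (\<Sum>L\<leftarrow>paths t. path_fun D n L)) v k"
  proof (cases "v \<in> D")
    case True
    note f = fin[rule_format, OF True]
    show ?thesis
    proof (cases "k \<in> Some ` range g")
      case k: True
      then obtain q where q: "k = Some (g q)" by auto
      have pf: "path_fun D n L v k = (\<Prod>j\<in>{..<n} - set L. v j None) * path_value v L q" for L
        using True inj_g by (simp add: path_fun_def q)
      have "(unit_fun D n + (\<Sum>L\<leftarrow>paths t. path_fun D n L)) v k = (\<Sum>L\<leftarrow>paths t. path_fun D n L v k)"
        using k by (simp add: plus_fun_def sl unit_fun_def)
      then show ?thesis using True
        by (simp add: pf[unfolded q] q mon_fun_def eval_g[OF f t'(1)] t'(2))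
    next
      case k: False
      have "(\<Sum>L\<leftarrow>paths t. path_fun D n L v k) = 0" using k by (simp add: path_fun_def)
      then have eq: "(unit_fun D n + (\<Sum>L\<leftarrow>paths t. path_fun D n L)) v k = unit_fun D n v k" by (simp add: plus_fun_def sl)
      show ?thesis
      proof (cases k)
        case None
        then show ?thesis unfolding eq using True by (simp add: mon_fun_def unit_fun_def eval_None[OF f t'(1)] t'(2) image_iff)
      next
        case (Some r)
        then have r: "r \<notin> range g" using k by auto
        then have "r \<notin> g ` range Suc" by auto
        then show ?thesis unfolding eq using True Some k
          by (simp add: mon_fun_def unit_fun_def eval_other[OF f _ t'(1)] t'(2))
      qed
    qed
  next
    case False
    then have "(\<Sum>L\<leftarrow>paths t. path_fun D n L v k) = 0" by (simp add: path_fun_def)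
    then show ?thesis using False by (simp add: plus_fun_def sl mon_fun_def unit_fun_def)
  qed
qed

text \<open>The word read along \<open>l\<close> varies with the output vertex. Splitting according
  to that word leaves pieces that depend on \<open>l\<close> only through its set and
  \<open>b_vars l u\<close>.\<close>

lemma path_fun_eq_sum_word_fun:
  assumes L: "distinct (i # l)" "set (i # l) \<subseteq> {..<n}" and W: "finite (range (win letter (length l)))"
  shows "path_fun D n (i # l) = (\<Sum>u\<in>range (win letter (length l)). word_fun D n (set (i # l), u, i, b_vars l u))"
proof (intro ext)
  fix v :: "nat \<Rightarrow> 'b option \<Rightarrow> 'a" and k
  have card: "card (insert i (set l)) = Suc (length l)" using L by (simp add: distinct_card)
  have di: "insert i (set l) - {i} = set l" using L by auto
  show "path_fun D n (i # l) v k = (\<Sum>u\<in>range (win letter (length l)). word_fun D n (set (i # l), u, i, b_vars l u)) v k"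
  proof (cases "v \<in> D \<and> k \<in> Some ` range g")
    case True
    then obtain q where q: "k = Some (g q)" "v \<in> D" by auto
    have "(\<Sum>u\<in>range (win letter (length l)). word_fun D n (set (i # l), u, i, b_vars l u) v k)
      = (\<Sum>u\<in>range (win letter (length l)). if win letter (length l) (q - length l) = u then
           (if length l \<le> q then (\<Prod>j\<in>{..<n} - insert i (set l). v j None) * (v i (Some (g (q - length l))) * ((\<Prod>j\<in>b_vars l u. v j (Some bb)) *
             (\<Prod>j\<in>set l - b_vars l u. v j (Some aa)))) else 0) else 0)"
      using q inj_g by (intro sum.cong refl) (simp add: word_fun_def card di Let_def)
    also have "\<dots> = path_fun D n (i # l) v k"
      using W q inj_g L by (simp add: path_fun_def path_value_def label_prod_b_vars)
    finally show ?thesis by (simp add: sum_apply2)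
  next
    case False
    then show ?thesis by (auto simp: sum_apply2 path_fun_def word_fun_def)
  qed
qed

lemma mon_fun_in_span:
  fixes D :: "(nat \<Rightarrow> 'b option \<Rightarrow> 'a::field) set"
  assumes fin: "\<forall>v\<in>D. \<forall>i. finite (supp (v i))"
    and W: "\<And>N. finite (range (win letter N))"
  shows "mon_fun (mult_sharp mt) D ` multilin_mons n \<subseteq> fs.span (insert (unit_fun D n) (word_fun D n ` word_data letter n))"
proof
  fix f assume "f \<in> mon_fun (mult_sharp mt) D ` multilin_mons n"
  then obtain t where t: "t \<in> multilin_mons n" "f = mon_fun (mult_sharp mt) D t" by auto
  let ?S = "fs.span (insert (unit_fun D n) (word_fun D n ` word_data letter n))"
  have P: "path_fun D n L \<in> ?S" if "L \<in> set (paths t)" for L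
  proof -
    from paths_subset[OF that] obtain i l where L: "L = i # l" by (cases L) auto
    have d: "distinct (i # l)" "set (i # l) \<subseteq> {..<n}"
      using paths_distinct[OF _ that] paths_subset[OF that] t by (auto simp: L multilin_mons_def)
    have card: "card (insert i (set l)) = Suc (length l)" using d by (simp add: distinct_card)
    have "(set (i # l), u, i, b_vars l u) \<in> word_data letter n" if "u \<in> range (win letter (length l))" for u
      using that d b_vars_subset[of l u] card card_b_vars[of l u] by (auto simp: word_data_def)
    then show ?thesis unfolding L path_fun_eq_sum_word_fun[OF d W]
      by (intro fs.span_sum fs.span_base) auto
  qed
  have "(\<Sum>L\<leftarrow>Ls. path_fun D n L) \<in> ?S" if "set Ls \<subseteq> set (paths t)" for Ls
    using that
  proof (induction Ls)
    case (Cons L Ls)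
    have "path_fun D n L + (\<Sum>L\<leftarrow>Ls. path_fun D n L) \<in> ?S"
      by (rule fs.span_add) (use Cons P in auto)
    then show ?case by (simp only: list.map sum_list.Cons)
  qed (simp add: fs.span_zero)
  then show "f \<in> ?S" unfolding t(2) mon_fun_decomp[of D, OF fin t(1)] 
    by (intro fs.span_add) (auto intro: fs.span_base)
qed

text \<open>A function \<open>word_fun\<close> vanishes unless some substitution in \<open>D\<close>
  makes all its unit, \<open>b\<close> and \<open>a\<close> factors nonzero, so only the data in
  \<open>Z\<close> count. The flag \<open>h\<close> tells whether \<open>unit_fun\<close> has to be
  counted as well.\<close>

lemma codim_upper:
  fixes D :: "(nat \<Rightarrow> 'b option \<Rightarrow> 'a::field) set"
  assumes fin: "\<forall>v\<in>D. \<forall>i. finite (supp (v i))"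
    and W: "\<And>N. finite (range (win letter N))"
    and Z: "finite Z" "\<And>V u i T v. (V,u,i,T) \<in> word_data letter n \<Longrightarrow> v \<in> D \<Longrightarrow>
       (\<And>j. j \<in> {..<n} - V \<Longrightarrow> v j None \<noteq> 0) \<Longrightarrow> (\<And>j. j \<in> T \<Longrightarrow> v j (Some bb) \<noteq> 0) \<Longrightarrow>
       (\<And>j. j \<in> V - {i} - T \<Longrightarrow> v j (Some aa) \<noteq> 0) \<Longrightarrow> (V,u,i,T) \<in> Z"
    and h: "\<not> h \<Longrightarrow> n \<ge> 2 \<and> (\<forall>v\<in>D. \<forall>i<n. v i None = 0)"
  shows "codim_on (mult_sharp mt) D n \<le> card Z + of_bool h"
proof -
  let ?B = "word_fun D n ` Z \<union> (if h then {unit_fun D n} else {})"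
  have G: "word_fun D n z = 0" if "z \<in> word_data letter n" "z \<notin> Z" for z
  proof -
    obtain V u i T where z: "z = (V,u,i,T)" by (cases z) auto
    have "(\<Prod>j\<in>{..<n} - V. v j None) * (x * ((\<Prod>j\<in>T. v j (Some bb)) * (\<Prod>j\<in>V - {i} - T. v j (Some aa)))) = 0"
      if "v \<in> D" for v x
    proof (rule ccontr)
      assume "\<not> ?thesis"
      then have p: "(\<Prod>j\<in>{..<n} - V. v j None) \<noteq> 0" "(\<Prod>j\<in>T. v j (Some bb)) \<noteq> 0" "(\<Prod>j\<in>V - {i} - T. v j (Some aa)) \<noteq> 0"
        by auto
      have fV: "finite V" "finite T" using \<open>z \<in> word_data letter n\<close> unfolding z word_data_def
        by (auto intro: finite_subset)
      show False using Z(2)[of V u i T v] \<open>z \<in> _\<close> \<open>z \<notin> Z\<close> that p fV unfolding z by (auto simp: prod_zero_iff)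
    qed
    then show ?thesis unfolding z word_fun_def by (auto simp: fun_eq_iff Let_def)
  qed
  have H: "unit_fun D n = 0" if "\<not> h"
  proof (intro ext)
    fix v :: "nat \<Rightarrow> 'b option \<Rightarrow> 'a" and k
    have n: "n \<ge> 2" using h that by simp
    have z: "(\<Prod>j<n. v j None) = 0" "(\<Prod>j\<in>{..<n} - {i}. v j None) = 0" if "v \<in> D" for i
    proof -
      \<comment> \<open>Since \<open>n \<ge> 2\<close>, some variable other than \<open>i\<close>
        remains and contributes its unit component 0.\<close>
      have "0 \<in> {..<n}" "(if i = 0 then 1 else 0) \<in> {..<n} - {i}" using n by auto
      then have "{..<n} \<noteq> {}" "{..<n} - {i} \<noteq> {}" by blast+
      then show "(\<Prod>j<n. v j None) = 0" "(\<Prod>j\<in>{..<n} - {i}. v j None) = 0"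
        using h \<open>\<not> h\<close> that by (auto simp: prod_zero_iff)
    qed
    show "unit_fun D n v k = 0 v k" by (cases "v \<in> D"; cases k) (simp_all add: unit_fun_def z)
  qed
  have "insert (unit_fun D n) (word_fun D n ` word_data letter n) \<subseteq> fs.span ?B"
  proof -
    have "word_fun D n z \<in> fs.span ?B" if "z \<in> word_data letter n" for z
      using G[OF that] by (cases "z \<in> Z") (auto intro: fs.span_base simp: fs.span_zero)
    moreover have "unit_fun D n \<in> fs.span ?B" using H by (cases h) (auto intro: fs.span_base simp: fs.span_zero)
    ultimately show ?thesis by auto
  qed
  then have "fs.span (insert (unit_fun D n) (word_fun D n ` word_data letter n)) \<subseteq> fs.span ?B"
    by (rule fs.span_minimal) (rule fs.subspace_span)
  then have "mon_fun (mult_sharp mt) D ` multilin_mons n \<subseteq> fs.span ?B"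
    using mon_fun_in_span[of D, OF fin W, of n] by blast
  then have "codim_on (mult_sharp mt) D n \<le> card ?B"
    unfolding codim_on_def by (rule fs.dim_le_card) (use Z in auto)
  also have "\<dots> \<le> card (word_fun D n ` Z) + card (if h then {unit_fun D n} else {})" by (rule card_Un_le)
  also have "\<dots> \<le> card Z + of_bool h" using card_image_le[OF Z(1), of "word_fun D n"] by (simp add: add_mono)
  finally show ?thesis .
qed

section \<open>Lower bound: test substitutions dual to padded left-normed monomials\<close>

definition subst_basis :: "nat \<Rightarrow> nat set \<times> nat \<times> nat set \<Rightarrow> nat \<Rightarrow> 'b option \<Rightarrow> 'a::field" where
  "subst_basis n = (\<lambda>(U,i,T) j. if j \<ge> n then 0 else if j \<notin> U then basis_vec None
     else if j = i then basis_vec (Some (g 0)) else if j \<in> T then basis_vec (Some bb) else basis_vec (Some aa))"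

definition left_normed :: "nat list \<Rightarrow> mon" where
  "left_normed l = foldl (\<lambda>t j. Node t (Leaf j)) (Leaf (hd l)) (tl l)"

definition pad_left :: "nat list \<Rightarrow> mon \<Rightarrow> mon" where
  "pad_left js t = foldr (\<lambda>j t. Node (Leaf j) t) js t"

lemma leaves_left_normed: "leaves (left_normed (i # l)) = i # l"
  unfolding left_normed_def by (induction l rule: rev_induct) auto

lemma leaves_pad_left: "leaves (pad_left js t) = js @ leaves t"
  unfolding pad_left_def by (induction js) auto

text \<open>A left-normed monomial has exactly one path through all its variables; every other path
  leaves some variable to the unit.\<close>

lemma paths_left_normed:
  "filter (\<lambda>L. length L \<ge> Suc (length l)) (paths (left_normed (i # l))) = [i # l] \<and>
   (\<forall>L\<in>set (paths (left_normed (i # l))). length L \<le> Suc (length l))"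
proof (induction l rule: rev_induct)
  case Nil
  then show ?case by (simp add: left_normed_def)
next
  case (snoc x l)
  have eq: "left_normed (i # l @ [x]) = Node (left_normed (i # l)) (Leaf x)" by (simp add: left_normed_def)
  have len: "\<forall>L\<in>set (paths (left_normed (i # l))). length L \<le> Suc (length l)" using snoc by blast
  have 1: "filter (\<lambda>L. Suc (Suc (length l)) \<le> length L) (paths (left_normed (i # l))) = []"
    using len by (auto simp: filter_empty_conv not_le le_imp_less_Suc)
  have 2: "filter (\<lambda>L. Suc (Suc (length l)) \<le> length L) (map (\<lambda>L. L @ [x]) (paths (left_normed (i # l))))
     = map (\<lambda>L. L @ [x]) (filter (\<lambda>L. Suc (length l) \<le> length L) (paths (left_normed (i # l))))"
    by (simp add: filter_map comp_def)
  have c: "concat (map (\<lambda>L. [L @ [x]]) xs) = map (\<lambda>L. L @ [x]) xs" for xs :: "nat list list" by (induction xs) auto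
  show ?case using snoc len 1 2 by (auto simp: eq c le_SucI)
qed

text \<open>
  A left factor annihilates every \<open>z\<close>, so padding on the left creates no paths with more than two variables.
\<close>

lemma paths_pad_left: "N \<ge> 3 \<Longrightarrow> filter (\<lambda>L. length L \<ge> N) (paths (pad_left js t)) = filter (\<lambda>L. length L \<ge> N) (paths t)"
  unfolding pad_left_def by (induction js) (auto simp: filter_empty_conv)

lemma sum_list_map_filter_nonzero:
  fixes f :: "'x \<Rightarrow> 'a::comm_monoid_add"
  shows "(\<And>x. x \<in> set xs \<Longrightarrow> \<not> P x \<Longrightarrow> f x = 0) \<Longrightarrow> (\<Sum>x\<leftarrow>xs. f x) = (\<Sum>x\<leftarrow>filter P xs. f x)"
  by (induction xs) auto

text \<open>Each triple yields a monomial, with its unit variables as padding on the left, and a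
  substitution by basis vectors. Since \<open>g 0\<close> is the only vertex substituted, a path of
  \<open>N\<close> variables ends at \<open>g (N - 1)\<close> and reads the prefix of the label
  word; at that coordinate monomials and substitutions are dual.\<close>

lemma codim_lower:
  fixes D :: "(nat \<Rightarrow> 'b option \<Rightarrow> 'a::field) set"
  assumes fin: "\<forall>v\<in>D. \<forall>i. finite (supp (v i))"
    and W: "\<And>N. finite (range (win letter N))"
    and N: "N \<ge> 3"
    and S: "finite S" "\<And>U i T. (U,i,T) \<in> S \<Longrightarrow> U \<subseteq> {..<n} \<and> card U = N \<and> i \<in> U \<and> T \<subseteq> U - {i} \<and>
        card T = count_b (win letter (N - 1) 0) \<and> subst_basis n (U,i,T) \<in> D"
  shows "card S \<le> codim_on (mult_sharp mt) D n"
proof -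
  define u where "u = win letter (N - 1) 0"
  define good where "good s l \<longleftrightarrow> (case s of (U,i,T) \<Rightarrow> distinct l \<and> set l = U - {i} \<and> b_vars l u = T)" for s :: "nat set \<times> nat \<times> nat set" and l
  define el where "el s = (SOME l. good s l)" for s
  have fU: "finite U" if "U \<subseteq> {..<n}" for U using that finite_subset by blast
  have el: "distinct (el (U,i,T))" "set (el (U,i,T)) = U - {i}" "b_vars (el (U,i,T)) u = T"
    if "(U,i,T) \<in> S" for U i T
  proof -
    have s: "U \<subseteq> {..<n}" "card U = N" "i \<in> U" "T \<subseteq> U - {i}" "card T = count_b u"
      using S(2)[OF that] by (auto simp: u_def)
    obtain l where "distinct l" "set l = U - {i}" "b_vars l u = T"
      by (rule obtain_b_vars[of "U - {i}" T u]) (use s fU in \<open>auto simp: u_def\<close>)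
    then have "good (U,i,T) l" by (simp add: good_def)
    then have "good (U,i,T) (el (U,i,T))" unfolding el_def by (rule someI)
    then show "distinct (el (U,i,T))" "set (el (U,i,T)) = U - {i}" "b_vars (el (U,i,T)) u = T"
      by (auto simp: good_def)
  qed
  define tt where "tt s = (case s of (U,i,T) \<Rightarrow> pad_left (sorted_list_of_set ({..<n} - U)) (left_normed (i # el s)))" for s
  have tt: "tt s \<in> multilin_mons n" if "s \<in> S" for s
  proof -
    obtain U i T where s: "s = (U,i,T)" by (cases s) auto
    show ?thesis using el[of U i T] S(2)[of U i T] that fU
      by (auto simp: s tt_def multilin_mons_def leaves_pad_left leaves_left_normed)
  qed
  have dual: "mon_fun (mult_sharp mt) D (tt s') (subst_basis n s) (Some (g (N - 1))) = (if s = s' then 1 else 0)"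
    if ss: "s \<in> S" "s' \<in> S" for s s'
  proof -
    obtain U i T where s: "s = (U,i,T)" by (cases s) auto
    obtain U' i' T' where s': "s' = (U',i',T')" by (cases s') auto
    define v :: "nat \<Rightarrow> 'b option \<Rightarrow> 'a" where "v = subst_basis n s"
    note S1 = S(2)[OF ss(1)[unfolded s]] and S2 = S(2)[OF ss(2)[unfolded s']]
    note el' = el[OF ss(2)[unfolded s']]
    have vD: "v \<in> D" using S1 by (simp add: v_def s)
    have vN: "v j None = (if j \<in> U then 0 else 1)" if "j < n" for j
      using that by (auto simp: v_def s subst_basis_def basis_vec_def)
    have vg: "v j (Some (g p)) = (if j = i \<and> p = 0 then 1 else 0)" if "j < n" for j p
      using that ab S1 inj_g by (auto simp: v_def s subst_basis_def basis_vec_def inj_eq)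
    have vb: "v j (Some bb) = (if j \<in> T then 1 else 0)" if "j < n" for j
      using that ab S1 by (auto simp: v_def s subst_basis_def basis_vec_def)
    have va: "v j (Some aa) = (if j \<in> U - {i} - T then 1 else 0)" if "j < n" for j
      using that ab S1 by (auto simp: v_def s subst_basis_def basis_vec_def)
    have label': "tt s' \<in> multilin_mons n" using tt ss by blast
    then have t': "distinct (leaves (tt s'))" "set (leaves (tt s')) = {..<n}" by (auto simp: multilin_mons_def)
    have len: "Suc (length (el s')) = N"
      using el'(1,2) S2 N fU distinct_card[OF el'(1)] by (simp add: s')
    \<comment> \<open>A path of fewer than \<open>N\<close> variables misses some variable of
      \<open>U\<close>, whose unit component is 0 under this substitution.\<close>
    have short: "(\<Prod>j\<in>{..<n} - set L. v j None) * path_value v L (N - 1) = 0"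
      if "L \<in> set (paths (tt s'))" "\<not> length L \<ge> N" for L
    proof -
      have "card (set L) < card U" using that S1 card_length[of L] by simp
      then have "\<not> U \<subseteq> set L" by (metis List.finite_set card_mono not_le)
      then obtain j where "j \<in> U" "j \<notin> set L" by blast
      then have "(\<Prod>j\<in>{..<n} - set L. v j None) = 0" using vN[of j] S1 by (intro prod_zero) auto
      then show ?thesis by simp
    qed
    have filt: "filter (\<lambda>L. length L \<ge> N) (paths (tt s')) = [i' # el s']"
      using paths_pad_left[OF N] paths_left_normed[of "el s'" i'] len by (simp add: tt_def s')
    have dl: "set (i' # el s') = U'" using el' S2 by (auto simp: s')
    have "mon_fun (mult_sharp mt) D (tt s') v (Some (g (N - 1))) =
        (\<Sum>L\<leftarrow>paths (tt s'). (\<Prod>j\<in>{..<n} - set L. v j None) * path_value v L (N - 1))"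
      using vD by (simp add: mon_fun_def eval_g[OF fin[rule_format, OF vD] t'(1)] t'(2))
    also have "\<dots> = (\<Sum>L\<leftarrow>[i' # el s']. (\<Prod>j\<in>{..<n} - set L. v j None) * path_value v L (N - 1))"
      unfolding filt[symmetric] by (rule sum_list_map_filter_nonzero) (rule short)
    also have "\<dots> = (\<Prod>j\<in>{..<n} - U'. v j None) * path_value v (i' # el s') (N - 1)"
      unfolding dl[symmetric] by simp
    also have "path_value v (i' # el s') (N - 1) = v i' (Some (g 0)) * label_prod v 0 (el s')"
      using len by (auto simp: path_value_def)
    also have "label_prod v 0 (el s') = (\<Prod>j\<in>T'. v j (Some bb)) * (\<Prod>j\<in>U' - {i'} - T'. v j (Some aa))"
    proof -
      have "length (el s') = N - 1" using len by simp
      then have "win letter (length (el s')) 0 = u" by (simp only: u_def)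
      then show ?thesis using label_prod_b_vars[of "el s'" v 0] el' by (simp add: s')
    qed
    finally have val: "mon_fun (mult_sharp mt) D (tt s') v (Some (g (N - 1))) =
       (\<Prod>j\<in>{..<n} - U'. v j None) * (v i' (Some (g 0)) * ((\<Prod>j\<in>T'. v j (Some bb)) * (\<Prod>j\<in>U' - {i'} - T'. v j (Some aa))))" .
    have fin': "finite U'" "finite T'" "finite U" "finite T" using S1 S2 fU by (auto intro: finite_subset)
    show ?thesis
    proof (cases "s = s'")
      case True
      then have e: "U' = U" "i' = i" "T' = T" using s s' by auto
      have "(\<Prod>j\<in>{..<n} - U. v j None) = 1" using vN by (intro prod.neutral) auto
      moreover have "(\<Prod>j\<in>T. v j (Some bb)) = 1" using vb S1 by (intro prod.neutral) auto
      moreover have "(\<Prod>j\<in>U - {i} - T. v j (Some aa)) = 1"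
      proof (intro prod.neutral ballI)
        fix j assume j: "j \<in> U - {i} - T"
        then have "j < n" using S1 by auto
        then show "v j (Some aa) = 1" using va[of j] j by simp
      qed
      moreover have "v i (Some (g 0)) = 1" using vg[of i 0] S1 by auto
      ultimately have "mon_fun (mult_sharp mt) D (tt s') v (Some (g (N - 1))) = 1" using val by (simp add: e)
      then show ?thesis using True by (simp add: v_def)
    next
      case False
      have "mon_fun (mult_sharp mt) D (tt s') v (Some (g (N - 1))) = 0"
      proof (rule ccontr)
        assume "\<not> ?thesis"
        then have nz: "(\<Prod>j\<in>{..<n} - U'. v j None) \<noteq> 0" "v i' (Some (g 0)) \<noteq> 0" "(\<Prod>j\<in>T'. v j (Some bb)) \<noteq> 0"
          unfolding val by auto
        have 1: "i' = i" using nz(2) vg[of i' 0] S2 by (auto split: if_splits)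
        \<comment> \<open>A variable of \<open>U\<close> outside \<open>U'\<close> would contribute
          a zero unit component. Equal cardinalities turn this inclusion, and likewise the one
          between \<open>T'\<close> and \<open>T\<close>, into an equality.\<close>
        have "U \<subseteq> U'"
        proof
          fix j assume j: "j \<in> U"
          show "j \<in> U'"
          proof (rule ccontr)
            assume "j \<notin> U'"
            then have "(\<Prod>j\<in>{..<n} - U'. v j None) = 0" using vN[of j] S1 j by (intro prod_zero) auto
            then show False using nz by simp
          qed
        qed
        then have 2: "U = U'" using S1 S2 fin' by (metis card_subset_eq)
        have "T' \<subseteq> T"
        proof
          fix j assume j: "j \<in> T'"
          show "j \<in> T"
          proof (rule ccontr)
            assume "j \<notin> T"
            then have "(\<Prod>j\<in>T'. v j (Some bb)) = 0" using vb[of j] S2 j fin' by (intro prod_zero) auto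
            then show False using nz by simp
          qed
        qed
        then have "T' = T" using S1 S2 fin' by (metis card_subset_eq)
        then show False using False 1 2 s s' by simp
      qed
      then show ?thesis using False by (simp add: v_def)
    qed
  qed
  show ?thesis unfolding codim_on_def
  proof (rule card_le_dim_if_dual[OF S(1) _ _ mon_fun_in_span[of D, OF fin W, of n], where f="\<lambda>s. mon_fun (mult_sharp mt) D (tt s)"
        and x="subst_basis n" and y="\<lambda>_. Some (g (N - 1))"])
    show "(\<lambda>s. mon_fun (mult_sharp mt) D (tt s)) ` S \<subseteq> mon_fun (mult_sharp mt) D ` multilin_mons n" using tt by auto
    show "finite (insert (unit_fun D n) (word_fun D n ` word_data letter n))" using finite_word_data[OF W] by simp
  qed (use dual in auto)
qed

end

section \<open>The algebra without unit inside the algebra with unit\<close>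

definition emb :: "(nat \<Rightarrow> 'b \<Rightarrow> 'a::field) \<Rightarrow> nat \<Rightarrow> 'b option \<Rightarrow> 'a" where
  "emb v = (\<lambda>i. embed_sharp 0 (v i))"

lemma embed_sharp_simps [simp]: "embed_sharp c x None = c" "embed_sharp c x (Some i) = x i"
  by (simp_all add: embed_sharp_def)

lemma embed_sharp_comp_Some [simp]: "embed_sharp c x \<circ> Some = x"
  by (simp add: fun_eq_iff)

lemma finite_supp_embed: "finite (supp x) \<Longrightarrow> finite (supp (embed_sharp c x))"
proof (rule finite_subset)
  show "supp (embed_sharp c x) \<subseteq> insert None (Some ` supp x)"
  proof
    fix z assume "z \<in> supp (embed_sharp c x)"
    then show "z \<in> insert None (Some ` supp x)" by (cases z) (auto simp: supp_def)
  qed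
qed simp

lemma eval_emb:
  assumes "\<And>i. finite (supp (v i))"
  shows "eval_mon (mult_sharp mt) (emb v) t = embed_sharp 0 (eval_mon mt v t)"
proof (induction t)
  case (Node s t)
  have f: "finite (supp (embed_sharp 0 (eval_mon mt v r)))" for r
    by (intro finite_supp_embed finite_supp_eval assms)
  have "vmul (mult_sharp mt) (embed_sharp 0 (eval_mon mt v s)) (embed_sharp 0 (eval_mon mt v t)) k
      = embed_sharp 0 (vmul mt (eval_mon mt v s) (eval_mon mt v t)) k" for k
    by (cases k) (simp_all add: vmul_sharp f)
  then have "vmul (mult_sharp mt) (embed_sharp 0 (eval_mon mt v s)) (embed_sharp 0 (eval_mon mt v t))
      = embed_sharp 0 (vmul mt (eval_mon mt v s) (eval_mon mt v t))" by (rule ext)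
  then show ?case using Node by simp
qed (simp add: emb_def)

text \<open>\<open>L\<close> transports functions on \<open>D\<close> to functions on the embedded
  substitutions. It is linear, maps each monomial function to its counterpart, and is injective on
  their span, so dimensions agree.\<close>

lemma codim_embed:
  fixes D :: "(nat \<Rightarrow> 'b \<Rightarrow> 'a::field) set"
  assumes fin: "\<forall>v\<in>D. \<forall>i. finite (supp (v i))"
  shows "codim_on (mult_sharp mt) (emb ` D) n = codim_on mt D n"
proof -
  define L :: "((nat \<Rightarrow> 'b \<Rightarrow> 'a) \<Rightarrow> 'b \<Rightarrow> 'a) \<Rightarrow> (nat \<Rightarrow> 'b option \<Rightarrow> 'a) \<Rightarrow> 'b option \<Rightarrow> 'a" where
    "L f = (\<lambda>v k. if v \<in> emb ` D then embed_sharp 0 (f (\<lambda>i. v i \<circ> Some)) k else 0)" for f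
  let ?M = "mon_fun mt D ` multilin_mons n"
  have embS: "(\<lambda>i. emb v i \<circ> Some) = v" for v :: "nat \<Rightarrow> 'b \<Rightarrow> 'a" by (simp add: emb_def)
  have inj: "emb v \<in> emb ` D \<longleftrightarrow> v \<in> D" for v using embS by (metis imageE image_eqI)
  have Lm: "mon_fun (mult_sharp mt) (emb ` D) t = L (mon_fun mt D t)" for t
  proof (intro ext)
    fix v :: "nat \<Rightarrow> 'b option \<Rightarrow> 'a" and k
    show "mon_fun (mult_sharp mt) (emb ` D) t v k = L (mon_fun mt D t) v k"
    proof (cases "v \<in> emb ` D")
      case True
      then obtain v' where v': "v = emb v'" "v' \<in> D" by auto
      then show ?thesis using eval_emb[of v' mt t] fin True embS[of v'] by (simp add: mon_fun_def L_def)
    next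
      case False
      then show ?thesis by (simp add: mon_fun_def L_def)
    qed
  qed
  have lin: "Vector_Spaces.linear fscale fscale L"
  proof (unfold_locales)
    fix f f' and c :: 'a
    show "L (f + f') = L f + L f'"
      by (intro ext) (auto simp: L_def embed_sharp_def plus_fun_def split: option.split)
    show "L (fscale c f) = fscale c (L f)"
      by (intro ext) (auto simp: L_def embed_sharp_def fscale_def split: option.split)
  qed
  interpret L: Vector_Spaces.linear fscale fscale L by (rule lin)
  \<comment> \<open>\<open>L\<close> only sees values on \<open>D\<close>; injectivity therefore
    needs that functions in the span vanish elsewhere.\<close>
  have van: "f v = 0" if "f \<in> fs.span ?M" "v \<notin> D" for f v
    using that(1)
  proof (induction rule: fs.span_induct_alt)
    case (step c x y)
    then show ?case using that(2) by (auto simp: fscale_def mon_fun_def fun_eq_iff)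
  qed simp
  have injL: "inj_on L (fs.span ?M)"
  proof (rule inj_onI)
    fix f f' assume f: "f \<in> fs.span ?M" "f' \<in> fs.span ?M" "L f = L f'"
    show "f = f'"
    proof (intro ext)
      fix v k
      show "f v k = f' v k"
      proof (cases "v \<in> D")
        case True
        have "L f (emb v) (Some k) = L f' (emb v) (Some k)" using f by simp
        then show ?thesis using True by (simp add: L_def embS)
      qed (use van f in simp)
    qed
  qed
  obtain B where B: "B \<subseteq> ?M" "fs.independent B" "?M \<subseteq> fs.span B" "card B = fs.dim ?M"
    by (rule fs.basis_exists)
  have sBM: "fs.span B \<subseteq> fs.span ?M" using B(1) by (rule fs.span_mono)
  have BsM: "B \<subseteq> fs.span ?M" using B(1) fs.span_superset by blast
  have "fs.dim (L ` ?M) = card B"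
  proof (rule fs.dim_unique[of "L ` B"])
    show "L ` B \<subseteq> L ` ?M" using B by blast
    show "L ` ?M \<subseteq> fs.span (L ` B)" unfolding L.span_image using B by blast
    show "fs.independent (L ` B)" using L.dependent_inj_imageD[of B] B(2) inj_on_subset[OF injL sBM] by blast
    show "card (L ` B) = card B" by (rule card_image) (rule inj_on_subset[OF injL BsM])
  qed
  moreover have "mon_fun (mult_sharp mt) (emb ` D) ` multilin_mons n = L ` ?M"
    by (auto simp: Lm)
  ultimately show ?thesis unfolding codim_on_def using B by simp
qed

section \<open>Counting compatible parities\<close>

definition triples :: "nat \<Rightarrow> nat \<Rightarrow> nat \<Rightarrow> (nat set \<times> nat \<times> nat set) set" where
  "triples n N s = {(V,i,T). V \<subseteq> {..<n} \<and> card V = N \<and> i \<in> V \<and> T \<subseteq> V - {i} \<and> card T = s}"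

lemma finite_triples: "finite (triples n N s)"
  by (rule finite_subset[of _ "Pow {..<n} \<times> {..<n} \<times> Pow {..<n}"]) (auto simp: triples_def)

lemma card_triples: "card (triples n N s) = (n choose N) * (N * ((N - 1) choose s))"
proof -
  have fin: "finite V" if "V \<subseteq> {..<n}" for V using that finite_subset by blast
  have eq: "triples n N s = (SIGMA V:{V. V \<subseteq> {..<n} \<and> card V = N}. SIGMA i:V. {T. T \<subseteq> V - {i} \<and> card T = s})"
    by (auto simp: triples_def)
  have "card (triples n N s) = (\<Sum>V\<in>{V. V \<subseteq> {..<n} \<and> card V = N}. card (SIGMA i:V. {T. T \<subseteq> V - {i} \<and> card T = s}))"
    unfolding eq using fin by (subst card_SigmaI) auto
  also have "\<dots> = (\<Sum>V\<in>{V. V \<subseteq> {..<n} \<and> card V = N}. N * ((N - 1) choose s))"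
  proof (intro sum.cong refl)
    fix V assume "V \<in> {V. V \<subseteq> {..<n} \<and> card V = N}"
    then have V: "finite V" "card V = N" using fin by auto
    have "card (SIGMA i:V. {T. T \<subseteq> V - {i} \<and> card T = s}) = (\<Sum>i\<in>V. card {T. T \<subseteq> V - {i} \<and> card T = s})"
      using V by (subst card_SigmaI) auto
    also have "\<dots> = (\<Sum>i\<in>V. (N - 1) choose s)" using V by (intro sum.cong refl) (simp add: n_subsets)
    also have "\<dots> = N * ((N - 1) choose s)" using V by simp
    finally show "card (SIGMA i:V. {T. T \<subseteq> V - {i} \<and> card T = s}) = N * ((N - 1) choose s)" .
  qed
  also have "\<dots> = (n choose N) * (N * ((N - 1) choose s))" by (simp add: n_subsets)
  finally show ?thesis .
qed

text \<open>A set \<open>E\<close> of even variables is compatible with a triple \<open>(V,i,T)\<close> if the unit is substituted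
  for even variables only, while the variables in \<open>T\<close> and in \<open>V - {i} - T\<close> have the parities \<open>pb\<close> of \<open>b\<close>
  and \<open>pa\<close> of \<open>a\<close>; \<open>Q\<close> constrains the parity of the variable for which some \<open>z\<close> is substituted.\<close>

definition parity_compat :: "bool \<Rightarrow> bool \<Rightarrow> (bool \<Rightarrow> bool) \<Rightarrow> nat \<Rightarrow> nat set \<Rightarrow> nat set \<times> nat \<times> nat set \<Rightarrow> bool" where
  "parity_compat pa pb Q n E = (\<lambda>(V,i,T). (\<forall>j\<in>{..<n} - V. j \<in> E) \<and> (\<forall>j\<in>T. (j \<in> E) = pb) \<and>
     (\<forall>j\<in>V - {i} - T. (j \<in> E) = pa) \<and> Q (i \<in> E))"

text \<open>A permutation of the variables carrying \<open>E\<close> to \<open>E'\<close> maps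
  compatible triples injectively to compatible triples. Hence the count depends only on the number
  of even variables, and may be computed for \<open>{..<k}\<close>.\<close>

lemma card_compat_le:
  assumes E: "E \<subseteq> {..<n}" "E' \<subseteq> {..<n}" "card E = card E'"
  shows "card {x \<in> triples n N s. parity_compat pa pb Q n E x} \<le> card {x \<in> triples n N s. parity_compat pa pb Q n E' x}"
proof -
  have fin: "finite E" "finite E'" using E finite_subset by blast+
  obtain h where h: "bij_betw h E E'" using finite_same_card_bij[OF fin E(3)] by blast
  have "card ({..<n} - E) = card ({..<n} - E')" using E fin by (simp add: card_Diff_subset)
  then obtain h' where h': "bij_betw h' ({..<n} - E) ({..<n} - E')"
    using finite_same_card_bij[of "{..<n} - E" "{..<n} - E'"] by auto
  define \<pi> where "\<pi> j = (if j \<in> E then h j else h' j)" for j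
  have "bij_betw \<pi> E E'" using h by (rule bij_betw_cong[THEN iffD1, rotated]) (simp add: \<pi>_def)
  moreover have "bij_betw \<pi> ({..<n} - E) ({..<n} - E')" using h' by (rule bij_betw_cong[THEN iffD1, rotated]) (simp add: \<pi>_def)
  ultimately have "bij_betw \<pi> (E \<union> ({..<n} - E)) (E' \<union> ({..<n} - E'))"
    by (rule bij_betw_combine) auto
  moreover have "E \<union> ({..<n} - E) = {..<n}" "E' \<union> ({..<n} - E') = {..<n}" using E by auto
  ultimately have bij: "bij_betw \<pi> {..<n} {..<n}" by simp
  then have inj: "inj_on \<pi> {..<n}" and im: "\<pi> ` {..<n} = {..<n}" by (auto simp: bij_betw_def)
  have label: "\<pi> j < n" if "j < n" for j using im that by auto
  have mem: "\<pi> j \<in> E' \<longleftrightarrow> j \<in> E" if "j < n" for j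
    using that h h' by (auto simp: \<pi>_def bij_betw_def)
  have memV: "\<pi> j \<in> \<pi> ` V \<longleftrightarrow> j \<in> V" if "j < n" "V \<subseteq> {..<n}" for j V
    using inj_on_image_mem_iff[OF inj] that by simp
  define F where "F = (\<lambda>(V,i,T). (\<pi> ` V, \<pi> i, \<pi> ` T))"
  show ?thesis
  proof (rule card_inj_on_le)
    show "inj_on F {x \<in> triples n N s. parity_compat pa pb Q n E x}"
    proof (rule inj_onI, clarsimp simp: F_def)
      fix V i T V' i' T'
      assume t: "(V,i,T) \<in> triples n N s" "(V',i',T') \<in> triples n N s"
        and eq: "\<pi> ` V = \<pi> ` V'" "\<pi> i = \<pi> i'" "\<pi> ` T = \<pi> ` T'"
      have "V \<subseteq> {..<n}" "V' \<subseteq> {..<n}" "T \<subseteq> {..<n}" "T' \<subseteq> {..<n}" "i < n" "i' < n"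
        using t by (auto simp: triples_def)
      then show "V = V' \<and> i = i' \<and> T = T'"
        using eq inj_on_image_eq_iff[OF inj] inj_onD[OF inj, of i i'] by auto
    qed
    show "F ` {x \<in> triples n N s. parity_compat pa pb Q n E x} \<subseteq> {x \<in> triples n N s. parity_compat pa pb Q n E' x}"
    proof (clarsimp simp: F_def)
      fix V i T
      assume t: "(V,i,T) \<in> triples n N s" and c: "parity_compat pa pb Q n E (V,i,T)"
      have V: "V \<subseteq> {..<n}" "T \<subseteq> {..<n}" "i < n" "i \<in> V" "T \<subseteq> V - {i}" "card V = N" "card T = s"
        using t by (auto simp: triples_def)
      have iT: "\<pi> i \<notin> \<pi> ` T" using memV[of i T] V by auto
      have cards: "card (\<pi> ` V) = N" "card (\<pi> ` T) = s"
        using V inj_on_subset[OF inj] by (auto simp: card_image)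
      have "\<pi> ` V \<subseteq> {..<n}" using V label by auto
      moreover have "\<pi> ` T \<subseteq> \<pi> ` V - {\<pi> i}" using V iT by blast
      ultimately have "(\<pi> ` V, \<pi> i, \<pi> ` T) \<in> triples n N s"
        using V(4) cards by (simp add: triples_def)
      moreover have "parity_compat pa pb Q n E' (\<pi> ` V, \<pi> i, \<pi> ` T)"
      proof -
        have "j \<in> E'" if "j \<in> {..<n} - \<pi> ` V" for j
        proof -
          have "j \<in> \<pi> ` {..<n}" using that im by blast
          then obtain j' where j': "j' < n" "j = \<pi> j'" by blast
          then have "j' \<notin> V" using that by auto
          then show ?thesis using c j' mem[of j'] by (auto simp: parity_compat_def)
        qed
        moreover have "(\<pi> j \<in> E') = pb" if "j \<in> T" for j
        proof -
          have "j < n" using that V by auto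
          then show ?thesis using mem[of j] c that by (auto simp: parity_compat_def)
        qed
        moreover have "(\<pi> j \<in> E') = pa" if "j \<in> V" "\<pi> j \<noteq> \<pi> i" "\<pi> j \<notin> \<pi> ` T" for j
        proof -
          have "j < n" "j \<noteq> i" "j \<notin> T" using that V by auto
          then show ?thesis using mem[of j] c that by (auto simp: parity_compat_def)
        qed
        moreover have "Q (\<pi> i \<in> E')" using mem[of i] V c by (simp add: parity_compat_def)
        ultimately show ?thesis by (auto simp: parity_compat_def)
      qed
      ultimately show "(\<pi> ` V, \<pi> i, \<pi> ` T) \<in> triples n N s \<and> parity_compat pa pb Q n E' (\<pi> ` V, \<pi> i, \<pi> ` T)" by blast
    qed
    show "finite {x \<in> triples n N s. parity_compat pa pb Q n E' x}" using finite_triples by simp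
  qed
qed

text \<open>Reads the weights in the graded codimension as a sum over all choices of even variables,
  which permits double counting.\<close>

lemma sum_binomial_eq_sum_Pow:
  fixes f :: "nat set \<Rightarrow> nat"
  assumes "\<And>E E'. E \<subseteq> {..<n} \<Longrightarrow> E' \<subseteq> {..<n} \<Longrightarrow> card E = card E' \<Longrightarrow> f E \<le> f E'"
  shows "(\<Sum>k\<le>n. (n choose k) * f {..<k}) = (\<Sum>E\<in>Pow {..<n}. f E)"
proof -
  have "(\<Sum>E\<in>Pow {..<n}. f E) = (\<Sum>k\<in>{..n}. \<Sum>E\<in>{E \<in> Pow {..<n}. card E = k}. f E)"
    by (rule sum.group[symmetric]) (auto intro: card_mono[of "{..<n}", simplified])
  also have "\<dots> = (\<Sum>k\<le>n. (n choose k) * f {..<k})"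
  proof (intro sum.cong refl)
    fix k assume k: "k \<in> {..n}"
    have "f E = f {..<k}" if "E \<in> {E \<in> Pow {..<n}. card E = k}" for E
      using that k by (intro antisym assms) auto
    then have "(\<Sum>E\<in>{E \<in> Pow {..<n}. card E = k}. f E) = (\<Sum>E\<in>{E \<in> Pow {..<n}. card E = k}. f {..<k})"
      by (intro sum.cong) auto
    also have "\<dots> = (n choose k) * f {..<k}" by (simp add: n_subsets Pow_def)
    finally show "(\<Sum>E\<in>{E \<in> Pow {..<n}. card E = k}. f E) = (n choose k) * f {..<k}" .
  qed
  finally show ?thesis by simp
qed

lemma sum_card_swap:
  assumes "finite A" "finite B"
  shows "(\<Sum>a\<in>A. card {b \<in> B. P a b}) = (\<Sum>b\<in>B. card {a \<in> A. P a b})"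
proof -
  have "(\<Sum>a\<in>A. card {b \<in> B. P a b}) = (\<Sum>a\<in>A. \<Sum>b\<in>B. if P a b then 1 else 0)"
    using assms by (simp add: card_eq_sum sum.inter_filter del: sum_constant One_nat_def)
  also have "\<dots> = (\<Sum>b\<in>B. \<Sum>a\<in>A. if P a b then 1 else 0)" by (rule sum.swap)
  also have "\<dots> = (\<Sum>b\<in>B. card {a \<in> A. P a b})"
    using assms by (simp add: card_eq_sum sum.inter_filter del: sum_constant One_nat_def)
  finally show ?thesis .
qed

lemma sum_compat:
  "(\<Sum>k\<le>n. (n choose k) * card {x \<in> triples n N s. parity_compat pa pb Q n {..<k} x})
    = (\<Sum>x\<in>triples n N s. card {E \<in> Pow {..<n}. parity_compat pa pb Q n E x})"
  by (subst sum_binomial_eq_sum_Pow) (auto intro: card_compat_le simp: sum_card_swap finite_triples)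

text \<open>A triple determines the parity of every variable except \<open>i\<close>, hence at most
  two compatible sets.\<close>

lemma sum_compat_upper:
  "(\<Sum>k\<le>n. (n choose k) * card {x \<in> triples n N s. parity_compat pa pb Q n {..<k} x}) \<le> 2 * card (triples n N s)"
proof -
  have "card {E \<in> Pow {..<n}. parity_compat pa pb Q n E x} \<le> 2" if x: "x \<in> triples n N s" for x
  proof -
    obtain V i T where Vx: "x = (V,i,T)" by (cases x) auto
    have "card {E \<in> Pow {..<n}. parity_compat pa pb Q n E x} \<le> card (UNIV :: bool set)"
    proof (rule card_inj_on_le[where f="\<lambda>E. i \<in> E"])
      show "inj_on (\<lambda>E. i \<in> E) {E \<in> Pow {..<n}. parity_compat pa pb Q n E x}"
      proof (rule inj_onI)
        fix E E' assume e: "E \<in> {E \<in> Pow {..<n}. parity_compat pa pb Q n E x}" "E' \<in> {E \<in> Pow {..<n}. parity_compat pa pb Q n E x}"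
          and i: "(i \<in> E) = (i \<in> E')"
        have "j \<in> E \<longleftrightarrow> j \<in> E'" if "j < n" for j
        proof -
          consider "j \<in> {..<n} - V" | "j \<in> T" | "j \<in> V - {i} - T" | "j = i" using \<open>j < n\<close> by blast
          then show ?thesis using e i unfolding Vx parity_compat_def by cases auto
        qed
        then show "E = E'" using e by blast
      qed
    qed auto
    then show ?thesis by simp
  qed
  then have "(\<Sum>x\<in>triples n N s. card {E \<in> Pow {..<n}. parity_compat pa pb Q n E x}) \<le> of_nat (card (triples n N s)) * 2"
    by (intro sum_bounded_above) auto
  then show ?thesis unfolding sum_compat by simp
qed

text \<open>Once the parity of the variable \<open>i\<close> is prescribed, the compatible set can
  be written down explicitly for each triple.\<close>

lemma sum_compat_lower:
  "card (triples n N s) \<le> (\<Sum>k\<le>n. (n choose k) * card {x \<in> triples n N s. parity_compat pa pb (\<lambda>c. c = pz) n {..<k} x})"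
proof -
  have "1 \<le> card {E \<in> Pow {..<n}. parity_compat pa pb (\<lambda>c. c = pz) n E x}" if x: "x \<in> triples n N s" for x
  proof -
    obtain V i T where Vx: "x = (V,i,T)" by (cases x) auto
    define E where "E = {j. j < n \<and> (j \<notin> V \<or> (j \<in> T \<and> pb) \<or> (j \<in> V - {i} - T \<and> pa) \<or> (j = i \<and> pz))}"
    have "E \<in> {E \<in> Pow {..<n}. parity_compat pa pb (\<lambda>c. c = pz) n E x}"
      using x unfolding Vx by (auto simp: E_def parity_compat_def triples_def)
    then have "{E \<in> Pow {..<n}. parity_compat pa pb (\<lambda>c. c = pz) n E x} \<noteq> {}" by blast
    then show ?thesis by (simp add: Suc_le_eq card_gt_0_iff)
  qed
  then have "of_nat (card (triples n N s)) * 1 \<le> (\<Sum>x\<in>triples n N s. card {E \<in> Pow {..<n}. parity_compat pa pb (\<lambda>c. c = pz) n E x})"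
    by (intro sum_bounded_below) auto
  then show ?thesis unfolding sum_compat by simp
qed

lemma card_word_data_le:
  assumes W: "\<And>N. finite (range (win letter N))" and "finite \<N>"
  shows "card {(V,u,i,T). (V,u,i,T) \<in> word_data letter n \<and> card V \<in> \<N> \<and> P (V,i,T)}
     \<le> (\<Sum>N\<in>\<N>. \<Sum>u\<in>range (win letter (N - 1)). card {x \<in> triples n N (count_b u). P x})"
proof -
  let ?A = "\<lambda>N u. (\<lambda>(V,i,T). (V,u,i,T)) ` {x \<in> triples n N (count_b u). P x}"
  have fA: "finite (?A N u)" for N u using finite_triples by simp
  have "{(V,u,i,T). (V,u,i,T) \<in> word_data letter n \<and> card V \<in> \<N> \<and> P (V,i,T)}
     \<subseteq> (\<Union>N\<in>\<N>. \<Union>u\<in>range (win letter (N - 1)). ?A N u)"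
  proof clarify
    fix V u i T assume a: "(V,u,i,T) \<in> word_data letter n" "card V \<in> \<N>" "P (V,i,T)"
    then have "(V,i,T) \<in> {x \<in> triples n (card V) (count_b u). P x}" by (auto simp: word_data_def triples_def)
    then have "(V,u,i,T) \<in> ?A (card V) u" by (force simp: image_iff)
    moreover have "u \<in> range (win letter (card V - 1))" using a by (auto simp: word_data_def)
    ultimately show "(V,u,i,T) \<in> (\<Union>N\<in>\<N>. \<Union>u\<in>range (win letter (N - 1)). ?A N u)" using a(2) by blast
  qed
  then have "card {(V,u,i,T). (V,u,i,T) \<in> word_data letter n \<and> card V \<in> \<N> \<and> P (V,i,T)}
     \<le> card (\<Union>N\<in>\<N>. \<Union>u\<in>range (win letter (N - 1)). ?A N u)"
    using W assms(2) fA by (intro card_mono finite_UN_I) auto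
  also have "\<dots> \<le> (\<Sum>N\<in>\<N>. card (\<Union>u\<in>range (win letter (N - 1)). ?A N u))"
    by (rule card_UN_le) (rule assms)
  also have "\<dots> \<le> (\<Sum>N\<in>\<N>. \<Sum>u\<in>range (win letter (N - 1)). card (?A N u))"
    by (intro sum_mono card_UN_le W)
  also have "\<dots> \<le> (\<Sum>N\<in>\<N>. \<Sum>u\<in>range (win letter (N - 1)). card {x \<in> triples n N (count_b u). P x})"
    using finite_triples by (intro sum_mono card_image_le) simp
  finally show ?thesis .
qed

text \<open>For \<open>N\<close> variables on the path: the choice of the first one, times the
  choices of those at the letters \<open>b\<close>, summed over all factors.
  \<open>prefix_count\<close> keeps only the factor read from the initial vertex.\<close>

definition word_count :: "(nat \<Rightarrow> bool) \<Rightarrow> nat \<Rightarrow> nat" where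
  "word_count letter N = (\<Sum>u\<in>range (win letter (N - 1)). N * ((N - 1) choose count_b u))"

definition prefix_count :: "(nat \<Rightarrow> bool) \<Rightarrow> nat \<Rightarrow> nat" where
  "prefix_count letter N = N * ((N - 1) choose count_b (win letter (N - 1) 0))"

text \<open>Interchanging the sums lets \<open>sum_compat_upper\<close> act for each word. The
  constant \<open>h\<close>, the share of \<open>unit_fun\<close>, is multiplied by the total weight
  \<open>2 ^ n\<close>.\<close>

lemma weighted_sum_upper:
  assumes c: "\<And>k. k \<le> n \<Longrightarrow> c k \<le> (\<Sum>N\<in>\<N>. \<Sum>u\<in>range (win letter (N - 1)).
      card {x \<in> triples n N (count_b u). parity_compat pa pb Q n {..<k} x}) + h"
  shows "(\<Sum>k\<le>n. (n choose k) * c k) \<le> 2 * (\<Sum>N\<in>\<N>. (n choose N) * word_count letter N) + h * 2 ^ n"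
proof -
  let ?t = "\<lambda>k N u. card {x \<in> triples n N (count_b u). parity_compat pa pb Q n {..<k} x}"
  have "(\<Sum>k\<le>n. (n choose k) * c k)
     \<le> (\<Sum>k\<le>n. (n choose k) * ((\<Sum>N\<in>\<N>. \<Sum>u\<in>range (win letter (N - 1)). ?t k N u) + h))"
    using c by (intro sum_mono mult_left_mono) auto
  also have "\<dots> = (\<Sum>k\<le>n. \<Sum>N\<in>\<N>. \<Sum>u\<in>range (win letter (N - 1)). (n choose k) * ?t k N u) + h * (\<Sum>k\<le>n. n choose k)"
    by (simp add: distrib_left sum.distrib sum_distrib_left mult.commute)
  also have "(\<Sum>k\<le>n. \<Sum>N\<in>\<N>. \<Sum>u\<in>range (win letter (N - 1)). (n choose k) * ?t k N u)
     = (\<Sum>N\<in>\<N>. \<Sum>u\<in>range (win letter (N - 1)). \<Sum>k\<le>n. (n choose k) * ?t k N u)"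
    by (subst sum.swap) (intro sum.cong refl sum.swap)
  also have "(\<Sum>k\<le>n. n choose k) = 2 ^ n" by (rule choose_row_sum)
  also have "(\<Sum>N\<in>\<N>. \<Sum>u\<in>range (win letter (N - 1)). \<Sum>k\<le>n. (n choose k) * ?t k N u)
     \<le> (\<Sum>N\<in>\<N>. \<Sum>u\<in>range (win letter (N - 1)). 2 * card (triples n N (count_b u)))"
    by (intro sum_mono sum_compat_upper)
  also have "\<dots> = 2 * (\<Sum>N\<in>\<N>. (n choose N) * word_count letter N)"
    by (simp add: card_triples word_count_def sum_distrib_left mult.assoc)
  finally show ?thesis by simp
qed

lemma weighted_sum_lower:
  assumes "\<And>k. k \<le> n \<Longrightarrow> card {x \<in> triples n N (count_b (win letter (N - 1) 0)). parity_compat pa pb (\<lambda>c. c = pz) n {..<k} x} \<le> c k"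
  shows "(n choose N) * prefix_count letter N \<le> (\<Sum>k\<le>n. (n choose k) * c k)"
proof -
  have "(n choose N) * prefix_count letter N = card (triples n N (count_b (win letter (N - 1) 0)))"
    by (simp add: card_triples prefix_count_def)
  also have "\<dots> \<le> (\<Sum>k\<le>n. (n choose k) * card {x \<in> triples n N (count_b (win letter (N - 1) 0)). parity_compat pa pb (\<lambda>c. c = pz) n {..<k} x})"
    by (rule sum_compat_lower)
  also have "\<dots> \<le> (\<Sum>k\<le>n. (n choose k) * c k)" using assms by (intro sum_mono mult_left_mono) auto
  finally show ?thesis .
qed

section \<open>The algebra of a word\<close>

primrec z_index :: "nat \<Rightarrow> (nat \<Rightarrow> nat) \<Rightarrow> nat \<Rightarrow> nat \<times> nat" where
  "z_index m w 0 = (1, 1)"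
| "z_index m w (Suc p) = (let (i, j) = z_index m w p in if j < m + w i then (i, Suc j) else (Suc i, 1))"

definition z_at :: "nat \<Rightarrow> (nat \<Rightarrow> nat) \<Rightarrow> nat \<Rightarrow> gen" where
  "z_at m w p = (let (i, j) = z_index m w p in Gz i j)"

definition is_b :: "nat \<Rightarrow> (nat \<Rightarrow> nat) \<Rightarrow> nat \<Rightarrow> bool" where
  "is_b m w p = (let (i, j) = z_index m w p in \<not> j < m + w i)"

text \<open>Row \<open>k\<close> of the \<open>z\<close>'s has length \<open>m + w k\<close>;
  position is recovered from row and column. This yields injectivity of the enumeration and, later,
  the frequency of the letter \<open>b\<close>.\<close>

lemma z_index_index:
  assumes "m \<ge> 1" "z_index m w p = (i, j)"
  shows "1 \<le> i \<and> 1 \<le> j \<and> j \<le> m + w i \<and> Suc p = (\<Sum>k\<in>{1..<i}. m + w k) + j"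
  using assms(2)
proof (induction p arbitrary: i j)
  case (Suc p)
  obtain i' j' where z: "z_index m w p = (i', j')" by fastforce
  note IH = Suc.IH[OF z]
  have rec: "(i, j) = (if j' < m + w i' then (i', Suc j') else (Suc i', 1))" using Suc.prems z by simp
  have "(\<Sum>k\<in>{1..<Suc i'}. m + w k) = (\<Sum>k\<in>{1..<i'}. m + w k) + (m + w i')"
    using IH by (simp add: sum.atLeastLessThan_Suc)
  then show ?case using IH rec assms(1) by (auto split: if_splits)
qed (use assms in auto)

lemma z_index_inj:
  assumes "m \<ge> 1" "z_index m w p = z_index m w q"
  shows "p = q"
proof -
  obtain i j where "z_index m w q = (i, j)" by fastforce
  then have "Suc p = (\<Sum>k\<in>{1..<i}. m + w k) + j" "Suc q = (\<Sum>k\<in>{1..<i}. m + w k) + j"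
    using z_index_index[of m w p i j] z_index_index[of m w q i j] assms by simp_all
  then show ?thesis by simp
qed

lemma z_index_surj:
  assumes m: "m \<ge> 1" and "1 \<le> i" "1 \<le> j" "j \<le> m + w i"
  shows "\<exists>p. z_index m w p = (i, j)"
proof -
  have row: "\<exists>p. z_index m w p = (i, j)" if "\<exists>p. z_index m w p = (i, 1)" "1 \<le> j" "j \<le> m + w i" for i j
    using that(2,3)
  proof (induction j rule: dec_induct)
    case base
    then show ?case using that by simp
  next
    case (step j)
    then obtain p where "z_index m w p = (i, j)" by auto
    then have "z_index m w (Suc p) = (i, Suc j)" using step by simp
    then show ?case by blast
  qed
  have "\<exists>p. z_index m w p = (i, 1)" using \<open>1 \<le> i\<close>
  proof (induction i rule: dec_induct)
    case base
    then show ?case by (intro exI[of _ 0]) simp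
  next
    case (step i)
    then obtain p where "z_index m w p = (i, m + w i)" using row[of i "m + w i"] m by auto
    then have "z_index m w (Suc p) = (Suc i, 1)" by simp
    then show ?case by blast
  qed
  then show ?thesis using row assms by blast
qed

lemma path_algebra_multA:
  assumes m: "m \<ge> 1"
  shows "path_algebra (multA m w) (z_at m w) (is_b m w) Ga Gb"
proof
  fix x y r
  show "multA m w x y = Some r \<longleftrightarrow> (\<exists>p. x = z_at m w p \<and> y = (if is_b m w p then Gb else Ga) \<and> r = z_at m w (Suc p))"
  proof
    assume a: "multA m w x y = Some r"
    then obtain i j where x: "x = Gz i j" by (cases x) auto
    have v: "1 \<le> i" "1 \<le> j" "j \<le> m + w i" using a m unfolding x by (cases y; auto split: if_splits)+
    obtain p where p: "z_index m w p = (i, j)" using z_index_surj[of m i j w, OF m v] by blast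
    show "\<exists>p. x = z_at m w p \<and> y = (if is_b m w p then Gb else Ga) \<and> r = z_at m w (Suc p)"
      by (rule exI[of _ p], cases y) (use a p x in \<open>auto simp: z_at_def is_b_def split: if_splits\<close>)
  next
    assume "\<exists>p. x = z_at m w p \<and> y = (if is_b m w p then Gb else Ga) \<and> r = z_at m w (Suc p)"
    then obtain p where p: "x = z_at m w p" "y = (if is_b m w p then Gb else Ga)" "r = z_at m w (Suc p)" by blast
    obtain i j where z: "z_index m w p = (i, j)" by fastforce
    have "1 \<le> i" "1 \<le> j" "j \<le> m + w i" using z_index_index[OF m z] by auto
    then show "multA m w x y = Some r" using z p by (auto simp: z_at_def is_b_def)
  qed
next
  show "inj (z_at m w)"
  proof (rule injI)
    fix p q assume "z_at m w p = z_at m w q"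
    then have "z_index m w p = z_index m w q" by (auto simp: z_at_def split: prod.splits)
    then show "p = q" by (rule z_index_inj[OF m])
  qed
qed (auto simp: z_at_def split: prod.splits)

lemma basisA_z_at:
  assumes m: "m \<ge> 1"
  shows "basisA m w = {Ga, Gb} \<union> range (z_at m w)"
proof -
  have "z_at m w p \<in> basisA m w" for p
    using z_index_index[OF m, of w p] by (cases "z_index m w p") (auto simp: z_at_def basisA_def)
  moreover have "Gz i j \<in> range (z_at m w)" if "1 \<le> i" "1 \<le> j" "j \<le> m + w i" for i j
  proof -
    from z_index_surj[of m i j w, OF m that] obtain p where "z_index m w p = (i, j)" by blast
    then have "z_at m w p = Gz i j" by (simp add: z_at_def)
    then show ?thesis by (metis rangeI)
  qed
  ultimately show ?thesis by (auto simp: basisA_def)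
qed

lemma fst_z_index: "fst (z_index m w (p + N)) = fst (z_index m w p) + count_b (win (is_b m w) N p)"
  by (induction N) (auto simp: win_Suc is_b_def Let_def split: prod.splits)

text \<open>A window with \<open>s\<close> letters \<open>b\<close> moves down \<open>s\<close>
  rows, so \<open>N\<close> equals the total length of these rows up to the difference of two
  columns, both between 1 and m + 1. The discrepancy of \<open>w\<close> then compares
  \<open>N\<close> with \<open>s * (m + \<alpha>)\<close>, and dividing by
  \<open>m + \<alpha> \<ge> 1\<close> does not enlarge the error.\<close>

lemma is_b_discrepancy:
  assumes m: "m \<ge> 1" and bin: "binary_word w" and \<alpha>: "\<alpha> \<ge> 0"
    and C: "\<And>i n. \<bar>real (\<Sum>k<n. w (Suc (i+k))) - real n * \<alpha>\<bar> \<le> C"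
  shows "\<bar>real (count_b (win (is_b m w) N p)) - real N * (1 / (real m + \<alpha>))\<bar> \<le> C + real m + 1"
proof -
  define s where "s = count_b (win (is_b m w) N p)"
  obtain i j i' j' where z: "z_index m w p = (i, j)" "z_index m w (p + N) = (i', j')" by fastforce
  have i': "i' = i + s" using fst_z_index[of m w p N] z by (simp add: s_def)
  note z1 = z_index_index[OF m z(1)] and z2 = z_index_index[OF m z(2)]
  have w1: "w k \<le> 1" if "k \<ge> 1" for k using bin that unfolding binary_word_def by force
  have "j \<le> m + 1" "j' \<le> m + 1" using z1 z2 w1[of i] w1[of i'] by auto
  have "(\<Sum>k\<in>{1..<i'}. m + w k) = (\<Sum>k\<in>{1..<i}. m + w k) + (\<Sum>k\<in>{i..<i'}. m + w k)"
    using z1 i' by (intro sum.atLeastLessThan_concat[symmetric]) auto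
  moreover have "(\<Sum>k\<in>{i..<i'}. m + w k) = (\<Sum>k<s. m + w (i + k))"
    unfolding i' by (rule sum.reindex_bij_witness[of _ "\<lambda>k. i + k" "\<lambda>k. k - i"]) auto
  moreover have "(\<Sum>k<s. m + w (i + k)) = s * m + (\<Sum>k<s. w (i + k))" by (simp add: sum.distrib)
  ultimately have "N + j = s * m + (\<Sum>k<s. w (i + k)) + j'" using z1 z2 by simp
  then have eq: "real N + real j = real s * real m + real (\<Sum>k<s. w (i + k)) + real j'"
    by (metis of_nat_add of_nat_mult)
  have "(\<Sum>k<s. w (Suc (i - 1 + k))) = (\<Sum>k<s. w (i + k))" using z1 by simp
  then have "\<bar>real (\<Sum>k<s. w (i + k)) - real s * \<alpha>\<bar> \<le> C" using C[where i="i - 1" and n=s] by simp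
  then have b: "\<bar>real s * (real m + \<alpha>) - real N\<bar> \<le> C + real m + 1"
    using eq \<open>j \<le> m + 1\<close> \<open>j' \<le> m + 1\<close> z1 z2 by (simp add: algebra_simps abs_le_iff)
  have pos: "real m + \<alpha> \<ge> 1" using m \<alpha> by simp
  have "\<bar>real s - real N * (1 / (real m + \<alpha>))\<bar> = \<bar>real s * (real m + \<alpha>) - real N\<bar> / (real m + \<alpha>)"
    using pos by (simp add: abs_divide[symmetric] field_simps flip: abs_mult)
  also have "\<dots> \<le> \<bar>real s * (real m + \<alpha>) - real N\<bar> / 1" using pos by (intro divide_left_mono) auto
  finally show ?thesis using b by (simp add: s_def)
qed

text \<open>A window is determined by the column where it starts and the next \<open>N\<close>
  letters of \<open>w\<close>, because the row advances at most once per step. There are at most m +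
  1 columns.\<close>

lemma is_b_words:
  assumes m: "m \<ge> 1" and bin: "binary_word w"
    and fin: "finite (range (win (\<lambda>k. w (Suc k)) N))"
    and card: "card (range (win (\<lambda>k. w (Suc k)) N)) \<le> N + q"
  shows "finite (range (win (is_b m w) N))" "card (range (win (is_b m w) N)) \<le> (m + 1) * (N + q)"
proof -
  define key where "key p = (snd (z_index m w p), win (\<lambda>k. w (Suc k)) N (fst (z_index m w p) - 1))" for p
  have det: "win (is_b m w) N p = win (is_b m w) N p'" if "key p = key p'" for p p'
  proof -
    obtain i i' j where z: "z_index m w p = (i, j)" "z_index m w p' = (i', j)"
      using \<open>key p = key p'\<close> by (cases "z_index m w p"; cases "z_index m w p'") (auto simp: key_def)
    note z1 = z_index_index[OF m z(1)] and z2 = z_index_index[OF m z(2)]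
    have weq: "w (i + k) = w (i' + k)" if "k < N" for k
      using \<open>key p = key p'\<close> that z1 z2 by (auto simp: key_def z win_eq_iff)
    \<comment> \<open>Two enumerations started in the same column before equal stretches of
      \<open>w\<close> stay in the same column and advance rows simultaneously.\<close>
    have sync: "\<exists>d\<le>t. \<exists>l. z_index m w (p + t) = (i + d, l) \<and> z_index m w (p' + t) = (i' + d, l)" if "t \<le> N" for t
      using that
    proof (induction t)
      case 0
      then show ?case using z by simp
    next
      case (Suc t)
      then obtain d l where d: "d \<le> t" "z_index m w (p + t) = (i + d, l)" "z_index m w (p' + t) = (i' + d, l)" by auto
      have "w (i + d) = w (i' + d)" using d Suc by (intro weq) simp
      then show ?case using d by (cases "l < m + w (i + d)") (auto intro: exI[of _ d] exI[of _ "Suc d"])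
    qed
    show ?thesis unfolding win_eq_iff
    proof (intro allI impI)
      fix t assume t: "t < N"
      then obtain d l where d: "d \<le> t" "z_index m w (p + t) = (i + d, l)" "z_index m w (p' + t) = (i' + d, l)" using sync[of t] by auto
      have "w (i + d) = w (i' + d)" using d t by (intro weq) simp
      then show "is_b m w (p + t) = is_b m w (p' + t)" using d by (simp add: is_b_def)
    qed
  qed
  have "key p \<in> {1..m+1} \<times> range (win (\<lambda>k. w (Suc k)) N)" for p
  proof -
    obtain i j where z: "z_index m w p = (i, j)" by fastforce
    have "w i \<le> 1" using bin z_index_index[OF m z] unfolding binary_word_def by force
    then show ?thesis using z_index_index[OF m z] z by (auto simp: key_def)
  qed
  then have sub: "range key \<subseteq> {1..m+1} \<times> range (win (\<lambda>k. w (Suc k)) N)" by blast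
  have fk: "finite (range key)" by (rule finite_subset[OF sub]) (use fin in simp)
  have "range (win (is_b m w) N) \<subseteq> (\<lambda>x. win (is_b m w) N (inv key x)) ` range key"
  proof
    fix u assume "u \<in> range (win (is_b m w) N)"
    then obtain p where p: "u = win (is_b m w) N p" by auto
    have "key (inv key (key p)) = key p" by (simp add: f_inv_into_f)
    then have "u = win (is_b m w) N (inv key (key p))" unfolding p by (intro det) simp
    then show "u \<in> (\<lambda>x. win (is_b m w) N (inv key x)) ` range key" by blast
  qed
  then have sub2: "range (win (is_b m w) N) = (\<lambda>x. win (is_b m w) N (inv key x)) ` range key" by blast
  show "finite (range (win (is_b m w) N))" using sub2 fk by simp
  have "card (range (win (is_b m w) N)) \<le> card (range key)" unfolding sub2 by (rule card_image_le[OF fk])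
  also have "\<dots> \<le> card ({1..m+1} \<times> range (win (\<lambda>k. w (Suc k)) N))"
    by (rule card_mono[OF _ sub]) (use fin in simp)
  also have "\<dots> \<le> (m + 1) * (N + q)" using card by (simp add: card_cartesian_product del: mult_Suc)
  finally show "card (range (win (is_b m w) N)) \<le> (m + 1) * (N + q)" .
qed

section \<open>Ordinary codimensions and the growth of the counts\<close>

lemma supp_basis_vec [simp]: "supp (basis_vec k :: 'b \<Rightarrow> 'a::field) = {k}"
  by (auto simp: supp_def basis_vec_def)

lemma basis_vec_in_carrier [simp]: "basis_vec k \<in> carrier_alg B \<longleftrightarrow> k \<in> B"
  by (simp add: carrier_alg_def)

lemma zero_in_carrier [simp]: "0 \<in> carrier_alg B"
  by (simp add: carrier_alg_def supp_def)

lemma embed_in_carrier: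
  assumes "x \<in> carrier_alg B"
  shows "embed_sharp c x \<in> carrier_alg (basis_sharp B)"
proof -
  have "supp (embed_sharp c x) \<subseteq> insert None (Some ` supp x)"
  proof
    fix z assume "z \<in> supp (embed_sharp c x)"
    then show "z \<in> insert None (Some ` supp x)" by (cases z) (auto simp: supp_def)
  qed
  then show ?thesis using assms finite_supp_embed by (fastforce simp: carrier_alg_def basis_sharp_def)
qed

lemma embed_basis:
  "basis_vec None = embed_sharp 1 0" "basis_vec (Some k) = embed_sharp 0 (basis_vec k)" "0 = embed_sharp 0 0"
  by (auto simp: fun_eq_iff embed_sharp_def basis_vec_def split: option.split)

text \<open>With unit components 0, no variable can be read as the unit, so only data with all
  \<open>n\<close> variables on the path survive.\<close>

lemma codim_bounds:
  fixes m :: nat and w :: "nat \<Rightarrow> nat"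
  assumes m: "m \<ge> 1" and W: "\<And>N. finite (range (win (is_b m w) N))" and n: "n \<ge> 3"
  shows "codim TYPE('a::field) (basisA m w) (multA m w) n \<le> word_count (is_b m w) n"
    "prefix_count (is_b m w) n \<le> codim TYPE('a) (basisA m w) (multA m w) n"
proof -
  interpret path_algebra "multA m w" "z_at m w" "is_b m w" Ga Gb by (rule path_algebra_multA[OF m])
  define D where "D = {v :: nat \<Rightarrow> gen \<Rightarrow> 'a. \<forall>i. v i \<in> carrier_alg (basisA m w)}"
  have fD: "\<forall>v\<in>D. \<forall>i. finite (supp (v i))" by (auto simp: D_def carrier_alg_def)
  have eq: "codim TYPE('a) (basisA m w) (multA m w) n = codim_on (mult_sharp (multA m w)) (emb ` D) n"
    unfolding codim_embed[OF fD] by (simp add: codim_def D_def)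
  have fin: "\<forall>v\<in>emb ` D. \<forall>i. finite (supp (v i))"
    using fD by (auto simp: emb_def intro: finite_supp_embed)
  have zero: "v j None = 0" if "v \<in> emb ` D" for v j using that by (auto simp: emb_def)
  let ?Z = "{(V,u,i,T). (V,u,i,T) \<in> word_data (is_b m w) n \<and> card V \<in> {n} \<and> True}"
  have "finite ?Z" by (rule finite_subset[OF _ finite_word_data[where n=n, OF W]]) auto
  then have "codim_on (mult_sharp (multA m w)) (emb ` D) n \<le> card ?Z + of_bool False"
  proof (rule codim_upper[OF fin W])
    fix V u i T v
    assume a: "(V,u,i,T) \<in> word_data (is_b m w) n" "v \<in> emb ` D" "\<And>j. j \<in> {..<n} - V \<Longrightarrow> v j None \<noteq> 0"
    have "V \<subseteq> {..<n}" using a(1) by (auto simp: word_data_def)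
    moreover have "{..<n} \<subseteq> V" using a(3) zero[OF a(2)] by blast
    ultimately show "(V,u,i,T) \<in> ?Z" using a(1) by auto
  qed (use n zero in auto)
  also have "card ?Z \<le> (\<Sum>N\<in>{n}. \<Sum>u\<in>range (win (is_b m w) (N - 1)). card {x \<in> triples n N (count_b u). True})"
    by (rule card_word_data_le[OF W]) simp
  also have "\<dots> = word_count (is_b m w) n" by (simp add: card_triples word_count_def)
  finally show "codim TYPE('a) (basisA m w) (multA m w) n \<le> word_count (is_b m w) n" unfolding eq by simp
  have "card (triples n n (count_b (win (is_b m w) (n - 1) 0))) \<le> codim_on (mult_sharp (multA m w)) (emb ` D) n"
  proof (rule codim_lower[OF fin W n finite_triples])
    fix U i T assume t: "(U,i,T) \<in> triples n n (count_b (win (is_b m w) (n - 1) 0))"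
    have U: "U = {..<n}" using t card_subset_eq[of "{..<n}" U] by (simp add: triples_def)
    define v :: "nat \<Rightarrow> gen \<Rightarrow> 'a" where "v j = (if j \<ge> n then 0 else if j = i then basis_vec (z_at m w 0)
      else if j \<in> T then basis_vec Gb else basis_vec Ga)" for j
    have "v j \<in> carrier_alg (basisA m w)" for j by (simp add: v_def basisA_z_at[OF m])
    then have "v \<in> D" by (simp add: D_def)
    moreover have "subst_basis n (U,i,T) = emb v"
      by (rule ext) (simp add: emb_def subst_basis_def U v_def embed_basis)
    ultimately show "U \<subseteq> {..<n} \<and> card U = n \<and> i \<in> U \<and> T \<subseteq> U - {i} \<and>
        card T = count_b (win (is_b m w) (n - 1) 0) \<and> subst_basis n (U,i,T) \<in> emb ` D"
      using t by (auto simp: triples_def)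
  qed
  then show "prefix_count (is_b m w) n \<le> codim TYPE('a) (basisA m w) (multA m w) n"
    unfolding eq by (simp add: card_triples prefix_count_def)
qed

text \<open>The square of \<open>N\<close> has one factor from the choice of the first variable and
  one from the linear number of words; each binomial coefficient contributes the exponential
  growth.\<close>

lemma word_count_growth:
  assumes m: "m \<ge> 2" and bw: "binary_word w" and ps: "periodic_word w \<or> sturmian w" and sl: "has_slope w \<alpha>"
  obtains K r where "K > 0" "\<And>N. finite (range (win (is_b m w) N))"
    "\<And>N. N \<ge> 1 \<Longrightarrow> real (word_count (is_b m w) N) \<le> K * real N ^ 2 * Phi (1 / (real m + \<alpha>)) ^ N"
    "\<And>N. N \<ge> 3 \<Longrightarrow> Phi (1 / (real m + \<alpha>)) ^ N \<le> K * real N ^ r * real (prefix_count (is_b m w) N)"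
proof -
  define \<theta> where "\<theta> = 1 / (real m + \<alpha>)"
  have \<alpha>: "\<alpha> \<ge> 0" by (rule slope_nonneg[OF sl])
  have th: "0 < \<theta>" "\<theta> < 1" using m \<alpha> by (simp_all add: \<theta>_def)
  have P: "Phi \<theta> \<ge> 1" by (rule Phi_ge_1[OF th])
  obtain C q where C: "\<And>i n. \<bar>real (\<Sum>k<n. w (Suc (i+k))) - real n * \<alpha>\<bar> \<le> C"
    and fin: "\<And>n. finite (range (win (\<lambda>k. w (Suc k)) n))"
    and card: "\<And>n. card (range (win (\<lambda>k. w (Suc k)) n)) \<le> n + q"
    by (rule word_regularity[OF bw ps sl]) blast
  have m1: "m \<ge> 1" using m by simp
  note W = is_b_words[OF m1 bw fin card]
  define C' where "C' = C + real m + 1"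
  have disc: "\<bar>real (count_b u) - real N * \<theta>\<bar> \<le> C'" if "u \<in> range (win (is_b m w) N)" for u N
    using that is_b_discrepancy[OF m1 bw \<alpha> C] by (auto simp: \<theta>_def C'_def)
  have wtN: "count_b u \<le> N" if "u \<in> range (win (is_b m w) N)" for u N
    using that count_b_le_length[of u] by auto
  obtain K r where K: "K > 0"
    "\<And>n s. n \<ge> 1 \<Longrightarrow> s \<le> n \<Longrightarrow> \<bar>real s - real n * \<theta>\<bar> \<le> C' \<Longrightarrow> real (n choose s) \<le> K * Phi \<theta> ^ n"
    "\<And>n s. n \<ge> 1 \<Longrightarrow> s \<le> n \<Longrightarrow> \<bar>real s - real n * \<theta>\<bar> \<le> C' \<Longrightarrow> Phi \<theta> ^ n \<le> K * real n ^ r * real (n choose s)"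
    using binomial_Phi_bounds[OF th, of C'] by metis
  \<comment> \<open>One constant for both bounds. The first summand bounds the number of words per
    \<open>N\<close>, with \<open>max K 1\<close> covering \<open>N = 1\<close>, where the word is
    empty and \<open>binomial_Phi_bounds\<close> does not apply. The second pays for passing from
    exponent \<open>N - 1\<close> to \<open>N\<close>.\<close>
  define K' where "K' = real ((m + 1) * (1 + q)) * max K 1 + Phi \<theta> * K"
  have up: "real (word_count (is_b m w) N) \<le> K' * real N ^ 2 * Phi \<theta> ^ N" if N: "N \<ge> 1" for N
  proof -
    have b: "real ((N - 1) choose count_b u) \<le> max K 1 * Phi \<theta> ^ N" if u: "u \<in> range (win (is_b m w) (N - 1))" for u
    proof (cases "N = 1")
      case True
      have "real ((N - 1) choose count_b u) \<le> 1" using True by (cases "count_b u") auto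
      also have "1 \<le> max K 1 * Phi \<theta> ^ N" using True P mult_mono[of 1 "max K 1" 1 "Phi \<theta>"] by simp
      finally show ?thesis .
    next
      case False
      have "real ((N - 1) choose count_b u) \<le> K * Phi \<theta> ^ (N - 1)"
        by (rule K(2)) (use False N disc[OF u] wtN[OF u] in auto)
      also have "\<dots> \<le> max K 1 * Phi \<theta> ^ N" using K(1) P by (intro mult_mono power_increasing) auto
      finally show ?thesis .
    qed
    have "real (word_count (is_b m w) N) = (\<Sum>u\<in>range (win (is_b m w) (N - 1)). real N * real ((N - 1) choose count_b u))"
      by (simp add: word_count_def)
    also have "\<dots> \<le> of_nat (card (range (win (is_b m w) (N - 1)))) * (real N * (max K 1 * Phi \<theta> ^ N))"
      by (rule sum_bounded_above) (intro mult_left_mono b; simp)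
    also have "\<dots> \<le> (real ((m + 1) * (1 + q)) * real N) * (real N * (max K 1 * Phi \<theta> ^ N))"
    proof (rule mult_right_mono)
      have "card (range (win (is_b m w) (N - 1))) \<le> (m + 1) * (N - 1 + q)" by (rule W(2))
      also have "\<dots> \<le> (m + 1) * ((1 + q) * N)"
      proof (rule mult_le_mono2)
        have "q \<le> q * N" using N by simp
        then show "N - 1 + q \<le> (1 + q) * N" unfolding add_mult_distrib mult_1 by linarith
      qed
      finally have "card (range (win (is_b m w) (N - 1))) \<le> (m + 1) * (1 + q) * N" by (simp only: mult.assoc)
      then show "of_nat (card (range (win (is_b m w) (N - 1)))) \<le> real ((m + 1) * (1 + q)) * real N"
        by (metis of_nat_le_iff of_nat_mult)
      show "0 \<le> real N * (max K 1 * Phi \<theta> ^ N)" using P by (intro mult_nonneg_nonneg zero_le_power) auto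
    qed
    also have "\<dots> = (real ((m + 1) * (1 + q)) * max K 1) * (real N ^ 2 * Phi \<theta> ^ N)" by (simp add: power2_eq_square mult_ac)
    also have "\<dots> \<le> K' * (real N ^ 2 * Phi \<theta> ^ N)"
      using P K(1) by (intro mult_right_mono) (auto simp: K'_def)
    finally show ?thesis by (simp add: mult.assoc)
  qed
  have lo: "Phi \<theta> ^ N \<le> K' * real N ^ r * real (prefix_count (is_b m w) N)" if N: "N \<ge> 3" for N
  proof -
    let ?u = "win (is_b m w) (N - 1) 0"
    have "Phi \<theta> ^ N = Phi \<theta> * Phi \<theta> ^ (N - 1)" using N by (cases N) auto
    also have "\<dots> \<le> Phi \<theta> * (K * real (N - 1) ^ r * real ((N - 1) choose count_b ?u))"
      using P by (intro mult_left_mono K(3)) (use N disc[of ?u "N-1"] wtN[of ?u "N-1"] in auto)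
    also have "\<dots> \<le> Phi \<theta> * (K * real N ^ r * real (prefix_count (is_b m w) N))"
    proof (intro mult_left_mono mult_mono power_mono)
      have "(N - 1) choose count_b ?u \<le> N * ((N - 1) choose count_b ?u)" using N by simp
      then show "real ((N - 1) choose count_b ?u) \<le> real (prefix_count (is_b m w) N)"
        unfolding prefix_count_def by (rule of_nat_mono)
    qed (use K(1) P in auto)
    also have "\<dots> = (Phi \<theta> * K) * (real N ^ r * real (prefix_count (is_b m w) N))" by simp
    also have "\<dots> \<le> K' * (real N ^ r * real (prefix_count (is_b m w) N))"
      by (intro mult_right_mono) (auto simp: K'_def)
    finally show ?thesis by (simp add: mult.assoc)
  qed
  have "K' > 0" unfolding K'_def using K(1) P by (intro add_nonneg_pos mult_pos_pos mult_nonneg_nonneg) auto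
  then show thesis using that[of K' r] W(1) up lo by (simp add: \<theta>_def)
qed

section \<open>Homogeneous gradings\<close>

text \<open>Splitting \<open>x\<close> by the parity of its basis vectors, the part of the other
  parity lies in \<open>Q\<close>; being the difference of two elements of \<open>P\<close>, it also
  lies in \<open>P\<close>, hence it is 0.\<close>

lemma coefficient_parity:
  fixes P Q :: "('b \<Rightarrow> 'a::field) set"
  assumes sub: "subspace_of P V" "subspace_of Q V" and int: "P \<inter> Q = {0}"
    and hom: "\<And>k. k \<in> B \<Longrightarrow> basis_vec k \<in> P \<union> Q"
    and x: "x \<in> P" "finite (supp x)" "supp x \<subseteq> B" and k: "x k \<noteq> 0"
  shows "basis_vec k \<in> P"
proof -
  have cl: "(\<Sum>i\<in>S. vscale (c i) (basis_vec i)) \<in> R"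
    if "subspace_of R V" "\<And>i. i \<in> S \<Longrightarrow> basis_vec i \<in> R" for R S and c :: "'b \<Rightarrow> 'a"
    using that(2)
    by (induction S rule: infinite_finite_induct) (use that(1) in \<open>auto simp: subspace_of_def simp del: plus_fun_apply\<close>)
  have app: "(\<Sum>i\<in>S. vscale (c i) (basis_vec i)) k = (if k \<in> S then c k else 0)"
    if "finite S" for S k and c :: "'b \<Rightarrow> 'a"
    using that by (induction S rule: finite_induct) (auto simp: vscale_def basis_vec_def)
  define S0 where "S0 = {i \<in> supp x. basis_vec i \<in> P}"
  define S1 where "S1 = {i \<in> supp x. basis_vec i \<notin> P}"
  define y where "y = (\<Sum>i\<in>S0. vscale (x i) (basis_vec i))"
  define z where "z = (\<Sum>i\<in>S1. vscale (x i) (basis_vec i))"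
  have fS: "finite S0" "finite S1" using x by (auto simp: S0_def S1_def)
  have y: "y \<in> P" unfolding y_def by (rule cl[OF sub(1)]) (auto simp: S0_def)
  have zQ: "z \<in> Q" unfolding z_def by (rule cl[OF sub(2)]) (use hom x in \<open>auto simp: S1_def\<close>)
  have "y k = (if k \<in> S0 then x k else 0)" "z k = (if k \<in> S1 then x k else 0)" for k
    by (simp_all add: y_def z_def app fS)
  then have "z = x + vscale (- 1) y"
    by (intro ext) (auto simp: vscale_def S0_def S1_def supp_def)
  moreover have "x + vscale (- 1) y \<in> P" using sub(1) x(1) y by (simp only: subspace_of_def)
  ultimately have "z \<in> P \<inter> Q" using zQ by simp
  then have "z k = 0" using int by simp
  then have "k \<notin> S1" using k by (auto simp: z_def app fS)
  then show ?thesis using k by (auto simp: S1_def supp_def)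
qed

locale graded_word_algebra =
  fixes m :: nat and w :: "nat \<Rightarrow> nat" and A0 A1 :: "(gen \<Rightarrow> 'a::field) set"
  assumes m: "m \<ge> 1"
    and W: "\<And>N. finite (range (win (is_b m w) N))"
    and gr: "Z2_grading (basisA m w) (multA m w) A0 A1"
    and hom: "basis_vec Ga \<in> A0 \<union> A1" "basis_vec Gb \<in> A0 \<union> A1" "basis_vec (Gz 1 1) \<in> A0 \<union> A1"
begin

sublocale path_algebra "multA m w" "z_at m w" "is_b m w" Ga Gb
  by (rule path_algebra_multA[OF m])

lemma vmul_basis: "vmul (multA m w) (basis_vec (z_at m w p)) (basis_vec (label p)) = (basis_vec (z_at m w (Suc p)) :: gen \<Rightarrow> 'a)"
proof
  fix k
  show "vmul (multA m w) (basis_vec (z_at m w p)) (basis_vec (label p)) k = (basis_vec (z_at m w (Suc p)) :: gen \<Rightarrow> 'a) k"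
  proof (cases "k \<in> z_at m w ` range Suc")
    case True
    then obtain q where "k = z_at m w (Suc q)" by auto
    then show ?thesis by (simp add: vmul_step) (auto simp: basis_vec_def inj_eq[OF inj_g])
  next
    case False
    then have "k \<noteq> z_at m w (Suc p)" by auto
    then show ?thesis using vmul_zero[OF False] by (simp add: basis_vec_def)
  qed
qed

text \<open>Homogeneity is assumed for the generators only; each further \<open>z\<close> is the
  previous one times \<open>a\<close> or \<open>b\<close>, so it inherits a parity.\<close>

lemma homogeneous: "k \<in> basisA m w \<Longrightarrow> (basis_vec k :: gen \<Rightarrow> 'a) \<in> A0 \<union> A1"
proof -
  have ltA: "(basis_vec (label p) :: gen \<Rightarrow> 'a) \<in> A0 \<union> A1" for p using hom by (simp add: label_def)
  have "(basis_vec (z_at m w p) :: gen \<Rightarrow> 'a) \<in> A0 \<union> A1" for p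
  proof (induction p)
    case 0
    then show ?case using hom by (simp add: z_at_def)
  next
    case (Suc p)
    then show ?case using ltA[of p] gr unfolding vmul_basis[symmetric, of p] Z2_grading_def by blast
  qed
  then show "k \<in> basisA m w \<Longrightarrow> ?thesis" unfolding basisA_z_at[OF m] using hom by auto
qed

lemma grading_facts:
  "subspace_of A0 (carrier_alg (basisA m w))" "subspace_of A1 (carrier_alg (basisA m w))" "A0 \<inter> A1 = {0}"
  using gr unfolding Z2_grading_def by blast+

definition even_gen :: "gen \<Rightarrow> bool" where "even_gen e \<longleftrightarrow> (basis_vec e :: gen \<Rightarrow> 'a) \<in> A0"

lemma not_even_gen: "e \<in> basisA m w \<Longrightarrow> \<not> even_gen e \<Longrightarrow> (basis_vec e :: gen \<Rightarrow> 'a) \<in> A1"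
  using homogeneous by (auto simp: even_gen_def)

lemma even_gen_if: "x \<in> A0 \<Longrightarrow> x e \<noteq> 0 \<Longrightarrow> even_gen e"
  unfolding even_gen_def
  by (rule coefficient_parity[OF grading_facts homogeneous]) (use grading_facts in \<open>auto simp: subspace_of_def carrier_alg_def\<close>)

lemma not_even_gen_if: "x \<in> A1 \<Longrightarrow> x e \<noteq> 0 \<Longrightarrow> \<not> even_gen e"
proof
  assume x: "x \<in> A1" "x e \<noteq> 0" and ev: "even_gen e"
  have int: "A1 \<inter> A0 = {0}" using grading_facts by blast
  have hom': "k \<in> basisA m w \<Longrightarrow> basis_vec k \<in> A1 \<union> A0" for k using homogeneous[of k] by blast
  have "basis_vec e \<in> A1"
    by (rule coefficient_parity[OF grading_facts(2,1) int hom' x(1) _ _ x(2)]) (use x grading_facts in \<open>auto simp: subspace_of_def carrier_alg_def\<close>)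
  then have "(basis_vec e :: gen \<Rightarrow> 'a) = 0" using ev grading_facts(3) by (auto simp: even_gen_def)
  then have "(basis_vec e :: gen \<Rightarrow> 'a) e = 0" by simp
  then show False by (simp add: basis_vec_def)
qed

lemma gens_in_basis: "Ga \<in> basisA m w" "Gb \<in> basisA m w" "z_at m w p \<in> basisA m w"
  by (auto simp: basisA_z_at[OF m])

abbreviation "B \<equiv> basisA m w"

definition Dsharp :: "nat \<Rightarrow> nat \<Rightarrow> (nat \<Rightarrow> gen option \<Rightarrow> 'a) set" where
  "Dsharp k n = {v. (\<forall>i. v i \<in> carrier_alg (basis_sharp B)) \<and> (\<forall>i<k. v i \<in> even_sharp A0) \<and>
     (\<forall>i. k \<le> i \<and> i < n \<longrightarrow> v i \<in> odd_sharp A1)}"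

definition Dgr :: "nat \<Rightarrow> nat \<Rightarrow> (nat \<Rightarrow> gen \<Rightarrow> 'a) set" where
  "Dgr k n = {v. (\<forall>i. v i \<in> carrier_alg B) \<and> (\<forall>i<k. v i \<in> A0) \<and> (\<forall>i. k \<le> i \<and> i < n \<longrightarrow> v i \<in> A1)}"

lemma emb_Dgr: "emb ` Dgr k n \<subseteq> Dsharp k n"
  by (auto simp: Dgr_def Dsharp_def emb_def even_sharp_def odd_sharp_def intro: embed_in_carrier)

lemma Dsharp_unit: "v \<in> Dsharp k n \<Longrightarrow> j < n \<Longrightarrow> v j None \<noteq> 0 \<Longrightarrow> j < k"
proof (rule ccontr)
  assume "v \<in> Dsharp k n" "j < n" "v j None \<noteq> 0" "\<not> j < k"
  moreover from this have "v j \<in> odd_sharp A1" by (simp add: Dsharp_def)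
  ultimately show False by (auto simp: odd_sharp_def)
qed

lemma Dsharp_parity:
  assumes "v \<in> Dsharp k n" "j < n" "v j (Some e) \<noteq> 0"
  shows "j < k \<longleftrightarrow> even_gen e"
proof (cases "j < k")
  case True
  then obtain c x where "v j = embed_sharp c x" "x \<in> A0" using assms by (auto simp: Dsharp_def even_sharp_def)
  then show ?thesis using True assms even_gen_if by auto
next
  case False
  then have "v j \<in> odd_sharp A1" using assms by (simp add: Dsharp_def)
  then obtain x where "v j = embed_sharp 0 x" "x \<in> A1" by (auto simp: odd_sharp_def)
  then show ?thesis using False assms not_even_gen_if by auto
qed

text \<open>Common to the algebra with and without unit; the set of admissible sizes of
  \<open>V\<close> is what distinguishes them. The predicate \<open>Q\<close> is trivial because the
  first variable may be replaced by combinations of different \<open>z\<close>'s, whose parity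
  varies along the path.\<close>

lemma codim_gr_bound:
  assumes D: "D \<subseteq> Dsharp k n" and \<N>: "finite \<N>"
    and N: "\<And>V v. V \<subseteq> {..<n} \<Longrightarrow> V \<noteq> {} \<Longrightarrow> v \<in> D \<Longrightarrow> (\<And>j. j \<in> {..<n} - V \<Longrightarrow> v j None \<noteq> 0) \<Longrightarrow> card V \<in> \<N>"
    and h: "\<not> h \<Longrightarrow> n \<ge> 2 \<and> (\<forall>v\<in>D. \<forall>i<n. v i None = 0)"
  shows "codim_on (mult_sharp (multA m w)) D n \<le> (\<Sum>N\<in>\<N>. \<Sum>u\<in>range (win (is_b m w) (N - 1)).
      card {x \<in> triples n N (count_b u). parity_compat (even_gen Ga) (even_gen Gb) (\<lambda>_. True) n {..<k} x}) + of_bool h"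
proof -
  let ?Z = "{(V,u,i,T). (V,u,i,T) \<in> word_data (is_b m w) n \<and> card V \<in> \<N> \<and>
     parity_compat (even_gen Ga) (even_gen Gb) (\<lambda>_. True) n {..<k} (V,i,T)}"
  have fin: "\<forall>v\<in>D. \<forall>i. finite (supp (v i))" using D by (auto simp: Dsharp_def carrier_alg_def)
  have "finite ?Z" by (rule finite_subset[OF _ finite_word_data[OF W]]) auto
  then have "codim_on (mult_sharp (multA m w)) D n \<le> card ?Z + of_bool h"
  proof (rule codim_upper[OF fin W _ _ h])
    fix V u i T v
    assume a: "(V,u,i,T) \<in> word_data (is_b m w) n" "v \<in> D" "\<And>j. j \<in> {..<n} - V \<Longrightarrow> v j None \<noteq> 0"
      "\<And>j. j \<in> T \<Longrightarrow> v j (Some Gb) \<noteq> 0" "\<And>j. j \<in> V - {i} - T \<Longrightarrow> v j (Some Ga) \<noteq> 0"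
    have V: "V \<subseteq> {..<n}" "i \<in> V" "T \<subseteq> V - {i}" using a(1) by (auto simp: word_data_def)
    have vD: "v \<in> Dsharp k n" using a D by blast
    have "card V \<in> \<N>" using N[OF V(1) _ a(2,3)] V(2) by blast
    moreover have "parity_compat (even_gen Ga) (even_gen Gb) (\<lambda>_. True) n {..<k} (V,i,T)"
    proof -
      have "j < k" if "j \<in> {..<n} - V" for j using Dsharp_unit[OF vD, of j] a(3)[OF that] that by simp
      moreover have "(j < k) = even_gen Gb" if "j \<in> T" for j
        using Dsharp_parity[OF vD _ a(4)[OF that]] V that by auto
      moreover have "(j < k) = even_gen Ga" if "j \<in> V - {i} - T" for j
        using Dsharp_parity[OF vD _ a(5)[OF that]] V that by auto
      ultimately show ?thesis by (simp add: parity_compat_def)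
    qed
    ultimately show "(V,u,i,T) \<in> ?Z" using a(1) by simp
  qed
  also have "card ?Z \<le> (\<Sum>N\<in>\<N>. \<Sum>u\<in>range (win (is_b m w) (N - 1)).
      card {x \<in> triples n N (count_b u). parity_compat (even_gen Ga) (even_gen Gb) (\<lambda>_. True) n {..<k} x})"
    by (rule card_word_data_le[OF W \<N>])
  finally show ?thesis by simp
qed

lemma codim_gr_sharp_eq:
  "codim_gr (basis_sharp B) (mult_sharp (multA m w)) (even_sharp A0) (odd_sharp A1) n =
    (\<Sum>k\<le>n. (n choose k) * codim_on (mult_sharp (multA m w)) (Dsharp k n) n)"
  by (simp add: codim_gr_def codim_gr_kn_def Dsharp_def)

lemma codim_gr_eq:
  "codim_gr B (multA m w) A0 A1 n = (\<Sum>k\<le>n. (n choose k) * codim_on (mult_sharp (multA m w)) (emb ` Dgr k n) n)"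
proof -
  have "\<forall>v\<in>Dgr k n. \<forall>i. finite (supp (v i))" for k by (auto simp: Dgr_def carrier_alg_def)
  then have "codim_gr_kn B (multA m w) A0 A1 k n = codim_on (mult_sharp (multA m w)) (emb ` Dgr k n) n" for k
    by (subst codim_embed) (auto simp: codim_gr_kn_def Dgr_def)
  then show ?thesis by (simp add: codim_gr_def)
qed

lemma codim_gr_sharp_upper:
  "codim_gr (basis_sharp B) (mult_sharp (multA m w)) (even_sharp A0) (odd_sharp A1) n \<le>
     2 * (\<Sum>N\<in>{1..n}. (n choose N) * word_count (is_b m w) N) + 2 ^ n"
proof -
  have "codim_on (mult_sharp (multA m w)) (Dsharp k n) n \<le> (\<Sum>N\<in>{1..n}. \<Sum>u\<in>range (win (is_b m w) (N - 1)).
      card {x \<in> triples n N (count_b u). parity_compat (even_gen Ga) (even_gen Gb) (\<lambda>_. True) n {..<k} x}) + of_bool True" for k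
  proof (rule codim_gr_bound)
    fix V assume "V \<subseteq> {..<n}" "V \<noteq> {}"
    then show "card V \<in> {1..n}"
      using card_mono[of "{..<n}" V] by (auto simp: Suc_le_eq card_gt_0_iff finite_subset)
  qed auto
  then have "(\<Sum>k\<le>n. (n choose k) * codim_on (mult_sharp (multA m w)) (Dsharp k n) n)
      \<le> 2 * (\<Sum>N\<in>{1..n}. (n choose N) * word_count (is_b m w) N) + 1 * 2 ^ n"
    by (intro weighted_sum_upper) simp
  then show ?thesis unfolding codim_gr_sharp_eq by simp
qed

lemma codim_gr_upper:
  assumes "n \<ge> 2"
  shows "codim_gr B (multA m w) A0 A1 n \<le> 2 * word_count (is_b m w) n"
proof -
  have "codim_on (mult_sharp (multA m w)) (emb ` Dgr k n) n \<le> (\<Sum>N\<in>{n}. \<Sum>u\<in>range (win (is_b m w) (N - 1)).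
      card {x \<in> triples n N (count_b u). parity_compat (even_gen Ga) (even_gen Gb) (\<lambda>_. True) n {..<k} x}) + of_bool False" for k
  proof (rule codim_gr_bound[OF emb_Dgr])
    fix V :: "nat set" and v :: "nat \<Rightarrow> gen option \<Rightarrow> 'a"
    assume a: "V \<subseteq> {..<n}" "v \<in> emb ` Dgr k n" "\<And>j. j \<in> {..<n} - V \<Longrightarrow> v j None \<noteq> 0"
    have "v j None = 0" for j using a(2) by (auto simp: emb_def)
    then have "V = {..<n}" using a(1,3) by blast
    then show "card V \<in> {n}" by simp
  qed (use assms in \<open>auto simp: emb_def\<close>)
  then have "(\<Sum>k\<le>n. (n choose k) * codim_on (mult_sharp (multA m w)) (emb ` Dgr k n) n)
      \<le> 2 * (\<Sum>N\<in>{n}. (n choose N) * word_count (is_b m w) N) + 0 * 2 ^ n"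
    by (intro weighted_sum_upper) simp
  then show ?thesis unfolding codim_gr_eq by simp
qed

lemma subst_basis_parity:
  assumes t: "(U,i,T) \<in> triples n N s" and c: "parity_compat (even_gen Ga) (even_gen Gb) (\<lambda>c. c = even_gen (z_at m w 0)) n {..<k} (U,i,T)"
    and j: "j < n" "j \<in> U"
  obtains e where "subst_basis n (U,i,T) j = (basis_vec (Some e) :: gen option \<Rightarrow> 'a)" "e \<in> B" "even_gen e \<longleftrightarrow> j < k"
proof -
  consider "j = i" | "j \<in> T" "j \<noteq> i" | "j \<in> U - {i} - T" using j by blast
  then show thesis
  proof cases
    case 1
    then show thesis using that[of "z_at m w 0"] c j gens_in_basis by (auto simp: subst_basis_def parity_compat_def)
  next
    case 2
    then show thesis using that[of Gb] c j gens_in_basis by (auto simp: subst_basis_def parity_compat_def)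
  next
    case 3
    then show thesis using that[of Ga] c j gens_in_basis by (auto simp: subst_basis_def parity_compat_def)
  qed
qed

lemma subst_basis_in_Dsharp:
  assumes t: "(U,i,T) \<in> triples n N s" and c: "parity_compat (even_gen Ga) (even_gen Gb) (\<lambda>c. c = even_gen (z_at m w 0)) n {..<k} (U,i,T)"
    and k: "k \<le> n"
  shows "subst_basis n (U,i,T) \<in> Dsharp k n"
proof -
  have z: "0 \<in> A0" "0 \<in> A1" using grading_facts by (auto simp: subspace_of_def)
  have "(subst_basis n (U,i,T) j :: gen option \<Rightarrow> 'a) \<in> carrier_alg (basis_sharp B) \<and> (j < k \<longrightarrow> subst_basis n (U,i,T) j \<in> even_sharp A0)
     \<and> (k \<le> j \<and> j < n \<longrightarrow> subst_basis n (U,i,T) j \<in> odd_sharp A1)" for j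
  proof -
    consider "j \<ge> n" | "j < n" "j \<notin> U" | "j < n" "j \<in> U" by linarith
    then show ?thesis
    proof cases
      case 1
      then show ?thesis using k by (simp add: subst_basis_def)
    next
      case 2
      then have "j < k" using c by (auto simp: parity_compat_def)
      moreover have one: "subst_basis n (U,i,T) j = (embed_sharp 1 0 :: gen option \<Rightarrow> 'a)" using 2 by (simp add: subst_basis_def embed_basis)
      ultimately show ?thesis unfolding one using z by (auto simp: even_sharp_def intro!: embed_in_carrier)
    next
      case 3
      obtain e where e: "subst_basis n (U,i,T) j = (basis_vec (Some e) :: gen option \<Rightarrow> 'a)" "e \<in> B" "even_gen e \<longleftrightarrow> j < k"
        by (rule subst_basis_parity[OF t c 3])
      show ?thesis unfolding e(1) embed_basis(2) using e(2,3) not_even_gen[of e]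
        by (auto simp: even_sharp_def odd_sharp_def even_gen_def intro!: embed_in_carrier)
    qed
  qed
  then show ?thesis by (simp add: Dsharp_def)
qed

lemma subst_basis_in_Dgr:
  assumes t: "(U,i,T) \<in> triples n n s" and c: "parity_compat (even_gen Ga) (even_gen Gb) (\<lambda>c. c = even_gen (z_at m w 0)) n {..<k} (U,i,T)"
    and k: "k \<le> n"
  shows "subst_basis n (U,i,T) \<in> emb ` Dgr k n"
proof
  let ?v = "\<lambda>j. (subst_basis n (U,i,T) j :: gen option \<Rightarrow> 'a) \<circ> Some"
  have U: "U = {..<n}" using t card_subset_eq[of "{..<n}" U] by (simp add: triples_def)
  have e: "(\<exists>e\<in>B. subst_basis n (U,i,T) j = (basis_vec (Some e) :: gen option \<Rightarrow> 'a) \<and> (even_gen e \<longleftrightarrow> j < k))" if "j < n" for j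
    using subst_basis_parity[OF t c \<open>j < n\<close>] that U by blast
  have z: "subst_basis n (U,i,T) j = (0 :: gen option \<Rightarrow> 'a)" if "\<not> j < n" for j using that by (simp add: subst_basis_def)
  show "subst_basis n (U,i,T) = emb ?v"
  proof
    fix j
    show "subst_basis n (U,i,T) j = emb ?v j"
      using e[of j] z[of j] by (cases "j < n") (auto simp: emb_def embed_basis comp_def embed_sharp_def fun_eq_iff split: option.split)
  qed
  have "?v j \<in> carrier_alg B \<and> (j < k \<longrightarrow> ?v j \<in> A0) \<and> (k \<le> j \<and> j < n \<longrightarrow> ?v j \<in> A1)" for j
  proof (cases "j < n")
    case True
    then obtain e where e: "e \<in> B" "subst_basis n (U,i,T) j = (basis_vec (Some e) :: gen option \<Rightarrow> 'a)" "even_gen e \<longleftrightarrow> j < k"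
      using e by blast
    have "?v j = basis_vec e" unfolding e(2) by (simp add: embed_basis)
    then show ?thesis using e not_even_gen[of e] by (auto simp: even_gen_def)
  next
    case False
    have "?v j = 0" using z[OF False] by (simp add: fun_eq_iff)
    then show ?thesis using False k by simp
  qed
  then show "?v \<in> Dgr k n" by (simp add: Dgr_def)
qed

text \<open>Here the start vertex is fixed to the initial \<open>z\<close>, so its parity can be
  prescribed for the first variable and the test substitutions are homogeneous.\<close>

lemma codim_gr_sharp_lower:
  assumes "N \<ge> 3"
  shows "(n choose N) * prefix_count (is_b m w) N \<le> codim_gr (basis_sharp B) (mult_sharp (multA m w)) (even_sharp A0) (odd_sharp A1) n"
  unfolding codim_gr_sharp_eq
proof (rule weighted_sum_lower[where pa="even_gen Ga" and pb="even_gen Gb" and pz="even_gen (z_at m w 0)"])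
  fix k assume k: "k \<le> n"
  have "\<forall>v\<in>Dsharp k n. \<forall>i. finite (supp (v i))" by (auto simp: Dsharp_def carrier_alg_def)
  then show "card {x \<in> triples n N (count_b (win (is_b m w) (N - 1) 0)). parity_compat (even_gen Ga) (even_gen Gb) (\<lambda>c. c = even_gen (z_at m w 0)) n {..<k} x}
      \<le> codim_on (mult_sharp (multA m w)) (Dsharp k n) n"
    by (rule codim_lower[OF _ W assms])
      (use finite_triples subst_basis_in_Dsharp[OF _ _ k] in \<open>auto simp: triples_def\<close>)
qed

lemma codim_gr_lower:
  assumes "n \<ge> 3"
  shows "prefix_count (is_b m w) n \<le> codim_gr B (multA m w) A0 A1 n"
proof -
  have "(n choose n) * prefix_count (is_b m w) n \<le> codim_gr B (multA m w) A0 A1 n"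
    unfolding codim_gr_eq
  proof (rule weighted_sum_lower[where pa="even_gen Ga" and pb="even_gen Gb" and pz="even_gen (z_at m w 0)"])
    fix k assume k: "k \<le> n"
    have "\<forall>v\<in>emb ` Dgr k n. \<forall>i. finite (supp (v i))"
      by (auto simp: Dgr_def carrier_alg_def emb_def intro: finite_supp_embed)
    then show "card {x \<in> triples n n (count_b (win (is_b m w) (n - 1) 0)). parity_compat (even_gen Ga) (even_gen Gb) (\<lambda>c. c = even_gen (z_at m w 0)) n {..<k} x}
        \<le> codim_on (mult_sharp (multA m w)) (emb ` Dgr k n) n"
      by (rule codim_lower[OF _ W assms])
        (use finite_triples subst_basis_in_Dgr[OF _ _ k] in \<open>auto simp: triples_def\<close>)
  qed
  then show ?thesis by simp
qed

end

theorem theorem5: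
  fixes m :: nat and w :: "nat \<Rightarrow> nat" and \<alpha> :: real
    and A0 A1 :: "(gen \<Rightarrow> 'a::field_char_0) set"
  assumes "m \<ge> 2"
    and "binary_word w"
    and "periodic_word w \<or> sturmian w"
    and "has_slope w \<alpha>"
    and "Z2_grading (basisA m w) (multA m w) A0 A1"
    and "basis_vec Ga \<in> A0 \<union> A1" and "basis_vec Gb \<in> A0 \<union> A1"
    and "basis_vec (Gz 1 1) \<in> A0 \<union> A1"
  shows "((\<lambda>n. root n (real (codim_gr (basisA m w) (multA m w) A0 A1 n)))
            \<longlonglongrightarrow> Phi (1 / (m + \<alpha>))) \<and>
         ((\<lambda>n. root n (real (codim TYPE('a) (basisA m w) (multA m w) n)))
            \<longlonglongrightarrow> Phi (1 / (m + \<alpha>))) \<and>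
         ((\<lambda>n. root n (real (codim_gr (basis_sharp (basisA m w)) (mult_sharp (multA m w))
                                     (even_sharp A0) (odd_sharp A1) n)))
            \<longlonglongrightarrow> Phi (1 / (m + \<alpha>)) + 1)"
proof -
  define P where "P = Phi (1 / (m + \<alpha>))"
  obtain K r where K: "K > 0" and W: "\<And>N. finite (range (win (is_b m w) N))"
    and up: "\<And>N. N \<ge> 1 \<Longrightarrow> real (word_count (is_b m w) N) \<le> K * real N ^ 2 * P ^ N"
    and lo: "\<And>N. N \<ge> 3 \<Longrightarrow> P ^ N \<le> K * real N ^ r * real (prefix_count (is_b m w) N)"
    unfolding P_def by (rule word_count_growth[OF assms(1-4)]) blast
  have P: "P \<ge> 1" unfolding P_def using assms(1) slope_nonneg[OF assms(4)] by (intro Phi_ge_1) auto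
  have m1: "m \<ge> 1" using assms(1) by simp
  interpret graded_word_algebra m w A0 A1
    by unfold_locales (use m1 W assms in auto)
  \<comment> \<open>Shared by the graded and the ordinary codimensions; the factor 2 is the possible
    loss through the free parity of the first variable.\<close>
  have lim: "(\<lambda>n. root n (real (f n))) \<longlonglongrightarrow> P"
    if f: "\<And>n. n \<ge> 3 \<Longrightarrow> f n \<le> 2 * word_count (is_b m w) n" "\<And>n. n \<ge> 3 \<Longrightarrow> prefix_count (is_b m w) n \<le> f n" for f
  proof (rule root_sandwich_degrees[where K="2*K" and K'=K and r=2 and r'=r])
    fix n :: nat assume n: "n \<ge> 3"
    have "real (f n) \<le> 2 * real (word_count (is_b m w) n)" using of_nat_mono[OF f(1)[OF n], where 'a=real] by simp
    also have "\<dots> \<le> 2 * (K * real n ^ 2 * P ^ n)" using up[of n] n by simp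
    finally show "real (f n) \<le> 2 * K * real n ^ 2 * P ^ n" by simp
    have "K * real n ^ r * real (prefix_count (is_b m w) n) \<le> K * real n ^ r * real (f n)"
      using f(2)[OF n] K by (intro mult_left_mono) auto
    with lo[OF n] show "P ^ n \<le> K * real n ^ r * real (f n)" by simp
  qed (use P K in auto)
  have 1: "(\<lambda>n. root n (real (codim_gr (basisA m w) (multA m w) A0 A1 n))) \<longlonglongrightarrow> P"
    by (rule lim) (use codim_gr_upper codim_gr_lower in auto)
  have 2: "(\<lambda>n. root n (real (codim TYPE('a) (basisA m w) (multA m w) n))) \<longlonglongrightarrow> P"
  proof (rule lim)
    fix n :: nat assume n: "n \<ge> 3"
    show "codim TYPE('a) (basisA m w) (multA m w) n \<le> 2 * word_count (is_b m w) n"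
      using codim_bounds(1)[OF m1 W n, where 'a='a] by simp
    show "prefix_count (is_b m w) n \<le> codim TYPE('a) (basisA m w) (multA m w) n"
      by (rule codim_bounds(2)[OF m1 W n])
  qed
  have 3: "(\<lambda>n. root n (real (codim_gr (basis_sharp (basisA m w)) (mult_sharp (multA m w))
      (even_sharp A0) (odd_sharp A1) n))) \<longlonglongrightarrow> P + 1"
    by (rule root_limit_sharp[OF P K _ codim_gr_sharp_lower up lo]) (intro of_nat_mono codim_gr_sharp_upper)
  show ?thesis using 1 2 3 unfolding P_def by blast
qed

end
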